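(* Let $m\ge1$, $1\le r\le\infty$ with conjugate exponent $r'$, and $0<p<\infty$. (i) Let $1\le q<\infty$ and suppose that either $r=2$ and $p,q<2$; or $r=2$ and $q\le p$; or $p<r'<2$ and $q\le 2$. If $X$ is an $\mathcal L_q^g$-space, then there are constants $0<a\le b<\infty$, independent of $N$ and $T$, such that for every $N\ge1$ and every $T\in\mathcal L(^m\ell_r^N;X)$, $$a\,I_p(T)\le\pi_p(T)\le b\,I_p(T),\qquad I_p(T)=\Big(\int_{\mathbb K^N}\dots\int_{\mathbb K^N}\|T(z^{(1)},\dots,z^{(m)})\|_X^p\,d\mu^N_{r'}(z^{(1)})\dots d\mu^N_{r'}(z^{(m)})\Big)^{1/p}.$$ That is, the multiple $p$-summing norm and the $L_p(\mathbb K^N\times\dots\times\mathbb K^N,\mu_{r'}^N\times\dots\times\mu_{r'}^N)$ norm are equivalent on $\mathcal L(^m\ell_r^N;X)$ with constants independent of $N$. (ii) If $r=2$ or $p<r'<2$, then for any Banach space $X$ there is a constant $a>0$, independent of $N$ and $T$, such that $\pi_p(T)\ge a\,I_p(T)$ for every $N\ge 1$ and every $T\in\mathcal L(^m\ell_r^N;X)$, with $I_p(T)$ given by the same formula.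
   Context: $\mathbb K=\mathbb R$ or $\mathbb C$; $\ell_r^N$ is $\mathbb K^N$ with the $\ell_r$-norm; $1/r+1/r'=1$. $\mathcal L(^mE;F)$ is the space of continuous $m$-linear maps $E\times\dots\times E\to F$ between Banach spaces. Multiple summing norm: for a continuous $m$-linear $T:E_1\times\dots\times E_m\to F$, $\pi_p(T)$ is the infimum of all $C>0$ such that for all finite sequences $(x^k_{j_k})_{j_k=1}^{J_k}\subset E_k$, $k=1,\dots,m$, $$\Big(\sum_{j_1,\dots,j_m}\|T(x^1_{j_1},\dots,x^m_{j_m})\|_F^p\Big)^{1/p}\le C\,w_p((x^1_{j})_{j})\cdots w_p((x^m_{j})_{j}),\qquad w_p((y_j)_j)=\sup_{\gamma\in B_{E'}}\Big(\sum_j|\gamma(y_j)|^p\Big)^{1/p}.$$ $\mathcal L_q^g$-spaces: a normed space $X$ is an $\mathcal L_{q,\lambda}^g$-space ($1\le\lambda<\infty$) if for each finite dimensional subspace $M\subset X$ and each $\varepsilon>0$ there are $k\in\mathbb N$ and linear operators $R:M\to\ell_q^k$, $S:\ell_q^k\to X$ with $S\circ R$ equal to the inclusion $M\hookrightarrow X$ and $\|S\|\,\|R\|\le\lambda+\varepsilon$. $X$ is an $\mathcal L_q^g$-space if it is an $\mathcal L_{q,\lambda}^g$-space for some $\lambda\ge1$. Stable measures: for $0<s<2$, $\mu_s^1$ is the $s$-stable Lévy measure on $\mathbb K$, i.e. the Borel probability measure with $\int_{\mathbb K}e^{i\,\mathrm{Re}(z\bar w)}d\mu_s^1(z)=e^{-|w|^s}$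 for all $w\in\mathbb K$; $\mu_2^1$ is the standard Gaussian measure on $\mathbb K$; $\mu_s^N$ is the $N$-fold product of $\mu_s^1$ on $\mathbb K^N$. *)

theory Defs
  imports "HOL-Probability.Probability" "HOL-Library.Function_Algebras"
begin

text \<open>
  The scalar field \<open>\<K>\<close> is a type \<open>'k :: {real_normed_field, euclidean_space}\<close>. Up to isometric
  isomorphism (Frobenius) the only such fields are \<open>real\<close> and \<open>complex\<close>, and in both of them
  \<open>z \<bullet> w = Re (z * cnj w)\<close>.

  A normed space is given by a carrier inside an additive group, since \<open>\<ell>\<^sub>r\<^sup>N\<close> is needed for
  varying \<open>N\<close> and finite dimensional subspaces have to be treated as spaces of their own.
\<close>

record ('k, 'v) nspace =
  pts :: "'v set"
  smul :: "'k \<Rightarrow> 'v \<Rightarrow> 'v"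
  nm :: "'v \<Rightarrow> real"

definition ntop :: "('k, 'v::ab_group_add) nspace \<Rightarrow> 'v topology" where
  "ntop E = Metric_space.mtopology (pts E) (\<lambda>x y. nm E (x - y))"

definition lin_map ::
  "('k, 'v::ab_group_add) nspace \<Rightarrow> ('k, 'w::ab_group_add) nspace \<Rightarrow> ('v \<Rightarrow> 'w) \<Rightarrow> bool" where
  "lin_map E F f \<longleftrightarrow> f \<in> pts E \<rightarrow> pts F
     \<and> (\<forall>x\<in>pts E. \<forall>y\<in>pts E. f (x + y) = f x + f y)
     \<and> (\<forall>c. \<forall>x\<in>pts E. f (smul E c x) = smul F c (f x))"

definition op_norm :: "('k, 'v) nspace \<Rightarrow> ('k, 'w) nspace \<Rightarrow> ('v \<Rightarrow> 'w) \<Rightarrow> ennreal" where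
  "op_norm E F f = (SUP x\<in>{x \<in> pts E. nm E x \<le> 1}. ennreal (nm F (f x)))"

text \<open>A normed \<open>\<K>\<close>-vector space whose carrier is a whole type, with the norm of the type class.\<close>

locale normed_space_over = vector_space sc
  for sc :: "'k::real_normed_field \<Rightarrow> 'x::real_normed_vector \<Rightarrow> 'x" +
  assumes norm_sc: "norm (sc c x) = norm c * norm x"
    and sc_of_real: "sc (of_real t) x = t *\<^sub>R x"

definition whole :: "('k \<Rightarrow> 'x::real_normed_vector \<Rightarrow> 'x) \<Rightarrow> ('k, 'x) nspace" where
  "whole sc = \<lparr>pts = UNIV, smul = sc, nm = norm\<rparr>"

definition dual_ball :: "('k::real_normed_field, 'v::ab_group_add) nspace \<Rightarrow> ('v \<Rightarrow> 'k) set" where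
  "dual_ball E = {\<gamma>. lin_map E (whole (*)) \<gamma> \<and> op_norm E (whole (*)) \<gamma> \<le> 1}"

text \<open>\<open>\<K>\<^sup>N\<close> consists of the sequences vanishing from index \<open>N\<close> on.\<close>

definition ell :: "ennreal \<Rightarrow> nat \<Rightarrow> ('k::real_normed_field, nat \<Rightarrow> 'k) nspace" where
  "ell r N = \<lparr>pts = {x. \<forall>i\<ge>N. x i = 0},
     smul = (\<lambda>c x i. c * x i),
     nm = (\<lambda>x. if r = \<infinity> then Max (insert 0 ((\<lambda>i. norm (x i)) ` {..<N}))
               else (\<Sum>i<N. norm (x i) powr enn2real r) powr (1 / enn2real r))\<rparr>"

text \<open>
  \<open>m\<close>-linear maps act on extensional families indexed by \<open>{..<m}\<close>; their values at other
  arguments are never used.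
\<close>

definition cont_multilinear ::
  "nat \<Rightarrow> (nat \<Rightarrow> ('k, 'v::ab_group_add) nspace) \<Rightarrow> ('k, 'w::ab_group_add) nspace
     \<Rightarrow> ((nat \<Rightarrow> 'v) \<Rightarrow> 'w) set" where
  "cont_multilinear m E F =
     {T. continuous_map (product_topology (\<lambda>k. ntop (E k)) {..<m}) (ntop F) T
       \<and> (\<forall>x \<in> (\<Pi>\<^sub>E k\<in>{..<m}. pts (E k)). \<forall>k<m. lin_map (E k) F (\<lambda>u. T (x(k := u))))}"

definition weak_norm ::
  "real \<Rightarrow> ('k::real_normed_field, 'v::ab_group_add) nspace \<Rightarrow> nat \<Rightarrow> (nat \<Rightarrow> 'v) \<Rightarrow> ennreal" where
  "weak_norm p E J y = (SUP \<gamma>\<in>dual_ball E. ennreal ((\<Sum>j<J. norm (\<gamma> (y j)) powr p) powr (1 / p)))"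

text \<open>The value is \<open>\<infinity>\<close> if no constant \<open>C\<close> is admissible.\<close>

definition multiple_summing_norm ::
  "real \<Rightarrow> nat \<Rightarrow> (nat \<Rightarrow> ('k::real_normed_field, 'v::ab_group_add) nspace)
     \<Rightarrow> ('k, 'w) nspace \<Rightarrow> ((nat \<Rightarrow> 'v) \<Rightarrow> 'w) \<Rightarrow> ennreal" where
  "multiple_summing_norm p m E F T =
     Inf {ennreal C | C. 0 < C \<and>
       (\<forall>J x. (\<forall>k<m. \<forall>j<J k. x k j \<in> pts (E k)) \<longrightarrow>
          ennreal ((\<Sum>j \<in> (\<Pi>\<^sub>E k\<in>{..<m}. {..<J k}).
                      nm F (T (\<lambda>k\<in>{..<m}. x k (j k))) powr p) powr (1 / p))
            \<le> ennreal C * (\<Prod>k<m. weak_norm p (E k) (J k) (x k)))}"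

definition Lg_space_const ::
  "real \<Rightarrow> real \<Rightarrow> ('k::real_normed_field \<Rightarrow> 'x::real_normed_vector \<Rightarrow> 'x) \<Rightarrow> bool" where
  "Lg_space_const q \<Lambda> sc \<longleftrightarrow>
     (\<forall>M. module.subspace sc M \<and> (\<exists>B. finite B \<and> module.span sc B = M) \<longrightarrow>
        (\<forall>\<epsilon>>0. \<exists>k R S.
           lin_map ((whole sc)\<lparr>pts := M\<rparr>) (ell (ennreal q) k) R
         \<and> lin_map (ell (ennreal q) k) (whole sc) S
         \<and> (\<forall>x\<in>M. S (R x) = x)
         \<and> op_norm (ell (ennreal q) k) (whole sc) S
             * op_norm ((whole sc)\<lparr>pts := M\<rparr>) (ell (ennreal q) k) R \<le> ennreal (\<Lambda> + \<epsilon>)))"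

definition Lg_space ::
  "real \<Rightarrow> ('k::real_normed_field \<Rightarrow> 'x::real_normed_vector \<Rightarrow> 'x) \<Rightarrow> bool" where
  "Lg_space q sc \<longleftrightarrow> (\<exists>\<Lambda>\<ge>1. Lg_space_const q \<Lambda> sc)"

text \<open>For \<open>\<K> = \<complex>\<close>, real and imaginary part are independent standard normal variables.\<close>

definition std_gaussian :: "'k::euclidean_space measure" where
  "std_gaussian = density lborel
     (\<lambda>z. ennreal ((2 * pi) powr (- real DIM('k) / 2) * exp (- (norm z)\<^sup>2 / 2)))"

text \<open>
  \<open>\<mu> = \<mu>\<^sub>s\<^sup>1\<close>, for \<open>0 < s \<le> 2\<close>. A finite measure on a Euclidean space is determined by its
  characteristic function, so there is at most one such \<open>\<mu>\<close>.
\<close>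

definition stable_measure :: "real \<Rightarrow> 'k::euclidean_space measure \<Rightarrow> bool" where
  "stable_measure s \<mu> \<longleftrightarrow>
     (s = 2 \<and> \<mu> = std_gaussian) \<or>
     (0 < s \<and> s < 2 \<and> prob_space \<mu> \<and> sets \<mu> = sets borel \<and>
       (\<forall>w. (LINT z|\<mu>. exp (\<i> * complex_of_real (z \<bullet> w)))
              = complex_of_real (exp (- (norm w powr s)))))"

definition ennpowr :: "ennreal \<Rightarrow> real \<Rightarrow> ennreal" where
  "ennpowr x a = (if x = \<infinity> then \<infinity> else ennreal (enn2real x powr a))"

text \<open>
  The product measures live on extensional functions, which the argument of \<open>T\<close> turns into
  elements of \<open>\<K>\<^sup>N\<close>.
\<close>

definition Lp_integral_norm ::
  "real \<Rightarrow> nat \<Rightarrow> nat \<Rightarrow> 'k::real_normed_field measure \<Rightarrow> ((nat \<Rightarrow> nat \<Rightarrow> 'k) \<Rightarrow> 'x::real_normed_vector)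
     \<Rightarrow> ennreal" where
  "Lp_integral_norm p m N \<mu> T =
     ennpowr
       (\<integral>\<^sup>+ z. ennreal (norm (T (\<lambda>k\<in>{..<m}. \<lambda>i. if i < N then z k i else 0)) powr p)
          \<partial>(Pi\<^sub>M {..<m} (\<lambda>_. Pi\<^sub>M {..<N} (\<lambda>_. \<mu>))))
       (1 / p)"

end

theory Submission
  imports Defs
begin

text \<open>
  Write \<open>s = r'\<close> and let \<open>\<mu>\<close> be the \<open>s\<close>-stable law. Everything rests on one property of \<open>\<mu>\<close>: a
  combination \<open>\<Sum>i. c\<^sub>i z\<^sub>i\<close> of independent \<open>\<mu>\<close>-distributed scalars has, coordinate by coordinate, the
  law of \<open>(\<Sum>i. |c\<^sub>i|\<^sup>s)\<^bsup>1/s\<^esup> z\<close>, so that its \<open>L\<^sub>p\<close>-norm is comparable to the \<open>\<ell>\<^sub>s\<close>-norm of \<open>c\<close>, which is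
  the norm of the functional with coefficients \<open>c\<close> on \<open>\<ell>\<^sub>r\<close> (\<open>lp_norm_combination\<close>,
  \<open>dual_ball_coeffs\<close>, \<open>coeffs_dual_ball\<close>). Finiteness of the \<open>p\<close>-th moment is what the
  conditions \<open>r = 2\<close> or \<open>p < r' < 2\<close> provide.

  Lower estimate. Replace every Gaussian or stable scalar by a simple function of it. Then the
  integral over \<open>\<K>\<^sup>N\<close> becomes a finite sum over vectors \<open>w\<^sub>j\<^bsup>1/p\<^esup> h\<^sub>j\<close>, whose weak \<open>p\<close>-norm is, by the
  property above, bounded by a constant that depends on neither \<open>N\<close> nor the discretization, once
  this is fine enough. Apply the definition of \<open>\<pi>\<^sub>p\<close> to these vectors and pass to the limit by
  Fatou's lemma (\<open>integral_le_multiple_summing_norm\<close>).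

  Upper estimate. If \<open>\<Sum>\<^sub>j \<parallel>u x\<^sub>j\<parallel>\<^sup>p \<le> b w\<^sub>p(x)\<^sup>p \<integral> \<parallel>u z\<parallel>\<^sup>p\<close> holds for linear \<open>u\<close> (\<open>linear_domination\<close>), it can
  be applied to one variable of a multilinear map after the other, because sums and integrals of
  nonnegative functions commute (\<open>multi_sum_le_integral\<close>). A linear \<open>u\<close> has finite dimensional range,
  so that it factors through some \<open>\<ell>\<^sub>q\<^sup>k\<close> and is given by scalar forms \<open>u\<^sub>1, \<dots>, u\<^sub>k\<close>; a single scalar form satisfies the
  estimate by the definition of the weak norm. If \<open>q \<le> p\<close>, the forms are combined by
  Jensen's inequality, as in the passage from \<open>q\<close>-summing to \<open>p\<close>-summing operators
  (\<open>lq_domination_of_le\<close>). If \<open>p < q \<le> 2\<close>, then \<open>\<parallel>y\<parallel>\<^sub>q\<close> is comparable to the \<open>L\<^sub>p\<close>-norm of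
  \<open>\<Sum>\<^sub>l g\<^sub>l y\<^sub>l\<close> for suitable independent real random variables \<open>g\<^sub>l\<close>, and the estimate for the scalar
  forms \<open>\<Sum>\<^sub>l g\<^sub>l u\<^sub>l\<close> is integrated over \<open>g\<close> (\<open>lq_domination_of_gt\<close>).

  As only comparable norms matter, the \<open>g\<^sub>l\<close> can be given the two-sided Pareto law with exponent \<open>q\<close>,
  or the normal law for \<open>q = 2\<close>. Their moments of order \<open>p < q\<close> are estimated through
  characteristic functions by means of the identity
  \<open>\<bar>x\<bar>\<^sup>p \<integral>\<^sub>0\<^sup>\<infinity> (1 - cos t) t\<^bsup>-1-p\<^esup> dt = \<integral>\<^sub>0\<^sup>\<infinity> (1 - cos (x t)) t\<^bsup>-1-p\<^esup> dt\<close>.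
\<close>

section \<open>Moments from characteristic functions\<close>

text \<open>A crude constant that serves for \<open>p < 1\<close> and \<open>p \<ge> 1\<close> alike; only comparability is ever needed.\<close>

lemma powr_sum_le:
  fixes a :: "'i \<Rightarrow> real"
  assumes "finite I" "\<And>i. i \<in> I \<Longrightarrow> 0 \<le> a i" "0 < p"
  shows "(\<Sum>i\<in>I. a i) powr p \<le> real (card I) powr p * (\<Sum>i\<in>I. a i powr p)"
proof (cases "I = {}")
  case False
  have "Max (a ` I) \<in> a ` I"
    using assms(1) False by (intro Max_in) auto
  then obtain i0 where "i0 \<in> I" "a i0 = Max (a ` I)" by auto
  then have i0: "i0 \<in> I" "\<And>i. i \<in> I \<Longrightarrow> a i \<le> a i0"
    using assms(1) by auto
  have "(\<Sum>i\<in>I. a i) \<le> real (card I) * a i0"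
    using sum_bounded_above[of I a "a i0"] i0 by simp
  then have "(\<Sum>i\<in>I. a i) powr p \<le> (real (card I) * a i0) powr p"
    using assms by (intro powr_mono2) (auto intro: sum_nonneg)
  also have "\<dots> = real (card I) powr p * a i0 powr p"
    using assms i0 by (simp add: powr_mult)
  also have "a i0 powr p \<le> (\<Sum>i\<in>I. a i powr p)"
    using assms i0 by (intro member_le_sum) auto
  finally show ?thesis by (simp add: mult_left_mono)
qed simp

text \<open>Up to a factor, the Levy density of the symmetric \<open>p\<close>-stable law on the positive half-line.\<close>

definition levy_weight :: "real \<Rightarrow> real \<Rightarrow> real" where
  "levy_weight p t = indicator {0<..} t * t powr (- 1 - p)"

lemma levy_weight_measurable [measurable]: "levy_weight p \<in> borel_measurable borel"
  unfolding levy_weight_def by measurable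

lemma levy_weight_nonneg: "0 \<le> levy_weight p t"
  by (simp add: levy_weight_def)

lemma nn_integral_min_levy_weight_finite:
  assumes "0 < p" "p < q"
  shows "(\<integral>\<^sup>+t. ennreal (min 1 (t powr q) * levy_weight p t) \<partial>lborel) < \<infinity>"
proof -
  have "(\<integral>\<^sup>+t. ennreal (min 1 (t powr q) * levy_weight p t) \<partial>lborel)
      \<le> (\<integral>\<^sup>+t. ennreal (t powr (q - p - 1)) * indicator {0..1} t
             + ennreal (t powr (- 1 - p)) * indicator {1..} t \<partial>lborel)"
  proof (rule nn_integral_mono)
    fix t :: real
    consider "t \<le> 0" | "0 < t" "t \<le> 1" | "1 < t" by linarith
    then show "ennreal (min 1 (t powr q) * levy_weight p t) \<le> ennreal (t powr (q - p - 1)) * indicator {0..1} t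
             + ennreal (t powr (- 1 - p)) * indicator {1..} t"
    proof cases
      case 2
      have "min 1 (t powr q) * levy_weight p t \<le> t powr q * t powr (- 1 - p)"
        using 2 by (intro mult_mono) (auto simp: levy_weight_def)
      also have "\<dots> = t powr (q - p - 1)" by (simp add: powr_add[symmetric] algebra_simps)
      finally show ?thesis using 2 by (auto intro!: add_increasing2)
    next
      case 3
      have "min 1 (t powr q) * levy_weight p t \<le> 1 * t powr (- 1 - p)"
        using 3 by (intro mult_mono) (auto simp: levy_weight_def)
      then show ?thesis using 3 by simp
    qed (simp add: levy_weight_def)
  qed
  also have "\<dots> = (\<integral>\<^sup>+t. ennreal (t powr (q - p - 1)) * indicator {0..1} t \<partial>lborel)
             + (\<integral>\<^sup>+t. ennreal (t powr (- 1 - p)) * indicator {1..} t \<partial>lborel)"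
    by (rule nn_integral_add) auto
  also have "\<dots> < \<infinity>"
    using nn_integral_has_integral_lebesgue'[OF _ has_integral_powr_from_0[of "q - p - 1" 1]]
      nn_integral_has_integral_lebesgue'[OF _ has_integral_powr_to_inf[of "- 1 - p" 1]] assms
    by (simp add: nn_integral_has_integral_lebesgue)
  finally show ?thesis .
qed

definition levy_constant :: "real \<Rightarrow> ennreal" where
  "levy_constant p = (\<integral>\<^sup>+t. ennreal ((1 - cos t) * levy_weight p t) \<partial>lborel)"

lemma one_minus_cos_bounds:
  fixes t :: real
  shows "0 \<le> 1 - cos t" "1 - cos t \<le> 2" "1 - cos t \<le> t\<^sup>2 / 2"
  using cos_le_one[of t] cos_ge_minus_one[of t] cos_squared_eq[of t]
proof -
  have "1 - cos t = 2 * (sin (t/2))\<^sup>2"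
    using cos_double_sin[of "t/2"] by simp
  also have "(sin (t/2))\<^sup>2 \<le> (t/2)\<^sup>2"
    unfolding abs_le_square_iff[symmetric] by (rule abs_sin_x_le_abs_x)
  finally show "1 - cos t \<le> t\<^sup>2 / 2" by (simp add: power2_eq_square)
qed auto

lemma levy_constant_finite:
  assumes "0 < p" "p < 2" shows "levy_constant p < \<infinity>"
proof -
  have "levy_constant p \<le> (\<integral>\<^sup>+t. 2 * ennreal (min 1 (t powr 2) * levy_weight p t) \<partial>lborel)"
    unfolding levy_constant_def
  proof (rule nn_integral_mono)
    fix t :: real
    have "1 - cos t \<le> 2 * t\<^sup>2"
      using one_minus_cos_bounds(3)[of t] zero_le_power2[of t] by linarith
    then have "1 - cos t \<le> 2 * min 1 (t powr 2)" if "0 < t"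
      using one_minus_cos_bounds(2)[of t] that by (auto simp: min_def)
    then have "(1 - cos t) * levy_weight p t \<le> (2 * min 1 (t powr 2)) * levy_weight p t"
      by (cases "0 < t") (auto simp: levy_weight_def intro!: mult_right_mono)
    then show "ennreal ((1 - cos t) * levy_weight p t) \<le> 2 * ennreal (min 1 (t powr 2) * levy_weight p t)"
      using levy_weight_nonneg[of p t]
      by (subst ennreal_numeral[symmetric], subst ennreal_mult[symmetric]) (auto simp: mult.assoc intro: ennreal_leI)
  qed
  also have "\<dots> < \<infinity>"
    using nn_integral_min_levy_weight_finite[OF assms]
    by (subst nn_integral_cmult) (auto simp: ennreal_mult_less_top)
  finally show ?thesis .
qed

lemma nn_integral_interval_ge:
  fixes f :: "real \<Rightarrow> real"
  assumes "a \<le> b" "0 \<le> c" "\<And>t. a \<le> t \<Longrightarrow> t \<le> b \<Longrightarrow> c \<le> f t"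
  shows "ennreal (c * (b - a)) \<le> (\<integral>\<^sup>+t. ennreal (f t) \<partial>lborel)"
proof -
  have "ennreal (c * (b - a)) = (\<integral>\<^sup>+t. ennreal c * indicator {a..b} t \<partial>lborel)"
    using assms by (simp add: nn_integral_cmult_indicator ennreal_mult)
  also have "\<dots> \<le> (\<integral>\<^sup>+t. ennreal (f t) \<partial>lborel)"
    using assms by (intro nn_integral_mono) (auto simp: indicator_def intro!: ennreal_leI)
  finally show ?thesis .
qed

lemma one_minus_cos_ge:
  fixes t :: real assumes "1 \<le> t" "t \<le> 2"
  shows "1 - cos 1 \<le> 1 - cos t"
  using assms pi_gt3 by (simp add: cos_mono_le_eq)

lemma cos_1_less: "cos (1::real) < 1"
  using cos_monotone_0_pi[of 0 1] pi_gt3 by simp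

lemma levy_constant_pos: assumes "0 < p" shows "0 < levy_constant p"
proof -
  have "ennreal (((1 - cos 1) * 2 powr (- 1 - p)) * (2 - 1)) \<le> levy_constant p"
    unfolding levy_constant_def
  proof (rule nn_integral_interval_ge)
    fix t :: real assume t: "1 \<le> t" "t \<le> 2"
    have "2 powr (- 1 - p) \<le> t powr (- 1 - p)"
      using t assms by (intro powr_mono2') auto
    then show "(1 - cos 1) * 2 powr (- 1 - p) \<le> (1 - cos t) * levy_weight p t"
      using t one_minus_cos_ge[OF t] one_minus_cos_bounds(1)[of t] by (auto simp: levy_weight_def intro!: mult_mono)
  qed (use cos_1_less in auto)
  moreover have "0 < ennreal (((1 - cos 1) * 2 powr (- 1 - p)) * (2 - 1))"
    using cos_1_less by (auto simp: ennreal_zero_less_mult_iff)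
  ultimately show ?thesis by (rule order.strict_trans2[rotated])
qed

text \<open>Substituting \<open>t := \<bar>x\<bar> t\<close> turns a power of \<open>\<bar>x\<bar>\<close> into a mixture of the functions
\<open>1 - cos (x t)\<close>, whose means are read off from a characteristic function.\<close>

lemma levy_constant_scale:
  assumes "0 < p"
  shows "(\<integral>\<^sup>+t. ennreal ((1 - cos (x * t)) * levy_weight p t) \<partial>lborel) = ennreal (\<bar>x\<bar> powr p) * levy_constant p"
proof (cases "x = 0")
  case False
  have w: "levy_weight p (\<bar>x\<bar> * t) = \<bar>x\<bar> powr (- 1 - p) * levy_weight p t" for t
    using False by (auto simp: levy_weight_def indicator_def powr_mult zero_less_mult_iff)
  have c: "cos (\<bar>x\<bar> * t) = cos (x * t)" for t by (cases "x \<ge> 0") auto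
  have "levy_constant p = ennreal \<bar>x\<bar> * (\<integral>\<^sup>+t. ennreal ((1 - cos (\<bar>x\<bar> * t)) * levy_weight p (\<bar>x\<bar> * t)) \<partial>lborel)"
    unfolding levy_constant_def using False
    by (subst nn_integral_real_affine[where c = "\<bar>x\<bar>" and t = 0]) auto
  also have "\<dots> = ennreal \<bar>x\<bar> * (\<integral>\<^sup>+t. ennreal (\<bar>x\<bar> powr (- 1 - p)) * ennreal ((1 - cos (x * t)) * levy_weight p t) \<partial>lborel)"
    unfolding w c using one_minus_cos_bounds(1) levy_weight_nonneg
    by (subst ennreal_mult[symmetric]) (auto simp: mult_ac)
  also have "\<dots> = (ennreal \<bar>x\<bar> * ennreal (\<bar>x\<bar> powr (- 1 - p))) * (\<integral>\<^sup>+t. ennreal ((1 - cos (x * t)) * levy_weight p t) \<partial>lborel)"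
    by (subst nn_integral_cmult) (auto simp: mult.assoc)
  finally have "ennreal (\<bar>x\<bar> powr p) * levy_constant p
     = ennreal (\<bar>x\<bar> powr p * (\<bar>x\<bar> * \<bar>x\<bar> powr (- 1 - p))) * (\<integral>\<^sup>+t. ennreal ((1 - cos (x * t)) * levy_weight p t) \<partial>lborel)"
    by (simp add: ennreal_mult mult.assoc)
  also have "\<bar>x\<bar> powr p * (\<bar>x\<bar> * \<bar>x\<bar> powr (- 1 - p)) = 1"
    using False powr_add[of "\<bar>x\<bar>" p "- p"] by (simp add: powr_diff powr_minus field_simps)
  finally show ?thesis by simp
qed (simp add: levy_constant_def)

lemma absolute_moment_by_char:
  assumes "prob_space M" and [measurable]: "Y \<in> borel_measurable M" and p: "0 < p"
    and \<psi>: "\<And>t. (LINT \<omega>|M. cos (t * Y \<omega>)) = \<psi> t"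
  shows "(\<integral>\<^sup>+\<omega>. ennreal (\<bar>Y \<omega>\<bar> powr p) \<partial>M) * levy_constant p = (\<integral>\<^sup>+t. ennreal ((1 - \<psi> t) * levy_weight p t) \<partial>lborel)"
proof -
  interpret prob_space M by fact
  interpret pair_sigma_finite M lborel ..
  have "(\<integral>\<^sup>+\<omega>. ennreal (\<bar>Y \<omega>\<bar> powr p) \<partial>M) * levy_constant p
      = (\<integral>\<^sup>+\<omega>. ennreal (\<bar>Y \<omega>\<bar> powr p) * levy_constant p \<partial>M)"
    by (rule nn_integral_multc[symmetric]) auto
  also have "\<dots> = (\<integral>\<^sup>+\<omega>. (\<integral>\<^sup>+t. ennreal ((1 - cos (Y \<omega> * t)) * levy_weight p t) \<partial>lborel) \<partial>M)"
    by (simp add: levy_constant_scale[OF p])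
  also have "\<dots> = (\<integral>\<^sup>+t. (\<integral>\<^sup>+\<omega>. ennreal ((1 - cos (Y \<omega> * t)) * levy_weight p t) \<partial>M) \<partial>lborel)"
    by (rule Fubini'[symmetric]) measurable
  also have "\<dots> = (\<integral>\<^sup>+t. ennreal ((1 - \<psi> t) * levy_weight p t) \<partial>lborel)"
  proof (rule nn_integral_cong)
    fix t :: real
    have int: "integrable M (\<lambda>\<omega>. cos (t * Y \<omega>))"
      by (rule integrable_const_bound[of _ 1]) auto
    have "(\<integral>\<^sup>+\<omega>. ennreal ((1 - cos (Y \<omega> * t)) * levy_weight p t) \<partial>M)
        = ennreal (LINT \<omega>|M. (1 - cos (t * Y \<omega>)) * levy_weight p t)"
      using int one_minus_cos_bounds(1) levy_weight_nonneg
      by (subst nn_integral_eq_integral) (auto simp: mult.commute)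
    also have "(LINT \<omega>|M. (1 - cos (t * Y \<omega>)) * levy_weight p t) = (1 - \<psi> t) * levy_weight p t"
      using int by (simp add: \<psi> prob_space)
    finally show "(\<integral>\<^sup>+\<omega>. ennreal ((1 - cos (Y \<omega> * t)) * levy_weight p t) \<partial>M) = ennreal ((1 - \<psi> t) * levy_weight p t)" .
  qed
  finally show ?thesis .
qed

lemma ennreal_le_of_mult_le:
  fixes a c x :: ennreal
  assumes "x * a \<le> c" "0 < a" "a < \<infinity>"
  shows "x \<le> c / a"
  using assms by (metis ennreal_divide_times ennreal_mult_divide_eq divide_right_mono_ennreal infinity_ennreal_def less_irrefl)

text \<open>If \<open>1 - \<psi> t\<close> behaves like \<open>t\<^sup>q\<close> near 0, then the \<open>p\<close>-th absolute moment lies between two positive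
  constants for all \<open>p < q\<close>. They are named because they depend on the two bounds on \<open>\<psi>\<close> only and not on
  the probability space, which is what makes them uniform in the dimension later on.\<close>

definition upper_moment :: "real \<Rightarrow> real \<Rightarrow> real \<Rightarrow> real" where
  "upper_moment p q C = C * enn2real (\<integral>\<^sup>+t. ennreal (min 1 (t powr q) * levy_weight p t) \<partial>lborel) / enn2real (levy_constant p)"

definition lower_moment :: "real \<Rightarrow> real \<Rightarrow> real \<Rightarrow> real \<Rightarrow> real" where
  "lower_moment p q c t0 = c * (t0/2) powr q * t0 powr (- 1 - p) * (t0/2) / enn2real (levy_constant p)"

lemma kap_eq:
  assumes "0 < p" "p < 2"
  shows "levy_constant p = ennreal (enn2real (levy_constant p))" "0 < enn2real (levy_constant p)"
  using levy_constant_pos[OF assms(1)] levy_constant_finite[OF assms] by (auto simp: enn2real_positive_iff)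

lemma lower_moment_pos:
  assumes "0 < p" "p < 2" "0 < c" "0 < t0"
  shows "0 < lower_moment p q c t0"
  using assms kap_eq(2)[OF assms(1,2)] by (simp add: lower_moment_def)

lemma absolute_moment_le:
  assumes "prob_space M" "Y \<in> borel_measurable M" and p: "0 < p" "p < q" "q \<le> 2" and C: "0 \<le> C"
    and "\<And>t. (LINT \<omega>|M. cos (t * Y \<omega>)) = \<psi> t"
    and up: "\<And>t. 0 < t \<Longrightarrow> 1 - \<psi> t \<le> C * min 1 (t powr q)"
  shows "(\<integral>\<^sup>+\<omega>. ennreal (\<bar>Y \<omega>\<bar> powr p) \<partial>M) \<le> ennreal (upper_moment p q C)"
proof -
  let ?G = "\<integral>\<^sup>+t. ennreal (min 1 (t powr q) * levy_weight p t) \<partial>lborel"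
  have G: "?G = ennreal (enn2real ?G)"
    using nn_integral_min_levy_weight_finite[OF p(1,2)] by simp
  define K where "K = enn2real (levy_constant p)"
  have K: "levy_constant p = ennreal K" "0 < K" using kap_eq[of p] p by (auto simp: K_def)
  have "(\<integral>\<^sup>+\<omega>. ennreal (\<bar>Y \<omega>\<bar> powr p) \<partial>M) * levy_constant p = (\<integral>\<^sup>+t. ennreal ((1 - \<psi> t) * levy_weight p t) \<partial>lborel)"
    using assms by (intro absolute_moment_by_char) auto
  also have "\<dots> \<le> (\<integral>\<^sup>+t. ennreal C * ennreal (min 1 (t powr q) * levy_weight p t) \<partial>lborel)"
  proof (rule nn_integral_mono)
    fix t :: real
    have "(1 - \<psi> t) * levy_weight p t \<le> (C * min 1 (t powr q)) * levy_weight p t"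
      using up by (cases "0 < t") (auto simp: levy_weight_def intro!: mult_right_mono)
    then show "ennreal ((1 - \<psi> t) * levy_weight p t) \<le> ennreal C * ennreal (min 1 (t powr q) * levy_weight p t)"
      using C levy_weight_nonneg[of p t] by (subst ennreal_mult[symmetric]) (auto simp: mult.assoc intro: ennreal_leI)
  qed
  also have "\<dots> = ennreal C * ?G"
    by (rule nn_integral_cmult) auto
  also have "\<dots> = ennreal (C * enn2real ?G)"
    using C by (subst G) (simp add: ennreal_mult)
  finally have "(\<integral>\<^sup>+\<omega>. ennreal (\<bar>Y \<omega>\<bar> powr p) \<partial>M) \<le> ennreal (C * enn2real ?G) / levy_constant p"
    using p by (intro ennreal_le_of_mult_le levy_constant_pos levy_constant_finite) auto
  also have "\<dots> = ennreal (upper_moment p q C)"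
    unfolding upper_moment_def K_def[symmetric] K(1) using K(2) C by (simp add: divide_ennreal)
  finally show ?thesis .
qed

lemma absolute_moment_ge:
  assumes "prob_space M" "Y \<in> borel_measurable M" and p: "0 < p" "p < 2" and c: "0 < c" "0 < t0" "0 \<le> q"
    and "\<And>t. (LINT \<omega>|M. cos (t * Y \<omega>)) = \<psi> t"
    and lo: "\<And>t. 0 < t \<Longrightarrow> t \<le> t0 \<Longrightarrow> c * t powr q \<le> 1 - \<psi> t"
  shows "ennreal (lower_moment p q c t0) \<le> (\<integral>\<^sup>+\<omega>. ennreal (\<bar>Y \<omega>\<bar> powr p) \<partial>M)"
proof -
  define K where "K = enn2real (levy_constant p)"
  have K: "levy_constant p = ennreal K" "0 < K" using kap_eq[OF p] by (auto simp: K_def)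
  have eq: "K * lower_moment p q c t0 = (c * (t0/2) powr q * t0 powr (- 1 - p)) * (t0 - t0/2)"
    using K by (simp add: lower_moment_def K_def[symmetric])
  have "ennreal K * ennreal (lower_moment p q c t0) = ennreal ((c * (t0/2) powr q * t0 powr (- 1 - p)) * (t0 - t0/2))"
    unfolding eq[symmetric] using K by (simp add: ennreal_mult')
  also have "\<dots> \<le> (\<integral>\<^sup>+t. ennreal ((1 - \<psi> t) * levy_weight p t) \<partial>lborel)"
  proof (rule nn_integral_interval_ge)
    fix t assume t: "t0/2 \<le> t" "t \<le> t0"
    then have "0 < t" using c by linarith
    have "c * (t0/2) powr q \<le> c * t powr q" using t c by (auto intro!: mult_left_mono powr_mono2)
    also have "\<dots> \<le> 1 - \<psi> t" using lo t \<open>0 < t\<close> by auto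
    finally have 1: "c * (t0/2) powr q \<le> 1 - \<psi> t" .
    have "t0 powr (- 1 - p) \<le> t powr (- 1 - p)" using t \<open>0 < t\<close> p by (intro powr_mono2') auto
    then show "c * (t0/2) powr q * t0 powr (- 1 - p) \<le> (1 - \<psi> t) * levy_weight p t"
      using 1 \<open>0 < t\<close> c order_trans[OF _ 1, of 0] by (auto simp: levy_weight_def intro!: mult_mono)
  qed (use c in auto)
  also have "\<dots> = (\<integral>\<^sup>+\<omega>. ennreal (\<bar>Y \<omega>\<bar> powr p) \<partial>M) * levy_constant p"
    using assms by (intro absolute_moment_by_char[symmetric]) auto
  also have "\<dots> = ennreal K * (\<integral>\<^sup>+\<omega>. ennreal (\<bar>Y \<omega>\<bar> powr p) \<partial>M)"
    by (simp only: K mult.commute)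
  finally show ?thesis
    using K by (simp add: ennreal_mult_le_mult_iff)
qed

lemma moment_coordinates:
  fixes Z :: "'w \<Rightarrow> 'a::euclidean_space"
  assumes [measurable]: "Z \<in> borel_measurable M" and p: "0 < p"
  shows coordinate_moment_le:
      "b \<in> Basis \<Longrightarrow> (\<integral>\<^sup>+\<omega>. ennreal (\<bar>Z \<omega> \<bullet> b\<bar> powr p) \<partial>M) \<le> (\<integral>\<^sup>+\<omega>. ennreal (norm (Z \<omega>) powr p) \<partial>M)"
    and moment_le_coordinates: "(\<integral>\<^sup>+\<omega>. ennreal (norm (Z \<omega>) powr p) \<partial>M)
      \<le> ennreal (real DIM('a) powr p) * (\<Sum>b\<in>Basis. \<integral>\<^sup>+\<omega>. ennreal (\<bar>Z \<omega> \<bullet> b\<bar> powr p) \<partial>M)"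
proof -
  show "(\<integral>\<^sup>+\<omega>. ennreal (\<bar>Z \<omega> \<bullet> b\<bar> powr p) \<partial>M) \<le> (\<integral>\<^sup>+\<omega>. ennreal (norm (Z \<omega>) powr p) \<partial>M)" if "b \<in> Basis"
    using p that by (intro nn_integral_mono ennreal_leI powr_mono2) (auto intro: Basis_le_norm)
  have "norm z powr p \<le> real DIM('a) powr p * (\<Sum>b\<in>Basis. \<bar>z \<bullet> b\<bar> powr p)" for z :: 'a
  proof -
    have "norm z powr p \<le> (\<Sum>b\<in>Basis. \<bar>z \<bullet> b\<bar>) powr p"
      using p by (intro powr_mono2 norm_le_l1) auto
    also have "\<dots> \<le> real DIM('a) powr p * (\<Sum>b\<in>Basis. \<bar>z \<bullet> b\<bar> powr p)"
      using p by (intro powr_sum_le) auto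
    finally show ?thesis .
  qed
  then have "(\<integral>\<^sup>+\<omega>. ennreal (norm (Z \<omega>) powr p) \<partial>M)
      \<le> (\<integral>\<^sup>+\<omega>. ennreal (real DIM('a) powr p) * (\<Sum>b\<in>Basis. ennreal (\<bar>Z \<omega> \<bullet> b\<bar> powr p)) \<partial>M)"
    by (intro nn_integral_mono, subst sum_ennreal) (auto simp: ennreal_mult[symmetric] sum_nonneg intro: ennreal_leI)
  also have "\<dots> = ennreal (real DIM('a) powr p) * (\<Sum>b\<in>Basis. \<integral>\<^sup>+\<omega>. ennreal (\<bar>Z \<omega> \<bullet> b\<bar> powr p) \<partial>M)"
    by (subst nn_integral_cmult, measurable, subst nn_integral_sum, measurable)
  finally show "(\<integral>\<^sup>+\<omega>. ennreal (norm (Z \<omega>) powr p) \<partial>M) \<le> \<dots>" .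
qed

section \<open>Embedding \<open>\<ell>\<^sub>q\<close> into \<open>L\<^sub>p\<close> by independent random variables\<close>

lemma char_PiM_sum:
  fixes h :: "'i \<Rightarrow> 'a \<Rightarrow> real"
  assumes "prob_space \<nu>" "finite I" and [measurable]: "\<And>i. h i \<in> borel_measurable \<nu>"
  shows "(CLINT \<omega>|Pi\<^sub>M I (\<lambda>_. \<nu>). iexp (\<Sum>i\<in>I. h i (\<omega> i))) = (\<Prod>i\<in>I. CLINT z|\<nu>. iexp (h i z))"
proof -
  interpret prob_space \<nu> by fact
  interpret product_sigma_finite "\<lambda>_. \<nu>" ..
  have "(CLINT \<omega>|Pi\<^sub>M I (\<lambda>_. \<nu>). iexp (\<Sum>i\<in>I. h i (\<omega> i))) = (CLINT \<omega>|Pi\<^sub>M I (\<lambda>_. \<nu>). (\<Prod>i\<in>I. iexp (h i (\<omega> i))))"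
    using assms(2) by (simp add: exp_sum sum_distrib_left)
  also have "\<dots> = (\<Prod>i\<in>I. CLINT z|\<nu>. iexp (h i z))"
    using assms by (intro product_integral_prod) (auto intro!: integrable_const_bound[of _ 1])
  finally show ?thesis .
qed

lemma integral_cos_eq_Re:
  assumes "prob_space M" and [measurable]: "Y \<in> borel_measurable M"
  shows "(LINT \<omega>|M. cos (Y \<omega>)) = Re (CLINT \<omega>|M. iexp (Y \<omega>))"
proof -
  interpret prob_space M by fact
  have "integrable M (\<lambda>\<omega>. iexp (Y \<omega>))"
    by (rule integrable_const_bound[of _ 1]) auto
  then show ?thesis
    by (subst integral_Re[symmetric]) (auto simp: Re_exp)
qed

text \<open>A symmetric law whose characteristic function has the same behaviour at 0 as that of a \<open>q\<close>-stable
  law. This behaviour alone makes the \<open>L\<^sub>p\<close>-norms of combinations of independent copies comparable to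
  \<open>\<ell>\<^sub>q\<close>-norms, and it is shared by laws with explicit densities.\<close>

definition stable_like :: "real \<Rightarrow> real \<Rightarrow> real \<Rightarrow> real measure \<Rightarrow> bool" where
  "stable_like q c C \<nu> \<longleftrightarrow> real_distribution \<nu> \<and>
     (\<exists>\<psi>. \<forall>t. char \<nu> t = complex_of_real (\<psi> t) \<and> 1 - \<psi> t \<le> C * \<bar>t\<bar> powr q
        \<and> (\<bar>t\<bar> \<le> 1 \<longrightarrow> c * \<bar>t\<bar> powr q \<le> 1 - \<psi> t))"

lemma one_minus_exp_ge:
  fixes x K :: real assumes "0 \<le> x" "x \<le> K"
  shows "x / (1 + K) \<le> 1 - exp (- x)"
proof -
  have "exp (- x) \<le> 1 / (1 + x)"
    using exp_ge_add_one_self[of x] assms by (simp add: exp_minus field_simps)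
  moreover have "x / (1 + K) \<le> x / (1 + x)"
    using assms by (intro divide_left_mono) auto
  moreover have "x / (1 + x) = 1 - 1 / (1 + x)" using assms by (simp add: field_simps)
  ultimately show ?thesis by linarith
qed

text \<open>For \<open>q = 2\<close> a Pareto law does not work: its variance is infinite, and \<open>1 - \<psi> t\<close> is of order
\<open>t\<^sup>2 ln (1/t)\<close>.\<close>

lemma stable_like_std_normal: "stable_like 2 (1/3) (1/2) std_normal_distribution"
  unfolding stable_like_def
proof (intro conjI exI[of _ "\<lambda>t. exp (- (t\<^sup>2) / 2)"] allI impI)
  fix t :: real
  show "char std_normal_distribution t = complex_of_real (exp (- (t\<^sup>2) / 2))"
    by (simp add: char_std_normal_distribution)
  show "1 - exp (- t\<^sup>2 / 2) \<le> 1 / 2 * \<bar>t\<bar> powr 2"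
    using exp_ge_add_one_self[of "- (t\<^sup>2) / 2"] by (cases "t = 0") auto
  assume "\<bar>t\<bar> \<le> 1"
  then have "t\<^sup>2 \<le> 1" by (simp add: abs_square_le_1)
  then show "1 / 3 * \<bar>t\<bar> powr 2 \<le> 1 - exp (- t\<^sup>2 / 2)"
    using one_minus_exp_ge[of "t\<^sup>2 / 2" "1/2"] by (cases "t = 0") auto
qed (rule real_dist_normal_dist)

lemma nn_integral_even:
  fixes f :: "real \<Rightarrow> ennreal"
  assumes [measurable]: "f \<in> borel_measurable borel" and even: "\<And>x. f (- x) = f x"
  shows "(\<integral>\<^sup>+x. f x \<partial>lborel) = 2 * (\<integral>\<^sup>+x. f x * indicator {0<..} x \<partial>lborel)"
proof -
  have "(\<integral>\<^sup>+x. f x \<partial>lborel) = (\<integral>\<^sup>+x. f x * indicator {0<..} x + f x * indicator {..<0} x \<partial>lborel)"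
  proof (rule nn_integral_cong_AE)
    show "AE x in lborel. f x = f x * indicator {0<..} x + f x * indicator {..<0} x"
      using AE_lborel_singleton[of "0::real"] by eventually_elim (auto simp: indicator_def)
  qed
  also have "\<dots> = (\<integral>\<^sup>+x. f x * indicator {0<..} x \<partial>lborel) + (\<integral>\<^sup>+x. f x * indicator {..<0} x \<partial>lborel)"
    by (rule nn_integral_add) auto
  also have "(\<integral>\<^sup>+x. f x * indicator {..<0} x \<partial>lborel) = (\<integral>\<^sup>+x. f x * indicator {0<..} x \<partial>lborel)"
  proof -
    have "(\<integral>\<^sup>+x. f x * indicator {..<0} x \<partial>lborel)
        = ennreal \<bar>- 1\<bar> * (\<integral>\<^sup>+x. f (0 + - 1 * x) * indicator {..<0} (0 + - 1 * x) \<partial>lborel)"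
      by (rule nn_integral_real_affine) auto
    also have "\<dots> = (\<integral>\<^sup>+x. f x * indicator {0<..} x \<partial>lborel)"
      by (simp add: even) (auto simp: indicator_def intro!: nn_integral_cong)
    finally show ?thesis .
  qed
  finally show ?thesis by (simp add: mult_2)
qed

definition pareto_density :: "real \<Rightarrow> real \<Rightarrow> real" where
  "pareto_density q x = indicator {1..} \<bar>x\<bar> * (q / 2 * \<bar>x\<bar> powr (- 1 - q))"

lemma pareto_density_measurable [measurable]: "pareto_density q \<in> borel_measurable borel"
  unfolding pareto_density_def by measurable

text \<open>The integral of \<open>(1 - cos (t x)) \<bar>x\<bar>\<^bsup>-1-q\<^esup>\<close> over the whole line is a multiple of \<open>\<bar>t\<bar>\<^sup>q\<close>; this gives the upper
  bound. Cutting off \<open>\<bar>x\<bar> < 1\<close>, which makes the density integrable, costs little as long as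
  \<open>\<bar>t\<bar> \<le> 1\<close>.\<close>

lemma stable_like_pareto:
  assumes q: "0 < q" "q < 2"
  shows "\<exists>c C. 0 < c \<and> 0 < C \<and> stable_like q c C (density lborel (pareto_density q))"
proof -
  define \<nu> where "\<nu> = density lborel (pareto_density q)"
  have nonneg: "0 \<le> pareto_density q x" for x using q by (simp add: pareto_density_def)
  have even: "pareto_density q (- x) = pareto_density q x" for x by (simp add: pareto_density_def)
  have "emeasure \<nu> (space \<nu>) = (\<integral>\<^sup>+x. ennreal (pareto_density q x) \<partial>lborel)"
    by (simp add: \<nu>_def emeasure_density)
  also have "\<dots> = 2 * (\<integral>\<^sup>+x. ennreal (pareto_density q x) * indicator {0<..} x \<partial>lborel)"
    by (rule nn_integral_even) (auto simp: even)
  also have "(\<integral>\<^sup>+x. ennreal (pareto_density q x) * indicator {0<..} x \<partial>lborel)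
      = (\<integral>\<^sup>+x. ennreal (q / 2) * (ennreal (x powr (- 1 - q)) * indicator {1..} x) \<partial>lborel)"
    using q by (intro nn_integral_cong) (auto simp: pareto_density_def indicator_def ennreal_mult[symmetric])
  also have "\<dots> = ennreal (q / 2) * ennreal (1 / q)"
    using nn_integral_has_integral_lebesgue'[OF _ has_integral_powr_to_inf[of "- 1 - q" 1]] q
    by (subst nn_integral_cmult) auto
  also have "2 * \<dots> = 1"
  proof -
    have "2 * (ennreal (q / 2) * ennreal (1 / q)) = ennreal (2 * (q / 2 * (1 / q)))"
      using q by (subst ennreal_mult, simp, simp)+ simp
    also have "2 * (q / 2 * (1 / q)) = 1" using q by simp
    finally show ?thesis by simp
  qed
  finally have "prob_space \<nu>" by (rule prob_spaceI)
  then have rd: "real_distribution \<nu>"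
    by (simp add: real_distribution_def real_distribution_axioms_def \<nu>_def)
  interpret real_distribution \<nu> by fact
  define \<psi> where "\<psi> t = (LINT x|\<nu>. cos (t * x))" for t
  \<comment> \<open>The characteristic function is real because the density is even and the sine is odd.\<close>
  have sin0: "(LINT x|\<nu>. sin (t * x)) = 0" for t
  proof -
    have dens: "(LINT x|\<nu>. sin (t * x)) = (LINT x|lborel. pareto_density q x * sin (t * x))"
      unfolding \<nu>_def by (subst integral_density) (auto simp: nonneg)
    have "(LINT x|lborel. pareto_density q x * sin (t * x))
        = (LINT x|lborel. pareto_density q (0 + (-1) * x) * sin (t * (0 + (-1) * x)))"
      by (subst lborel_integral_real_affine[where c = "-1" and t = 0]) auto
    also have "\<dots> = - (LINT x|lborel. pareto_density q x * sin (t * x))"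
      by (simp add: even)
    finally have "(LINT x|lborel. pareto_density q x * sin (t * x)) = 0" by simp
    then show ?thesis by (simp add: dens)
  qed
  have char: "char \<nu> t = complex_of_real (\<psi> t)" for t
  proof (rule complex_eqI)
    have int: "integrable \<nu> (\<lambda>x. iexp (t * x))"
      by (rule integrable_const_bound[of _ 1]) auto
    have "Im (char \<nu> t) = (LINT x|\<nu>. sin (t * x))"
      unfolding char_def using int by (subst integral_Im[symmetric]) (auto simp: Im_exp)
    then show "Im (char \<nu> t) = Im (complex_of_real (\<psi> t))" by (simp add: sin0)
    show "Re (char \<nu> t) = Re (complex_of_real (\<psi> t))"
      unfolding char_def \<psi>_def by (subst integral_cos_eq_Re) (auto simp: prob_space_axioms)
  qed
  have one: "ennreal (1 - \<psi> t) = ennreal q * (\<integral>\<^sup>+x. ennreal ((1 - cos (t * x)) * levy_weight q x) * indicator {1..} x \<partial>lborel)" for t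
  proof -
    have "1 - \<psi> t = (LINT x|\<nu>. 1 - cos (t * x))"
      unfolding \<psi>_def
      by (subst Bochner_Integration.integral_diff) (auto simp: prob_space[simplified] intro!: integrable_const_bound[of _ 1])
    also have "ennreal \<dots> = (\<integral>\<^sup>+x. ennreal (1 - cos (t * x)) \<partial>\<nu>)"
      using one_minus_cos_bounds
      by (subst nn_integral_eq_integral) (auto intro!: integrable_const_bound[of _ 2])
    also have "\<dots> = (\<integral>\<^sup>+x. ennreal (pareto_density q x) * ennreal (1 - cos (t * x)) \<partial>lborel)"
      unfolding \<nu>_def by (subst nn_integral_density) auto
    also have "\<dots> = 2 * (\<integral>\<^sup>+x. ennreal (pareto_density q x) * ennreal (1 - cos (t * x)) * indicator {0<..} x \<partial>lborel)"
      by (rule nn_integral_even) (auto simp: even)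
    also have "(\<integral>\<^sup>+x. ennreal (pareto_density q x) * ennreal (1 - cos (t * x)) * indicator {0<..} x \<partial>lborel)
        = (\<integral>\<^sup>+x. ennreal (q / 2) * (ennreal ((1 - cos (t * x)) * levy_weight q x) * indicator {1..} x) \<partial>lborel)"
      using q one_minus_cos_bounds(1)
      by (intro nn_integral_cong)
         (auto simp: pareto_density_def indicator_def levy_weight_def ennreal_mult[symmetric] mult_ac)
    also have "\<dots> = ennreal (q / 2) * (\<integral>\<^sup>+x. ennreal ((1 - cos (t * x)) * levy_weight q x) * indicator {1..} x \<partial>lborel)"
      by (rule nn_integral_cmult) auto
    finally show ?thesis
      using q by (simp add: mult.assoc[symmetric] ennreal_mult[symmetric] flip: ennreal_numeral)
  qed
  obtain K where K: "levy_constant q = ennreal K" "0 < K"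
    using levy_constant_pos[OF q(1)] levy_constant_finite[OF q] by (cases "levy_constant q") auto
  have up: "1 - \<psi> t \<le> (q * K) * \<bar>t\<bar> powr q" for t
  proof -
    have "ennreal (1 - \<psi> t) \<le> ennreal q * (\<integral>\<^sup>+x. ennreal ((1 - cos (t * x)) * levy_weight q x) \<partial>lborel)"
      unfolding one by (intro mult_left_mono nn_integral_mono) (auto simp: indicator_def)
    also have "\<dots> = ennreal (q * K * \<bar>t\<bar> powr q)"
      unfolding levy_constant_scale[OF q(1)] using q K by (simp add: ennreal_mult[symmetric] mult_ac)
    finally show ?thesis
      by (rule ennreal_le_iff[THEN iffD1, rotated]) (use q K in auto)
  qed
  define c where "c = q * (1 - cos 1) * 2 powr (- 1 - q)"
  have c: "0 < c" using q cos_1_less by (simp add: c_def)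
  have lo: "c * \<bar>t\<bar> powr q \<le> 1 - \<psi> t" if t: "\<bar>t\<bar> \<le> 1" for t
  proof (cases "t = 0")
    case True
    then show ?thesis by (simp add: \<psi>_def prob_space[simplified])
  next
    case False
    define a where "a = 1 / \<bar>t\<bar>"
    have a: "1 \<le> a" "a * \<bar>t\<bar> = 1" using False t by (auto simp: a_def)
    \<comment> \<open>On \<open>[1/\<bar>t\<bar>, 2/\<bar>t\<bar>]\<close> the argument of the cosine lies in \<open>[1, 2]\<close>, so that \<open>1 - cos\<close> is bounded below.\<close>
    have "ennreal (((1 - cos 1) * (2 * a) powr (- 1 - q)) * (2 * a - a))
       \<le> (\<integral>\<^sup>+x. ennreal ((1 - cos (t * x)) * levy_weight q x * indicator {1..} x) \<partial>lborel)"
    proof (rule nn_integral_interval_ge)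
      fix x assume x: "a \<le> x" "x \<le> 2 * a"
      have "(2 * a) powr (- 1 - q) \<le> x powr (- 1 - q)"
        using x a q by (intro powr_mono2') auto
      moreover have "1 \<le> \<bar>t\<bar> * x" "\<bar>t\<bar> * x \<le> 2"
        using mult_right_mono[OF x(1), of "\<bar>t\<bar>"] mult_right_mono[OF x(2), of "\<bar>t\<bar>"] a
        by (auto simp: mult_ac)
      then have "1 - cos 1 \<le> 1 - cos (\<bar>t\<bar> * x)" by (rule one_minus_cos_ge)
      then have "1 - cos 1 \<le> 1 - cos (t * x)" by (cases "t \<ge> 0") auto
      ultimately show "(1 - cos 1) * (2 * a) powr (- 1 - q) \<le> (1 - cos (t * x)) * levy_weight q x * indicator {1..} x"
        using x a one_minus_cos_bounds(1)[of "t * x"] by (auto simp: levy_weight_def intro!: mult_mono)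
    qed (use a cos_1_less in auto)
    then have "ennreal q * ennreal (((1 - cos 1) * (2 * a) powr (- 1 - q)) * (2 * a - a)) \<le> ennreal (1 - \<psi> t)"
      unfolding one by (intro mult_left_mono) (simp_all add: ennreal_mult'' ennreal_indicator)
    moreover have "q * (((1 - cos 1) * (2 * a) powr (- 1 - q)) * (2 * a - a)) = c * \<bar>t\<bar> powr q"
    proof -
      have "(2 * a) powr (- 1 - q) * a = 2 powr (- 1 - q) * (a powr (- 1 - q) * a powr 1)"
        using a by (simp add: powr_mult)
      also have "\<dots> = 2 powr (- 1 - q) * a powr (- q)"
        by (simp only: powr_add[symmetric]) simp
      also have "a powr (- q) = \<bar>t\<bar> powr q"
        using False by (simp add: a_def powr_divide powr_minus)
      finally show ?thesis by (simp add: c_def)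
    qed
    ultimately have "ennreal (c * \<bar>t\<bar> powr q) \<le> ennreal (1 - \<psi> t)"
      using q by (simp add: ennreal_mult'[symmetric])
    then show ?thesis
      using c False by (subst (asm) ennreal_le_iff2) (auto simp: mult_le_0_iff)
  qed
  have "stable_like q c (q * K) \<nu>"
    unfolding stable_like_def using rd char up lo by blast
  then show ?thesis using c q K unfolding \<nu>_def by (intro exI[of _ c] exI[of _ "q * K"]) auto
qed

lemma ex_stable_like:
  assumes "0 < q" "q \<le> 2"
  shows "\<exists>\<nu> c C. 0 < c \<and> 0 < C \<and> stable_like q c C \<nu>"
proof (cases "q = 2")
  case True
  then show ?thesis
    using stable_like_std_normal by (intro exI[of _ std_normal_distribution] exI[of _ "1/3"] exI[of _ "1/2"]) auto
next
  case False
  then show ?thesis using stable_like_pareto[of q] assms by fastforce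
qed

text \<open>The characteristic function of \<open>\<Sum>l. g\<^sub>l a\<^sub>l\<close> is the product of the \<open>\<psi> (t a\<^sub>l)\<close>. For \<open>\<parallel>a\<parallel>\<^sub>q = 1\<close> it satisfies
  bounds of the same kind as \<open>\<psi>\<close> itself, with constants independent of \<open>a\<close> and its length, so that
  \<open>absolute_moment_le\<close> and \<open>absolute_moment_ge\<close> apply; the general case follows by scaling.\<close>

lemma lq_norm_as_moment:
  fixes p q c C :: real
  assumes pq: "0 < p" "p < q" "q \<le> 2" and cC: "0 < c" "0 < C" and st: "stable_like q c C \<nu>"
  shows "\<exists>A B::real. 0 < A \<and> 0 < B \<and> (\<forall>k (a :: nat \<Rightarrow> real).
      ennreal (A * (\<Sum>l<k. \<bar>a l\<bar> powr q) powr (p / q))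
        \<le> (\<integral>\<^sup>+g. ennreal (\<bar>\<Sum>l<k. g l * a l\<bar> powr p) \<partial>Pi\<^sub>M {..<k} (\<lambda>_. \<nu>)) \<and>
      (\<integral>\<^sup>+g. ennreal (\<bar>\<Sum>l<k. g l * a l\<bar> powr p) \<partial>Pi\<^sub>M {..<k} (\<lambda>_. \<nu>))
        \<le> ennreal (B * (\<Sum>l<k. \<bar>a l\<bar> powr q) powr (p / q)))"
proof -
  interpret real_distribution \<nu> using st by (simp add: stable_like_def)
  obtain \<psi> where char: "\<And>t. char \<nu> t = complex_of_real (\<psi> t)"
    and up: "\<And>t. 1 - \<psi> t \<le> C * \<bar>t\<bar> powr q"
    and lo: "\<And>t. \<bar>t\<bar> \<le> 1 \<Longrightarrow> c * \<bar>t\<bar> powr q \<le> 1 - \<psi> t"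
    using st by (auto simp: stable_like_def)
  have \<psi>1: "\<bar>\<psi> t\<bar> \<le> 1" for t using cmod_char_le_1[of t] by (simp add: char)
  \<comment> \<open>Up to \<open>t0\<close> the upper bound on \<open>1 - \<psi>\<close> keeps \<open>\<psi>\<close> nonnegative, so that bounds on the factors can be multiplied.\<close>
  define t0 where "t0 = min 1 ((1 / C) powr (1 / q))"
  have t0: "0 < t0" "t0 \<le> 1" "C * t0 powr q \<le> 1"
  proof -
    have "t0 powr q \<le> ((1 / C) powr (1 / q)) powr q"
      using pq cC by (intro powr_mono2) (auto simp: t0_def)
    also have "\<dots> = 1 / C" using pq cC by (simp add: powr_powr)
    finally show "C * t0 powr q \<le> 1" using cC by (simp add: field_simps)
  qed (use cC in \<open>auto simp: t0_def\<close>)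
  define C' where "C' = max C 2"
  define A where "A = lower_moment p q (c / (1 + c)) t0"
  define B where "B = upper_moment p q C' + 1"
  have AB: "0 < A" "0 < B"
    using lower_moment_pos[of p "c / (1 + c)" t0 q] pq cC t0
    by (auto simp: A_def B_def upper_moment_def C'_def intro!: add_nonneg_pos divide_nonneg_nonneg mult_nonneg_nonneg)
  have normalized: "(\<integral>\<^sup>+g. ennreal (\<bar>\<Sum>l<k. g l * a l\<bar> powr p) \<partial>Pi\<^sub>M {..<k} (\<lambda>_. \<nu>)) \<le> ennreal B \<and>
      ennreal A \<le> (\<integral>\<^sup>+g. ennreal (\<bar>\<Sum>l<k. g l * a l\<bar> powr p) \<partial>Pi\<^sub>M {..<k} (\<lambda>_. \<nu>))"
    if a: "(\<Sum>l<k. \<bar>a l\<bar> powr q) = 1" for k and a :: "nat \<Rightarrow> real"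
  proof -
    let ?M = "Pi\<^sub>M {..<k} (\<lambda>_. \<nu>)" and ?Y = "\<lambda>g. \<Sum>l<k. g l * a l" and ?\<phi> = "\<lambda>t. \<Prod>l<k. \<psi> (t * a l)"
    have prob: "prob_space ?M" by (intro prob_space_PiM prob_space_axioms)
    have meas: "?Y \<in> borel_measurable ?M" by measurable
    have cosY: "(LINT g|?M. cos (t * ?Y g)) = ?\<phi> t" for t
    proof -
      have "(LINT g|?M. cos (t * ?Y g)) = Re (CLINT g|?M. iexp (\<Sum>l<k. (t * a l) * g l))"
        by (subst integral_cos_eq_Re) (auto simp: sum_distrib_left mult_ac intro!: prob_space_PiM prob_space_axioms)
      also have "\<dots> = Re (\<Prod>l<k. CLINT z|\<nu>. iexp ((t * a l) * z))"
        by (subst char_PiM_sum) (auto intro: prob_space_axioms)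
      also have "\<dots> = Re (\<Prod>l<k. char \<nu> (t * a l))"
        by (simp only: char_def)
      also have "\<dots> = ?\<phi> t"
        by (simp only: char of_real_prod[symmetric] Re_complex_of_real)
      finally show ?thesis .
    qed
    have upper: "1 - ?\<phi> t \<le> C' * min 1 (t powr q)" if t: "0 < t" for t
    proof -
      have "1 - ?\<phi> t \<le> norm ((\<Prod>l<k. 1) - ?\<phi> t)"
        by simp
      also have "\<dots> \<le> (\<Sum>l<k. norm (1 - \<psi> (t * a l)))"
        by (rule norm_prod_diff) (auto simp: \<psi>1)
      also have "\<dots> \<le> (\<Sum>l<k. C * (t powr q * \<bar>a l\<bar> powr q))"
      proof (rule sum_mono)
        fix l
        show "norm (1 - \<psi> (t * a l)) \<le> C * (t powr q * \<bar>a l\<bar> powr q)"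
          using up[of "t * a l"] \<psi>1[of "t * a l"] t by (simp add: abs_mult powr_mult)
      qed
      also have "\<dots> = C * t powr q"
        by (simp add: a flip: sum_distrib_left)
      finally have 1: "1 - ?\<phi> t \<le> C * t powr q" .
      have "\<bar>?\<phi> t\<bar> \<le> 1"
        unfolding abs_prod by (rule prod_le_1) (auto simp: \<psi>1)
      then have 2: "1 - ?\<phi> t \<le> 2" by linarith
      show ?thesis
        using 1 2 mult_right_mono[of C C' "t powr q"] by (auto simp: min_def C'_def)
    qed
    have lower: "c / (1 + c) * t powr q \<le> 1 - ?\<phi> t" if t: "0 < t" "t \<le> t0" for t
    proof -
      have al: "\<bar>a l\<bar> \<le> 1" if "l < k" for l
      proof -
        have "\<bar>a l\<bar> powr q \<le> 1"
          using a member_le_sum[of l "{..<k}" "\<lambda>l. \<bar>a l\<bar> powr q"] that by simp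
        then have "(\<bar>a l\<bar> powr q) powr (1/q) \<le> 1 powr (1/q)" using pq by (intro powr_mono2) auto
        then show ?thesis using pq by (simp add: powr_powr)
      qed
      have "?\<phi> t \<le> (\<Prod>l<k. exp (- (c * t powr q * \<bar>a l\<bar> powr q)))"
      proof (rule prod_mono)
        fix l assume "l \<in> {..<k}"
        then have al1: "\<bar>a l\<bar> \<le> 1" using al by auto
        have 1: "\<bar>t * a l\<bar> \<le> t0"
          using mult_mono[OF t(2) al1] t t0 by (simp add: abs_mult)
        have "C * \<bar>t * a l\<bar> powr q \<le> C * t0 powr q"
          using 1 pq cC t0 by (intro mult_left_mono powr_mono2) auto
        then have 2: "0 \<le> \<psi> (t * a l)" using up[of "t * a l"] t0 by linarith
        have "c * \<bar>t * a l\<bar> powr q \<le> 1 - \<psi> (t * a l)"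
          using 1 t0 by (intro lo) auto
        moreover have "c * \<bar>t * a l\<bar> powr q = c * t powr q * \<bar>a l\<bar> powr q"
          using t by (simp add: abs_mult powr_mult)
        ultimately show "0 \<le> \<psi> (t * a l) \<and> \<psi> (t * a l) \<le> exp (- (c * t powr q * \<bar>a l\<bar> powr q))"
          using 2 exp_ge_add_one_self[of "- (c * t powr q * \<bar>a l\<bar> powr q)"] by linarith
      qed
      also have "\<dots> = exp (- (c * t powr q))"
        by (simp add: exp_sum[symmetric] sum_negf a flip: sum_distrib_left)
      finally have "?\<phi> t \<le> exp (- (c * t powr q))" .
      moreover have "t powr q \<le> 1" using t t0 pq by (intro powr_le1) auto
      then have "c * t powr q / (1 + c) \<le> 1 - exp (- (c * t powr q))"
        using cC by (intro one_minus_exp_ge) (auto simp: mult_left_le)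
      ultimately show ?thesis by simp
    qed
    have "(\<integral>\<^sup>+g. ennreal (\<bar>?Y g\<bar> powr p) \<partial>?M) \<le> ennreal (upper_moment p q C')"
      using pq by (intro absolute_moment_le[OF prob meas _ _ _ _ cosY upper]) (auto simp: C'_def)
    also have "\<dots> \<le> ennreal B" by (intro ennreal_leI) (simp add: B_def)
    moreover have "ennreal A \<le> (\<integral>\<^sup>+g. ennreal (\<bar>?Y g\<bar> powr p) \<partial>?M)"
      unfolding A_def using pq cC t0 by (intro absolute_moment_ge[OF prob meas _ _ _ _ _ cosY lower]) auto
    ultimately show ?thesis by simp
  qed
  show ?thesis
  proof (rule exI[of _ A], rule exI[of _ B], intro conjI allI AB)
    fix k and a :: "nat \<Rightarrow> real"
    let ?S = "\<Sum>l<k. \<bar>a l\<bar> powr q"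
    let ?I = "\<integral>\<^sup>+g. ennreal (\<bar>\<Sum>l<k. g l * a l\<bar> powr p) \<partial>Pi\<^sub>M {..<k} (\<lambda>_. \<nu>)"
    have "ennreal (A * ?S powr (p / q)) \<le> ?I \<and> ?I \<le> ennreal (B * ?S powr (p / q))"
    proof (cases "?S = 0")
      case True
      then have "a l = 0" if "l < k" for l using that by (subst (asm) sum_nonneg_eq_0_iff) auto
      then show ?thesis using True by simp
    next
      case False
      then have S: "0 < ?S" by (simp add: order_less_le sum_nonneg)
      define s where "s = ?S powr (1 / q)"
      have s: "0 < s" "s powr q = ?S" "s powr p = ?S powr (p / q)"
        using S pq by (auto simp: s_def powr_powr)
      define a' where "a' l = a l / s" for l
      have "(\<Sum>l<k. \<bar>a' l\<bar> powr q) = 1"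
        using s S by (simp add: a'_def abs_divide powr_divide flip: sum_divide_distrib)
      note n = normalized[OF this]
      have "?I = (\<integral>\<^sup>+g. ennreal (s powr p) * ennreal (\<bar>\<Sum>l<k. g l * a' l\<bar> powr p) \<partial>Pi\<^sub>M {..<k} (\<lambda>_. \<nu>))"
      proof (rule nn_integral_cong)
        fix g :: "nat \<Rightarrow> real"
        have "(\<Sum>l<k. g l * a l) = s * (\<Sum>l<k. g l * a' l)"
          using s by (simp add: a'_def sum_distrib_left)
        then show "ennreal (\<bar>\<Sum>l<k. g l * a l\<bar> powr p) = ennreal (s powr p) * ennreal (\<bar>\<Sum>l<k. g l * a' l\<bar> powr p)"
          using s by (simp add: abs_mult powr_mult ennreal_mult)
      qed
      also have "\<dots> = ennreal (s powr p) * (\<integral>\<^sup>+g. ennreal (\<bar>\<Sum>l<k. g l * a' l\<bar> powr p) \<partial>Pi\<^sub>M {..<k} (\<lambda>_. \<nu>))"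
        by (rule nn_integral_cmult) measurable
      finally have I: "?I = \<dots>" .
      have "ennreal (A * s powr p) \<le> ?I" "?I \<le> ennreal (B * s powr p)"
        unfolding I using n AB mult_left_mono[of _ _ "ennreal (s powr p)"]
        by (simp_all add: ennreal_mult mult.commute[of _ "ennreal (s powr p)"])
      then show ?thesis by (simp add: s)
    qed
    then show "ennreal (A * ?S powr (p / q)) \<le> ?I" "?I \<le> ennreal (B * ?S powr (p / q))" by auto
  qed
qed

section \<open>Stable laws on the scalar field\<close>

text \<open>Factorizing over the coordinates reduces total mass and characteristic function to the real
normal law.\<close>

lemma std_gaussian_eq_prod:
  "(std_gaussian :: 'k::euclidean_space measure)
     = density lborel (\<lambda>z. ennreal (\<Prod>b\<in>Basis. std_normal_density (z \<bullet> b)))"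
proof -
  have "(2 * pi) powr (- real DIM('k) / 2) * exp (- (norm z)\<^sup>2 / 2) = (\<Prod>b\<in>Basis. std_normal_density (z \<bullet> b))"
    for z :: 'k
  proof -
    have n: "(norm z)\<^sup>2 = (\<Sum>b\<in>Basis. (z \<bullet> b)\<^sup>2)"
      by (subst euclidean_inner[of z z, folded power2_norm_eq_inner]) (simp add: power2_eq_square)
    have "(\<Prod>b\<in>(Basis::'k set). std_normal_density (z \<bullet> b))
        = (1 / sqrt (2 * pi)) ^ DIM('k) * exp (\<Sum>b\<in>Basis. - (z \<bullet> b)\<^sup>2 / 2)"
      by (simp add: std_normal_density_def prod.distrib prod_dividef exp_sum power_divide)
    also have "(1 / sqrt (2 * pi)) ^ DIM('k) = (2 * pi) powr (- real DIM('k) / 2)"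
    proof -
      have "1 / sqrt (2 * pi) = (2 * pi) powr (- (1 / 2))"
        by (simp add: powr_minus powr_half_sqrt inverse_eq_divide)
      then show ?thesis
        by (simp add: powr_realpow[symmetric] powr_powr)
    qed
    also have "(\<Sum>b\<in>Basis. - (z \<bullet> b)\<^sup>2 / 2) = - (norm z)\<^sup>2 / 2"
      by (simp add: n sum_negf sum_divide_distrib)
    finally show ?thesis by simp
  qed
  then show ?thesis by (simp add: std_gaussian_def)
qed

lemma std_gaussian_prob_space: "prob_space (std_gaussian :: 'k::euclidean_space measure)"
proof (rule prob_spaceI)
  interpret product_sigma_finite "\<lambda>_::'k. lborel :: real measure" ..
  have "emeasure (std_gaussian :: 'k measure) (space std_gaussian)
      = (\<integral>\<^sup>+z. (\<Prod>b\<in>Basis. ennreal (std_normal_density (z \<bullet> b))) \<partial>(lborel :: 'k measure))"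
    unfolding std_gaussian_eq_prod by (simp add: emeasure_density prod_ennreal)
  also have "\<dots> = (\<integral>\<^sup>+f. (\<Prod>b\<in>Basis. ennreal (std_normal_density (f b))) \<partial>(\<Pi>\<^sub>M b\<in>(Basis::'k set). lborel))"
    by (subst lborel_eq[where 'a = 'k], subst nn_integral_distr)
       (auto simp: inner_sum_left inner_Basis if_distrib cong: if_cong prod.cong intro!: nn_integral_cong)
  also have "\<dots> = (\<Prod>b\<in>(Basis::'k set). (\<integral>\<^sup>+x. ennreal (std_normal_density x) \<partial>lborel))"
    by (rule product_nn_integral_prod) auto
  also have "(\<integral>\<^sup>+x. ennreal (std_normal_density x) \<partial>lborel) = 1"
    using prob_space.emeasure_space_1[OF prob_space_normal_density[of 1 0]]
    by (simp add: emeasure_density)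
  finally show "emeasure (std_gaussian :: 'k measure) (space std_gaussian) = 1" by simp
qed

lemma std_gaussian_char:
  fixes w :: "'k::euclidean_space"
  shows "(CLINT z|std_gaussian. iexp (z \<bullet> w)) = complex_of_real (exp (- (norm w)\<^sup>2 / 2))"
proof -
  interpret product_sigma_finite "\<lambda>_::'k. lborel :: real measure" ..
  have "(CLINT z|std_gaussian. iexp (z \<bullet> w))
      = (LINT z|lborel. (\<Prod>b\<in>Basis. std_normal_density (z \<bullet> b)) *\<^sub>R iexp (z \<bullet> w))"
    unfolding std_gaussian_eq_prod by (subst integral_density) (auto intro!: prod_nonneg)
  also have "\<dots> = (LINT z|lborel. (\<Prod>b\<in>Basis. std_normal_density (z \<bullet> b) *\<^sub>R iexp ((w \<bullet> b) * (z \<bullet> b))))"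
  proof (rule Bochner_Integration.integral_cong[OF refl])
    fix z :: 'k
    have "iexp (z \<bullet> w) = (\<Prod>b\<in>Basis. iexp ((w \<bullet> b) * (z \<bullet> b)))"
      by (subst euclidean_inner[of z w]) (simp add: exp_sum sum_distrib_left mult_ac)
    then show "(\<Prod>b\<in>Basis. std_normal_density (z \<bullet> b)) *\<^sub>R iexp (z \<bullet> w)
      = (\<Prod>b\<in>Basis. std_normal_density (z \<bullet> b) *\<^sub>R iexp ((w \<bullet> b) * (z \<bullet> b)))"
      by (simp add: scaleR_conv_of_real prod.distrib)
  qed
  also have "\<dots> = (LINT f|(\<Pi>\<^sub>M b\<in>(Basis::'k set). lborel). (\<Prod>b\<in>Basis. std_normal_density (f b) *\<^sub>R iexp ((w \<bullet> b) * f b)))"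
    by (subst lborel_eq[where 'a = 'k], subst integral_distr)
       (auto simp: inner_sum_left inner_Basis if_distrib cong: if_cong prod.cong intro!: Bochner_Integration.integral_cong)
  also have "\<dots> = (\<Prod>b\<in>(Basis::'k set). LINT x|lborel. std_normal_density x *\<^sub>R iexp ((w \<bullet> b) * x))"
  proof (rule product_integral_prod)
    fix b :: 'k
    interpret N: prob_space std_normal_distribution
      using real_dist_normal_dist by (simp add: real_distribution_def)
    have "integrable std_normal_distribution (\<lambda>x. iexp ((w \<bullet> b) * x))"
      by (rule N.integrable_const_bound[of _ 1]) auto
    then show "integrable lborel (\<lambda>x. std_normal_density x *\<^sub>R iexp ((w \<bullet> b) * x))"
      by (subst (asm) integrable_density) auto
  qed simp
  also have "\<dots> = (\<Prod>b\<in>(Basis::'k set). char std_normal_distribution (w \<bullet> b))"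
    unfolding char_def by (intro prod.cong refl) (subst integral_density, auto)
  also have "\<dots> = complex_of_real (\<Prod>b\<in>(Basis::'k set). exp (- ((w \<bullet> b)\<^sup>2) / 2))"
    by (simp add: char_std_normal_distribution)
  also have "(\<Prod>b\<in>(Basis::'k set). exp (- ((w \<bullet> b)\<^sup>2) / 2)) = exp (- (norm w)\<^sup>2 / 2)"
    by (subst euclidean_inner[of w w, folded power2_norm_eq_inner])
       (simp add: exp_sum[symmetric] power2_eq_square sum_negf sum_divide_distrib)
  finally show ?thesis .
qed

text \<open>The two kinds of admissible laws differ only by the factor \<open>\<kappa>\<close> (1/2 for the Gaussian law, 1 otherwise)
  and are treated together from here on.\<close>

locale stable_law = prob_space \<mu>
  for \<mu> :: "'k::{real_normed_field, euclidean_space} measure" +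
  fixes s \<kappa> :: real
  assumes s: "0 < s" "s \<le> 2" and \<kappa>: "0 < \<kappa>"
    and sets_\<mu> [simp, measurable_cong]: "sets \<mu> = sets borel"
    and cf: "\<And>w. (CLINT z|\<mu>. iexp (z \<bullet> w)) = complex_of_real (exp (- \<kappa> * norm w powr s))"

lemma stable_measure_imp_stable_law:
  assumes "stable_measure s \<mu>"
  shows "\<exists>\<kappa>. stable_law \<mu> s \<kappa>"
proof -
  consider "s = 2" "\<mu> = std_gaussian" | "0 < s" "s < 2" "prob_space \<mu>" "sets \<mu> = sets borel"
    "\<And>w. (LINT z|\<mu>. exp (\<i> * complex_of_real (z \<bullet> w))) = complex_of_real (exp (- (norm w powr s)))"
    using assms by (auto simp: stable_measure_def)
  then show ?thesis
  proof cases
    case 1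
    have "norm w powr 2 = (norm w)\<^sup>2" for w :: 'a by (cases "w = 0") auto
    then have "stable_law \<mu> s (1/2)"
      unfolding stable_law_def stable_law_axioms_def 1
      by (auto simp: std_gaussian_char std_gaussian_prob_space) (auto simp: std_gaussian_def)
    then show ?thesis ..
  next
    case 2
    then have "stable_law \<mu> s 1"
      unfolding stable_law_def stable_law_axioms_def by auto
    then show ?thesis ..
  qed
qed

text \<open>Since the norm is multiplicative, multiplication by \<open>c\<close> is \<open>norm c\<close> times an isometry; the right-hand side
  displays its adjoint, that is, multiplication by the conjugate of \<open>c\<close>. This is how rotation invariance of the law enters without
  identifying the scalar field.\<close>

lemma inner_mult_left_adjoint:
  fixes c z w :: "'k::{real_normed_field, euclidean_space}"
  assumes "c \<noteq> 0"
  shows "(c * z) \<bullet> w = z \<bullet> ((norm c)\<^sup>2 *\<^sub>R (w / c))"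
proof -
  have polar: "x \<bullet> y = ((norm (x + y))\<^sup>2 - (norm x)\<^sup>2 - (norm y)\<^sup>2) / 2" for x y :: 'k
    by (simp add: power2_norm_eq_inner inner_add_left inner_add_right inner_commute)
  have "(c * z) \<bullet> (c * (w / c)) = (norm c)\<^sup>2 * (z \<bullet> (w / c))"
    unfolding polar distrib_left[symmetric] norm_mult power_mult_distrib by (simp add: algebra_simps)
  then show ?thesis using assms by simp
qed

context stable_law
begin

lemma prob_space_power: "prob_space (Pi\<^sub>M I (\<lambda>_. \<mu>))"
  by (intro prob_space_PiM prob_space_axioms)

lemma cf_scaled: "(CLINT z|\<mu>. iexp ((c * z) \<bullet> w)) = complex_of_real (exp (- \<kappa> * (norm c * norm w) powr s))"
proof (cases "c = 0")
  case False
  have "norm ((norm c)\<^sup>2 *\<^sub>R (w / c)) = norm c * norm w"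
    using False by (simp add: norm_divide power2_eq_square)
  then show ?thesis
    using cf[of "(norm c)\<^sup>2 *\<^sub>R (w / c)"] by (simp add: inner_mult_left_adjoint[OF False])
qed (simp add: prob_space)

lemma cf_combination:
  fixes N :: nat
  shows "(CLINT z|Pi\<^sub>M {..<N} (\<lambda>_. \<mu>). iexp ((\<Sum>i<N. c i * z i) \<bullet> w))
     = complex_of_real (exp (- \<kappa> * ((\<Sum>i<N. norm (c i) powr s) * norm w powr s)))"
proof -
  have "(CLINT z|Pi\<^sub>M {..<N} (\<lambda>_. \<mu>). iexp ((\<Sum>i<N. c i * z i) \<bullet> w))
      = (CLINT z|Pi\<^sub>M {..<N} (\<lambda>_. \<mu>). iexp (\<Sum>i<N. (c i * z i) \<bullet> w))"
    by (simp add: inner_sum_left)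
  also have "\<dots> = (\<Prod>i<N. CLINT z|\<mu>. iexp ((c i * z) \<bullet> w))"
    by (rule char_PiM_sum) (auto intro: prob_space_axioms)
  also have "\<dots> = complex_of_real (exp (\<Sum>i<N. - \<kappa> * (norm (c i) * norm w) powr s))"
    unfolding cf_scaled by (simp add: exp_sum)
  also have "(\<Sum>i<N. - \<kappa> * (norm (c i) * norm w) powr s) = - \<kappa> * ((\<Sum>i<N. norm (c i) powr s) * norm w powr s)"
    by (simp add: powr_mult sum_negf sum_distrib_left sum_distrib_right mult.assoc)
  finally show ?thesis .
qed

definition coord :: 'k where "coord = (SOME b. b \<in> Basis)"

lemma coord: "coord \<in> Basis" "norm coord = 1"
  using nonempty_Basis by (auto simp: coord_def some_in_eq)

definition moment :: "real \<Rightarrow> ennreal" where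
  "moment p = (\<integral>\<^sup>+z. ennreal (\<bar>z \<bullet> coord\<bar> powr p) \<partial>\<mu>)"

text \<open>Stability: by uniqueness of characteristic functions on the real line, the \<open>b\<close>-coordinate of the combination is distributed
  like \<open>\<sigma>\<close> times a fixed coordinate of \<open>z\<close>, where \<open>\<sigma>\<close> is the \<open>\<ell>\<^sub>s\<close>-norm of \<open>c\<close>. The choice of \<open>b\<close> does not
  matter as the characteristic function is radial.\<close>

lemma moment_combination:
  fixes N :: nat
  assumes b: "b \<in> Basis" and p: "0 < p"
  shows "(\<integral>\<^sup>+z. ennreal (\<bar>(\<Sum>i<N. c i * z i) \<bullet> b\<bar> powr p) \<partial>Pi\<^sub>M {..<N} (\<lambda>_. \<mu>))
      = ennreal ((\<Sum>i<N. norm (c i) powr s) powr (p / s)) * moment p"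
proof -
  define \<sigma> where "\<sigma> = (\<Sum>i<N. norm (c i) powr s) powr (1 / s)"
  let ?Y = "\<lambda>z. (\<Sum>i<N. c i * z i) \<bullet> b" and ?M = "Pi\<^sub>M {..<N} (\<lambda>_. \<mu>)"
  have \<sigma>: "0 \<le> \<sigma>" "\<sigma> powr s = (\<Sum>i<N. norm (c i) powr s)" "\<sigma> powr p = (\<Sum>i<N. norm (c i) powr s) powr (p / s)"
    using s by (auto simp: \<sigma>_def powr_powr sum_nonneg)
  have Y[measurable]: "?Y \<in> borel_measurable ?M" by measurable
  have "distr ?M borel ?Y = distr \<mu> borel (\<lambda>z. \<sigma> * (z \<bullet> coord))"
  proof (rule Levy_uniqueness)
    show "real_distribution (distr ?M borel ?Y)"
      by (rule prob_space.real_distribution_distr[OF prob_space_power Y])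
    show "real_distribution (distr \<mu> borel (\<lambda>z. \<sigma> * (z \<bullet> coord)))"
      by (rule real_distribution_distr) simp
    show "char (distr ?M borel ?Y) = char (distr \<mu> borel (\<lambda>z. \<sigma> * (z \<bullet> coord)))"
    proof
      fix t
      have "char (distr ?M borel ?Y) t = (CLINT z|?M. iexp ((\<Sum>i<N. c i * z i) \<bullet> (t *\<^sub>R b)))"
        unfolding char_def by (subst integral_distr) auto
      also have "\<dots> = complex_of_real (exp (- \<kappa> * (\<bar>t\<bar> * \<sigma>) powr s))"
        unfolding cf_combination using b \<sigma> by (simp add: powr_mult mult.commute)
      also have "\<dots> = (CLINT z|\<mu>. iexp (z \<bullet> ((t * \<sigma>) *\<^sub>R coord)))"
        unfolding cf using coord \<sigma> by (simp add: abs_mult)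
      also have "\<dots> = char (distr \<mu> borel (\<lambda>z. \<sigma> * (z \<bullet> coord))) t"
        unfolding char_def by (subst integral_distr) (auto simp: mult.assoc)
      finally show "char (distr ?M borel ?Y) t = char (distr \<mu> borel (\<lambda>z. \<sigma> * (z \<bullet> coord))) t" .
    qed
  qed
  then have "(\<integral>\<^sup>+y. ennreal (\<bar>y\<bar> powr p) \<partial>distr ?M borel ?Y)
      = (\<integral>\<^sup>+y. ennreal (\<bar>y\<bar> powr p) \<partial>distr \<mu> borel (\<lambda>z. \<sigma> * (z \<bullet> coord)))" by simp
  then have "(\<integral>\<^sup>+z. ennreal (\<bar>?Y z\<bar> powr p) \<partial>?M) = (\<integral>\<^sup>+z. ennreal (\<bar>\<sigma> * (z \<bullet> coord)\<bar> powr p) \<partial>\<mu>)"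
    by (simp add: nn_integral_distr)
  also have "\<dots> = (\<integral>\<^sup>+z. ennreal (\<sigma> powr p) * ennreal (\<bar>z \<bullet> coord\<bar> powr p) \<partial>\<mu>)"
    using \<sigma> by (intro nn_integral_cong) (simp add: abs_mult powr_mult ennreal_mult)
  also have "\<dots> = ennreal (\<sigma> powr p) * moment p"
    unfolding moment_def by (rule nn_integral_cmult) measurable
  finally show ?thesis by (simp add: \<sigma>)
qed

lemma moment_pos: "moment p \<noteq> 0"
proof
  assume "moment p = 0"
  then have "AE z in \<mu>. z \<bullet> coord = 0"
    unfolding moment_def by (subst (asm) nn_integral_0_iff_AE) (auto simp: ennreal_eq_0_iff)
  then have "(CLINT z|\<mu>. iexp (z \<bullet> coord)) = (CLINT z|\<mu>. 1)"
    by (intro integral_cong_AE) auto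
  then have "complex_of_real (exp (- \<kappa>)) = 1"
    unfolding cf using coord prob_space by simp
  then show False using \<kappa> by (simp only: of_real_eq_1_iff) simp
qed

text \<open>For \<open>p < s\<close> this is a case of \<open>absolute_moment_le\<close>; for \<open>s = 2\<close> all moments are those of a
scaled normal variable.\<close>

lemma moment_finite:
  assumes p: "0 < p" and "p < s \<or> s = 2"
  shows "moment p < \<infinity>"
  using assms(2)
proof
  assume ps: "p < s"
  have "moment p \<le> ennreal (upper_moment p s (max 1 \<kappa>))"
    unfolding moment_def
  proof (rule absolute_moment_le[OF prob_space_axioms _ p ps s(2), where \<psi> = "\<lambda>t. exp (- \<kappa> * \<bar>t\<bar> powr s)"])
    fix t :: real
    have "(LINT z|\<mu>. cos (t * (z \<bullet> coord))) = Re (CLINT z|\<mu>. iexp (z \<bullet> (t *\<^sub>R coord)))"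
      by (subst integral_cos_eq_Re) (auto intro: prob_space_axioms)
    then show "(LINT z|\<mu>. cos (t * (z \<bullet> coord))) = exp (- \<kappa> * \<bar>t\<bar> powr s)"
      unfolding cf using coord by simp
  next
    fix t :: real assume "0 < t"
    have "1 - exp (- \<kappa> * \<bar>t\<bar> powr s) \<le> \<kappa> * t powr s"
      using exp_ge_add_one_self[of "- \<kappa> * \<bar>t\<bar> powr s"] \<open>0 < t\<close> by simp
    also have "\<dots> \<le> max 1 \<kappa> * t powr s" by (intro mult_right_mono) auto
    finally show "1 - exp (- \<kappa> * \<bar>t\<bar> powr s) \<le> max 1 \<kappa> * min 1 (t powr s)"
      by (auto simp: min_def intro: order_trans[of _ 1])
  qed (use \<kappa> in auto)
  then show ?thesis by (rule order.strict_trans1) simp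
next
  assume s2: "s = 2"
  interpret N: real_distribution std_normal_distribution by (rule real_dist_normal_dist)
  have "distr \<mu> borel (\<lambda>z. z \<bullet> coord) = distr std_normal_distribution borel (\<lambda>x. sqrt (2 * \<kappa>) * x)"
  proof (rule Levy_uniqueness)
    show "real_distribution (distr \<mu> borel (\<lambda>z. z \<bullet> coord))"
      by (rule real_distribution_distr) simp
    show "real_distribution (distr std_normal_distribution borel (\<lambda>x. sqrt (2 * \<kappa>) * x))"
      by (rule N.real_distribution_distr) simp
    show "char (distr \<mu> borel (\<lambda>z. z \<bullet> coord)) = char (distr std_normal_distribution borel (\<lambda>x. sqrt (2 * \<kappa>) * x))"
    proof
      fix t
      have "char (distr \<mu> borel (\<lambda>z. z \<bullet> coord)) t = (CLINT z|\<mu>. iexp (z \<bullet> (t *\<^sub>R coord)))"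
        unfolding char_def by (subst integral_distr) auto
      also have "\<dots> = complex_of_real (exp (- ((t * sqrt (2 * \<kappa>))\<^sup>2) / 2))"
        unfolding cf using coord s2 \<kappa> by (cases "t = 0") (auto simp: power_mult_distrib)
      also have "\<dots> = char std_normal_distribution (t * sqrt (2 * \<kappa>))"
        by (simp add: char_std_normal_distribution)
      also have "\<dots> = char (distr std_normal_distribution borel (\<lambda>x. sqrt (2 * \<kappa>) * x)) t"
        unfolding char_def by (subst integral_distr) (auto simp: mult.assoc)
      finally show "char (distr \<mu> borel (\<lambda>z. z \<bullet> coord)) t
        = char (distr std_normal_distribution borel (\<lambda>x. sqrt (2 * \<kappa>) * x)) t" .
    qed
  qed
  then have "(\<integral>\<^sup>+y. ennreal (\<bar>y\<bar> powr p) \<partial>distr \<mu> borel (\<lambda>z. z \<bullet> coord))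
      = (\<integral>\<^sup>+y. ennreal (\<bar>y\<bar> powr p) \<partial>distr std_normal_distribution borel (\<lambda>x. sqrt (2 * \<kappa>) * x))" by simp
  then have "moment p = (\<integral>\<^sup>+x. ennreal (\<bar>sqrt (2 * \<kappa>) * x\<bar> powr p) \<partial>std_normal_distribution)"
    unfolding moment_def by (subst (asm) (1 2) nn_integral_distr) auto
  also have "\<dots> \<le> (\<integral>\<^sup>+x. ennreal (1 + (sqrt (2 * \<kappa>) * x) ^ (2 * nat \<lceil>p\<rceil>)) \<partial>std_normal_distribution)"
  proof (intro nn_integral_mono ennreal_leI)
    fix x :: real
    define y where "y = \<bar>sqrt (2 * \<kappa>) * x\<bar>"
    have "y powr p \<le> 1 + y ^ (2 * nat \<lceil>p\<rceil>)"
    proof (cases "y \<le> 1")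
      case True
      then have "y powr p \<le> 1" using p by (intro powr_le1) (auto simp: y_def)
      moreover have "0 \<le> y ^ (2 * nat \<lceil>p\<rceil>)" by (auto simp: y_def)
      ultimately show ?thesis by linarith
    next
      case False
      have "p \<le> real (2 * nat \<lceil>p\<rceil>)" using p by linarith
      then have "y powr p \<le> y powr real (2 * nat \<lceil>p\<rceil>)" using False by (intro powr_mono) auto
      also have "\<dots> = y ^ (2 * nat \<lceil>p\<rceil>)" using False by (simp only: powr_realpow)
      finally show ?thesis by simp
    qed
    then show "\<bar>sqrt (2 * \<kappa>) * x\<bar> powr p \<le> 1 + (sqrt (2 * \<kappa>) * x) ^ (2 * nat \<lceil>p\<rceil>)"
      by (simp add: y_def power_even_abs del: abs_mult)
  qed
  also have "\<dots> = ennreal (LINT x|std_normal_distribution. 1 + (sqrt (2 * \<kappa>) * x) ^ (2 * nat \<lceil>p\<rceil>))"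
  proof (rule nn_integral_eq_integral)
    show "integrable std_normal_distribution (\<lambda>x. 1 + (sqrt (2 * \<kappa>) * x) ^ (2 * nat \<lceil>p\<rceil>))"
      unfolding power_mult_distrib
      by (intro Bochner_Integration.integrable_add integrable_mult_right integrable_std_normal_distribution_moment) simp
  qed (auto intro!: AE_I2 add_nonneg_nonneg zero_le_even_power)
  also have "\<dots> < \<infinity>" by simp
  finally show ?thesis .
qed

lemma lp_norm_combination:
  assumes p: "0 < p" and fin: "p < s \<or> s = 2"
  shows "\<exists>A B::real. 0 < A \<and> 0 < B \<and> (\<forall>(N::nat) c.
      ennreal (A * (\<Sum>i<N. norm (c i) powr s) powr (p / s))
        \<le> (\<integral>\<^sup>+z. ennreal (norm (\<Sum>i<N. c i * z i) powr p) \<partial>Pi\<^sub>M {..<N} (\<lambda>_. \<mu>)) \<and>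
      (\<integral>\<^sup>+z. ennreal (norm (\<Sum>i<N. c i * z i) powr p) \<partial>Pi\<^sub>M {..<N} (\<lambda>_. \<mu>))
        \<le> ennreal (B * (\<Sum>i<N. norm (c i) powr s) powr (p / s)))"
proof -
  obtain K where K: "moment p = ennreal K" "0 < K"
    using moment_finite[OF assms] moment_pos[of p] by (cases "moment p") (auto simp: less_le)
  define D where "D = real DIM('k) powr p * real DIM('k)"
  have D: "0 < D" by (simp add: D_def)
  show ?thesis
  proof (rule exI[of _ K], rule exI[of _ "D * K"], intro conjI allI)
    fix N :: nat and c :: "nat \<Rightarrow> 'k"
    let ?S = "(\<Sum>i<N. norm (c i) powr s) powr (p / s)" and ?M = "Pi\<^sub>M {..<N} (\<lambda>_. \<mu>)"
    let ?Z = "\<lambda>z. \<Sum>i<N. c i * z i"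
    have "ennreal (K * ?S) = (\<integral>\<^sup>+z. ennreal (\<bar>?Z z \<bullet> coord\<bar> powr p) \<partial>?M)"
      unfolding moment_combination[OF coord(1) p] K(1) using K by (simp add: ennreal_mult mult.commute)
    also have "\<dots> \<le> (\<integral>\<^sup>+z. ennreal (norm (?Z z) powr p) \<partial>?M)"
      by (rule coordinate_moment_le[OF _ p coord(1)]) measurable
    finally show "ennreal (K * ?S) \<le> (\<integral>\<^sup>+z. ennreal (norm (?Z z) powr p) \<partial>?M)" .
    have "(\<integral>\<^sup>+z. ennreal (norm (?Z z) powr p) \<partial>?M)
        \<le> ennreal (real DIM('k) powr p) * (\<Sum>b\<in>Basis. \<integral>\<^sup>+z. ennreal (\<bar>?Z z \<bullet> b\<bar> powr p) \<partial>?M)"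
      by (rule moment_le_coordinates[OF _ p]) measurable
    also have "\<dots> = ennreal (real DIM('k) powr p) * (\<Sum>b\<in>(Basis::'k set). ennreal ?S * ennreal K)"
      using K by (simp add: moment_combination[OF _ p])
    also have "\<dots> = ennreal (D * K * ?S)"
      using K by (simp add: D_def ennreal_mult ennreal_of_nat_eq_real_of_nat mult_ac)
    finally show "(\<integral>\<^sup>+z. ennreal (norm (?Z z) powr p) \<partial>?M) \<le> ennreal (D * K * ?S)" .
  qed (use K D in auto)
qed

end

section \<open>Linear maps into \<open>\<ell>\<^sub>q\<^sup>k\<close>\<close>

text \<open>The convex function \<open>v\<^sup>\<alpha>\<close> lies above its tangent at \<open>a\<close>. Both Jensen inequalities below integrate
this at the mean value; subtraction is avoided so that it can be used with values in \<open>[0, \<infinity>]\<close>.\<close>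

lemma powr_tangent:
  fixes a v :: real
  assumes "1 \<le> \<alpha>" "0 < a" "0 \<le> v"
  shows "a powr \<alpha> + \<alpha> * a powr (\<alpha> - 1) * v \<le> v powr \<alpha> + \<alpha> * a powr \<alpha>"
proof -
  define x where "x = v / a"
  have x: "0 \<le> x" "v = a * x" using assms by (auto simp: x_def)
  have "1 + \<alpha> * x \<le> x powr \<alpha> + \<alpha>"
  proof (cases "x = 0")
    case False
    have "(x powr \<alpha>) powr (1 / \<alpha>) * 1 powr (1 - 1 / \<alpha>) \<le> 1 / \<alpha> * (x powr \<alpha>) + (1 - 1 / \<alpha>) * 1"
      using assms x False by (intro Youngs_inequality_0) auto
    then have "x \<le> x powr \<alpha> / \<alpha> + (1 - 1 / \<alpha>)"
      using assms x by (simp add: powr_powr)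
    then have "\<alpha> * x \<le> \<alpha> * (x powr \<alpha> / \<alpha> + (1 - 1 / \<alpha>))"
      using assms by (intro mult_left_mono) auto
    also have "\<dots> = x powr \<alpha> + \<alpha> - 1" using assms by (simp add: field_simps)
    finally show ?thesis by linarith
  qed (use assms in simp)
  then have "a powr \<alpha> * (1 + \<alpha> * x) \<le> a powr \<alpha> * (x powr \<alpha> + \<alpha>)"
    by (intro mult_left_mono) auto
  moreover have "a powr (\<alpha> - 1) * a = a powr \<alpha>"
    using assms powr_add[of a "\<alpha> - 1" 1] by simp
  then have eq: "\<alpha> * a powr (\<alpha> - 1) * v = a powr \<alpha> * (\<alpha> * x)"
    unfolding x(2) by (metis mult.assoc mult.commute)
  have "v powr \<alpha> = a powr \<alpha> * x powr \<alpha>"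
    using x assms by (simp add: powr_mult)
  ultimately show ?thesis
    unfolding eq by (simp add: algebra_simps)
qed

text \<open>Nonnegative integrals keep this applicable to moments that are not known to be finite.\<close>

lemma (in prob_space) powr_jensen_nn_integral:
  assumes [measurable]: "f \<in> borel_measurable M" and f: "\<And>x. 0 \<le> f x"
    and \<alpha>: "1 \<le> \<alpha>" and a: "0 \<le> a" "ennreal a \<le> (\<integral>\<^sup>+x. ennreal (f x) \<partial>M)"
  shows "ennreal (a powr \<alpha>) \<le> (\<integral>\<^sup>+x. ennreal (f x powr \<alpha>) \<partial>M)"
proof (cases "a = 0")
  case False
  then have a0: "0 < a" using a by simp
  let ?c = "\<alpha> * a powr (\<alpha> - 1)"
  have "?c * a = \<alpha> * a powr \<alpha>" using a0 powr_add[of a "\<alpha> - 1" 1] by simp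
  then have "ennreal (a powr \<alpha>) + ennreal (\<alpha> * a powr \<alpha>) = ennreal (a powr \<alpha>) + ennreal ?c * ennreal a"
    using \<alpha> a by (simp add: ennreal_mult[symmetric])
  also have "\<dots> \<le> ennreal (a powr \<alpha>) + ennreal ?c * (\<integral>\<^sup>+x. ennreal (f x) \<partial>M)"
    using a by (intro add_left_mono mult_left_mono) auto
  also have "\<dots> = (\<integral>\<^sup>+x. ennreal (a powr \<alpha>) + ennreal ?c * ennreal (f x) \<partial>M)"
    by (subst nn_integral_add) (auto simp: nn_integral_cmult emeasure_space_1)
  also have "\<dots> \<le> (\<integral>\<^sup>+x. ennreal (f x powr \<alpha>) + ennreal (\<alpha> * a powr \<alpha>) \<partial>M)"
  proof (rule nn_integral_mono)
    fix x
    show "ennreal (a powr \<alpha>) + ennreal ?c * ennreal (f x) \<le> ennreal (f x powr \<alpha>) + ennreal (\<alpha> * a powr \<alpha>)"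
      using powr_tangent[OF \<alpha> a0 f[of x]] \<alpha> f[of x]
      by (simp add: ennreal_mult[symmetric] flip: ennreal_plus)
  qed
  also have "\<dots> = (\<integral>\<^sup>+x. ennreal (f x powr \<alpha>) \<partial>M) + ennreal (\<alpha> * a powr \<alpha>)"
    by (subst nn_integral_add) (auto simp: emeasure_space_1)
  finally show ?thesis
    by (metis ennreal_add_left_cancel_le ennreal_neq_top add.commute infinity_ennreal_def)
qed simp

lemma powr_jensen_sum:
  fixes w a :: "'i \<Rightarrow> real"
  assumes "finite I" "\<And>i. i \<in> I \<Longrightarrow> 0 \<le> w i" "sum w I = 1" "\<And>i. i \<in> I \<Longrightarrow> 0 \<le> a i" "1 \<le> \<alpha>"
  shows "(\<Sum>i\<in>I. w i * a i) powr \<alpha> \<le> (\<Sum>i\<in>I. w i * a i powr \<alpha>)"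
proof (cases "(\<Sum>i\<in>I. w i * a i) = 0")
  case True
  then show ?thesis using assms by (simp add: sum_nonneg)
next
  case False
  define m where "m = (\<Sum>i\<in>I. w i * a i)"
  have m: "0 < m" using False assms by (auto simp: m_def less_le sum_nonneg)
  have "m powr \<alpha> + \<alpha> * m powr (\<alpha> - 1) * m = (\<Sum>i\<in>I. w i * (m powr \<alpha> + \<alpha> * m powr (\<alpha> - 1) * a i))"
    using assms(3) by (simp add: distrib_left sum.distrib m_def[symmetric] mult.left_commute[of "w _"]
      flip: sum_distrib_left sum_distrib_right)
  also have "\<dots> \<le> (\<Sum>i\<in>I. w i * (a i powr \<alpha> + \<alpha> * m powr \<alpha>))"
    using assms m by (intro sum_mono mult_left_mono powr_tangent) auto
  also have "\<dots> = (\<Sum>i\<in>I. w i * a i powr \<alpha>) + \<alpha> * m powr \<alpha>"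
    using assms(3) by (simp add: distrib_left sum.distrib flip: sum_distrib_right)
  also have "\<alpha> * m powr (\<alpha> - 1) * m = \<alpha> * m powr \<alpha>" using m powr_add[of m "\<alpha> - 1" 1] by simp
  finally show ?thesis by (simp add: m_def)
qed

text \<open>Real random variables also embed vector-valued (in particular complex) \<open>\<ell>\<^sub>q\<close>: the norm of a vector
is comparable to the sum of the absolute values of its coordinates.\<close>

lemma lq_norm_as_moment_euclidean:
  fixes p q c C :: real
  assumes pq: "0 < p" "p < q" "q \<le> 2" and cC: "0 < c" "0 < C" and st: "stable_like q c C \<nu>"
  shows "\<exists>A B::real. 0 < A \<and> 0 < B \<and> (\<forall>k (y :: nat \<Rightarrow> 'a::euclidean_space).
      ennreal (A * (\<Sum>l<k. norm (y l) powr q) powr (p / q))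
        \<le> (\<integral>\<^sup>+g. ennreal (norm (\<Sum>l<k. g l *\<^sub>R y l) powr p) \<partial>Pi\<^sub>M {..<k} (\<lambda>_. \<nu>)) \<and>
      (\<integral>\<^sup>+g. ennreal (norm (\<Sum>l<k. g l *\<^sub>R y l) powr p) \<partial>Pi\<^sub>M {..<k} (\<lambda>_. \<nu>))
        \<le> ennreal (B * (\<Sum>l<k. norm (y l) powr q) powr (p / q)))"
proof -
  interpret real_distribution \<nu> using st by (simp add: stable_like_def)
  obtain A B :: real where AB: "0 < A" "0 < B" and
    lo: "\<And>k (a :: nat \<Rightarrow> real). ennreal (A * (\<Sum>l<k. \<bar>a l\<bar> powr q) powr (p / q))
        \<le> (\<integral>\<^sup>+g. ennreal (\<bar>\<Sum>l<k. g l * a l\<bar> powr p) \<partial>Pi\<^sub>M {..<k} (\<lambda>_. \<nu>))" and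
    up: "\<And>k (a :: nat \<Rightarrow> real). (\<integral>\<^sup>+g. ennreal (\<bar>\<Sum>l<k. g l * a l\<bar> powr p) \<partial>Pi\<^sub>M {..<k} (\<lambda>_. \<nu>))
        \<le> ennreal (B * (\<Sum>l<k. \<bar>a l\<bar> powr q) powr (p / q))"
    using lq_norm_as_moment[OF assms] by blast
  define d where "d = real DIM('a)"
  have d: "0 < d" by (simp add: d_def)
  define E where "E = (d powr q * d) powr (p / q)"
  have E: "0 < E" using d by (simp add: E_def)
  show ?thesis
  proof (rule exI[of _ "A / E"], rule exI[of _ "d powr p * d * B"], intro conjI allI)
    fix k :: nat and y :: "nat \<Rightarrow> 'a"
    let ?M = "Pi\<^sub>M {..<k} (\<lambda>_. \<nu>)"
    let ?Z = "\<lambda>g. \<Sum>l<k. g l *\<^sub>R y l"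
    let ?S = "\<lambda>b. \<Sum>l<k. \<bar>y l \<bullet> b\<bar> powr q" and ?T = "\<Sum>l<k. norm (y l) powr q"
    have inner: "?Z g \<bullet> b = (\<Sum>l<k. g l * (y l \<bullet> b))" for g b
      by (simp add: inner_sum_left)
    have [measurable]: "?Z \<in> borel_measurable ?M" by measurable
    have "Max (?S ` Basis) \<in> ?S ` Basis" by (rule Max_in) auto
    then obtain b where b0: "Max (?S ` Basis) = ?S b" "b \<in> Basis" by (rule imageE)
    note b = b0(2) b0(1)[symmetric]
    have "?T \<le> (\<Sum>l<k. d powr q * (\<Sum>b\<in>Basis. \<bar>y l \<bullet> b\<bar> powr q))"
    proof (rule sum_mono)
      fix l
      have "norm (y l) powr q \<le> (\<Sum>b\<in>Basis. \<bar>y l \<bullet> b\<bar>) powr q"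
        using pq by (intro powr_mono2 norm_le_l1) auto
      also have "\<dots> \<le> d powr q * (\<Sum>b\<in>Basis. \<bar>y l \<bullet> b\<bar> powr q)"
        unfolding d_def using pq by (intro powr_sum_le) auto
      finally show "norm (y l) powr q \<le> d powr q * (\<Sum>b\<in>Basis. \<bar>y l \<bullet> b\<bar> powr q)" .
    qed
    also have "\<dots> = d powr q * (\<Sum>b\<in>Basis. ?S b)"
      by (simp add: sum_distrib_left[symmetric] sum.swap[of _ "{..<k}"])
    also have "(\<Sum>b\<in>Basis. ?S b) \<le> d * ?S b"
      unfolding d_def b(2) by (rule sum_bounded_above) auto
    finally have "?T \<le> d powr q * d * ?S b" by (simp add: mult_left_mono mult.assoc)
    then have "?T powr (p / q) \<le> (d powr q * d * ?S b) powr (p / q)"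
      using pq by (intro powr_mono2) (auto simp: sum_nonneg)
    also have "\<dots> = E * ?S b powr (p / q)"
      using d by (simp add: E_def powr_mult sum_nonneg)
    finally have "A / E * ?T powr (p / q) \<le> A / E * (E * ?S b powr (p / q))"
      using AB E by (intro mult_left_mono) auto
    then have "ennreal (A / E * ?T powr (p / q)) \<le> ennreal (A * ?S b powr (p / q))"
      using E by (intro ennreal_leI) simp
    also have "\<dots> \<le> (\<integral>\<^sup>+g. ennreal (\<bar>?Z g \<bullet> b\<bar> powr p) \<partial>?M)"
      unfolding inner by (rule lo)
    also have "\<dots> \<le> (\<integral>\<^sup>+g. ennreal (norm (?Z g) powr p) \<partial>?M)"
      using pq b by (intro coordinate_moment_le) auto
    finally show "ennreal (A / E * ?T powr (p / q)) \<le> (\<integral>\<^sup>+g. ennreal (norm (?Z g) powr p) \<partial>?M)" .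
    have "(\<integral>\<^sup>+g. ennreal (norm (?Z g) powr p) \<partial>?M)
        \<le> ennreal (d powr p) * (\<Sum>b\<in>Basis. \<integral>\<^sup>+g. ennreal (\<bar>?Z g \<bullet> b\<bar> powr p) \<partial>?M)"
      unfolding d_def using pq by (intro moment_le_coordinates) auto
    also have "\<dots> \<le> ennreal (d powr p) * (\<Sum>b\<in>(Basis :: 'a set). ennreal (B * ?T powr (p / q)))"
    proof (intro mult_left_mono sum_mono)
      fix b :: 'a assume b: "b \<in> Basis"
      have "(\<integral>\<^sup>+g. ennreal (\<bar>?Z g \<bullet> b\<bar> powr p) \<partial>?M) \<le> ennreal (B * ?S b powr (p / q))"
        unfolding inner by (rule up)
      also have "\<dots> \<le> ennreal (B * ?T powr (p / q))"
        using pq b AB by (intro ennreal_leI mult_left_mono powr_mono2 sum_mono) (auto simp: sum_nonneg intro: Basis_le_norm)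
      finally show "(\<integral>\<^sup>+g. ennreal (\<bar>?Z g \<bullet> b\<bar> powr p) \<partial>?M) \<le> ennreal (B * ?T powr (p / q))" .
    qed simp
    also have "\<dots> = ennreal (d powr p * d * B * ?T powr (p / q))"
      using d AB by (simp add: d_def ennreal_mult[symmetric] ennreal_of_nat_eq_real_of_nat mult_ac)
    finally show "(\<integral>\<^sup>+g. ennreal (norm (?Z g) powr p) \<partial>?M) \<le> ennreal (d powr p * d * B * ?T powr (p / q))" .
  qed (use AB E d in auto)
qed

text \<open>The weak \<open>p\<close>-norm of \<open>x\<^sub>0, \<dots>, x\<^bsub>J-1\<^esub>\<close> in \<open>\<ell>\<^sub>r\<^sup>N\<close> is at most \<open>W\<^bsup>1/p\<^esup>\<close>, expressed by the coefficients of
  functionals, whose norms are \<open>\<ell>\<^sub>s\<close>-norms.\<close>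

abbreviation weak_bound :: "real \<Rightarrow> real \<Rightarrow> real \<Rightarrow> nat \<Rightarrow> nat \<Rightarrow> (nat \<Rightarrow> nat \<Rightarrow> 'k::real_normed_field) \<Rightarrow> bool" where
  "weak_bound s p W N J x \<equiv>
     \<forall>c. (\<Sum>j<J. norm (\<Sum>i<N. c i * x j i) powr p) \<le> W * (\<Sum>i<N. norm (c i) powr s) powr (p / s)"

context stable_law
begin

text \<open>The linear case of the upper estimate for operators into \<open>\<ell>\<^sub>q\<^sup>k\<close>, which are matrices \<open>t\<close>.\<close>

abbreviation lq_dominated :: "real \<Rightarrow> real \<Rightarrow> real \<Rightarrow> bool" where
  "lq_dominated p q b \<equiv> \<forall>(N::nat) (k::nat) (J::nat) t (x :: nat \<Rightarrow> nat \<Rightarrow> 'k) W. 0 \<le> W \<longrightarrow> weak_bound s p W N J x \<longrightarrow>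
     ennreal (\<Sum>j<J. (\<Sum>l<k. norm (\<Sum>i<N. t l i * x j i) powr q) powr (p / q))
       \<le> ennreal (b * W) * (\<integral>\<^sup>+z. ennreal ((\<Sum>l<k. norm (\<Sum>i<N. t l i * z i) powr q) powr (p / q)) \<partial>Pi\<^sub>M {..<N} (\<lambda>_. \<mu>))"

text \<open>A Pietsch-type domination. Let \<open>u\<^sub>l\<close> be the form with coefficients \<open>t l\<close>. With \<open>\<sigma>\<^sub>l\<close> its norm and \<open>K = \<Sum>l. \<sigma>\<^sub>l\<^sup>q\<close>, the number \<open>\<parallel>u x\<parallel>\<^sup>q\<close> is \<open>K\<close> times
  the mean of \<open>\<bar>u\<^sub>l x / \<sigma>\<^sub>l\<bar>\<^sup>q\<close> for the probability weights \<open>\<sigma>\<^sub>l\<^sup>q / K\<close>. Jensen raises the exponent from \<open>q\<close> to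
  \<open>p\<close>, where the hypothesis on \<open>x\<close> applies to each \<open>u\<^sub>l / \<sigma>\<^sub>l\<close>. A second use of Jensen bounds \<open>K\<close>,
  which is comparable to the mean of \<open>\<parallel>u z\<parallel>\<^sup>q\<close>.\<close>

lemma lq_domination_of_le:
  assumes q: "0 < q" "q \<le> p" and fin: "p < s \<or> s = 2"
  shows "\<exists>b>0. lq_dominated p q b"
proof -
  have "q < s \<or> s = 2" using q fin by auto
  from lp_norm_combination[OF q(1) this] obtain A :: real where A: "0 < A" and
    lo: "\<And>(N::nat) c. ennreal (A * (\<Sum>i<N. norm (c i) powr s) powr (q / s))
        \<le> (\<integral>\<^sup>+z. ennreal (norm (\<Sum>i<N. c i * z i) powr q) \<partial>Pi\<^sub>M {..<N} (\<lambda>_. \<mu>))"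
    by blast
  define \<alpha> where "\<alpha> = p / q"
  have \<alpha>: "1 \<le> \<alpha>" using q by (simp add: \<alpha>_def)
  have q\<alpha>: "q * \<alpha> = p" using q by (simp add: \<alpha>_def)
  show ?thesis
  proof (rule exI[of _ "A powr - \<alpha>"], intro conjI allI impI)
    fix N k J :: nat and t x :: "nat \<Rightarrow> nat \<Rightarrow> 'k" and W :: real
    assume W: "0 \<le> W"
      and hyp: "weak_bound s p W N J x"
    let ?M = "Pi\<^sub>M {..<N} (\<lambda>_. \<mu>)"
    interpret M: prob_space ?M by (rule prob_space_power)
    define u where "u l z = (\<Sum>i<N. t l i * z i)" for l and z :: "nat \<Rightarrow> 'k"
    define \<sigma> where "\<sigma> l = (\<Sum>i<N. norm (t l i) powr s) powr (1 / s)" for l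
    have \<sigma>0: "0 \<le> \<sigma> l" for l by (simp add: \<sigma>_def)
    have \<sigma>p: "\<sigma> l powr e = (\<Sum>i<N. norm (t l i) powr s) powr (e / s)" for l e
      by (simp add: \<sigma>_def powr_powr)
    have uz: "u l z = 0" if "\<sigma> l = 0" for l z
    proof -
      have "(\<Sum>i<N. norm (t l i) powr s) = 0" using that by (simp add: \<sigma>_def)
      then have "\<forall>i<N. t l i = 0" by (subst (asm) sum_nonneg_eq_0_iff) auto
      then show ?thesis by (simp add: u_def)
    qed
    define K where "K = (\<Sum>l<k. \<sigma> l powr q)"
    have K0: "0 \<le> K" by (simp add: K_def sum_nonneg)
    have fz: "(\<Sum>l<k. norm (u l z) powr q) powr \<alpha> \<le> K powr \<alpha> * (\<Sum>l\<in>{l. l < k \<and> \<sigma> l \<noteq> 0}. \<sigma> l powr q / K * (norm (u l z) powr p / \<sigma> l powr p))"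
      for z
    proof (cases "K = 0")
      case True
      then have "\<forall>l<k. \<sigma> l = 0"
        unfolding K_def by (subst (asm) sum_nonneg_eq_0_iff) auto
      then show ?thesis using uz q by simp
    next
      case False
      let ?I = "{l. l < k \<and> \<sigma> l \<noteq> 0}"
      have Kpos: "0 < K" using False K0 by simp
      have sK: "(\<Sum>l\<in>?I. \<sigma> l powr q / K) = 1"
      proof -
        have "(\<Sum>l\<in>?I. \<sigma> l powr q) = K"
          unfolding K_def by (rule sum.mono_neutral_left) auto
        then show ?thesis using Kpos by (simp flip: sum_divide_distrib)
      qed
      have "(\<Sum>l<k. norm (u l z) powr q) = (\<Sum>l\<in>?I. norm (u l z) powr q)"
        by (rule sum.mono_neutral_right) (auto simp: uz)
      also have "\<dots> = K * (\<Sum>l\<in>?I. \<sigma> l powr q / K * (norm (u l z) powr q / \<sigma> l powr q))"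
        using Kpos \<sigma>0 by (auto simp: sum_distrib_left intro!: sum.cong)
      finally have "(\<Sum>l<k. norm (u l z) powr q) powr \<alpha>
          = K powr \<alpha> * (\<Sum>l\<in>?I. \<sigma> l powr q / K * (norm (u l z) powr q / \<sigma> l powr q)) powr \<alpha>"
        using Kpos by (simp add: powr_mult sum_nonneg)
      also have "\<dots> \<le> K powr \<alpha> * (\<Sum>l\<in>?I. \<sigma> l powr q / K * (norm (u l z) powr q / \<sigma> l powr q) powr \<alpha>)"
        using sK Kpos \<alpha> by (intro mult_left_mono powr_jensen_sum) auto
      finally show ?thesis
        using q\<alpha> by (simp add: powr_divide powr_powr)
    qed
    have "(\<Sum>j<J. (\<Sum>l<k. norm (u l (x j)) powr q) powr \<alpha>)
        \<le> (\<Sum>j<J. K powr \<alpha> * (\<Sum>l\<in>{l. l < k \<and> \<sigma> l \<noteq> 0}. \<sigma> l powr q / K * (norm (u l (x j)) powr p / \<sigma> l powr p)))"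
      by (intro sum_mono fz)
    also have "\<dots> = K powr \<alpha> * (\<Sum>l\<in>{l. l < k \<and> \<sigma> l \<noteq> 0}. \<sigma> l powr q / K * ((\<Sum>j<J. norm (u l (x j)) powr p) / \<sigma> l powr p))"
      unfolding sum_distrib_left[symmetric]
      by (subst sum.swap) (simp add: sum_distrib_left sum_divide_distrib)
    also have "\<dots> \<le> K powr \<alpha> * (\<Sum>l\<in>{l. l < k \<and> \<sigma> l \<noteq> 0}. \<sigma> l powr q / K * W)"
    proof (intro mult_left_mono sum_mono)
      fix l assume l: "l \<in> {l. l < k \<and> \<sigma> l \<noteq> 0}"
      have "(\<Sum>j<J. norm (u l (x j)) powr p) \<le> W * \<sigma> l powr p"
        unfolding u_def \<sigma>p by (rule hyp[rule_format])
      then show "(\<Sum>j<J. norm (u l (x j)) powr p) / \<sigma> l powr p \<le> W"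
        using l \<sigma>0[of l] by (simp add: divide_le_eq)
    qed (use K0 in auto)
    also have "\<dots> = K powr \<alpha> * ((\<Sum>l<k. \<sigma> l powr q) / K * W)"
    proof -
      have "(\<Sum>l\<in>{l. l < k \<and> \<sigma> l \<noteq> 0}. \<sigma> l powr q) = (\<Sum>l<k. \<sigma> l powr q)"
        by (rule sum.mono_neutral_left) auto
      then show ?thesis by (simp flip: sum_distrib_right sum_divide_distrib)
    qed
    also have "\<dots> \<le> K powr \<alpha> * W" by (cases "K = 0") (simp_all add: K_def[symmetric])
    finally have main: "(\<Sum>j<J. (\<Sum>l<k. norm (u l (x j)) powr q) powr \<alpha>) \<le> K powr \<alpha> * W" .
    have [measurable]: "u l \<in> borel_measurable ?M" for l unfolding u_def by measurable
    have "ennreal (A * K) = (\<Sum>l<k. ennreal (A * \<sigma> l powr q))"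
      using A by (subst sum_ennreal) (auto simp: K_def sum_distrib_left)
    also have "\<dots> \<le> (\<Sum>l<k. \<integral>\<^sup>+z. ennreal (norm (u l z) powr q) \<partial>?M)"
      unfolding u_def \<sigma>p by (intro sum_mono lo)
    also have "\<dots> = (\<integral>\<^sup>+z. ennreal (\<Sum>l<k. norm (u l z) powr q) \<partial>?M)"
      by (subst nn_integral_sum[symmetric]) (auto intro!: nn_integral_cong)
    finally have "ennreal ((A * K) powr \<alpha>) \<le> (\<integral>\<^sup>+z. ennreal ((\<Sum>l<k. norm (u l z) powr q) powr \<alpha>) \<partial>?M)"
      using A K0 \<alpha> by (intro M.powr_jensen_nn_integral) (auto simp: sum_nonneg)
    then have J: "ennreal (A powr - \<alpha> * W) * ennreal ((A * K) powr \<alpha>)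
        \<le> ennreal (A powr - \<alpha> * W) * (\<integral>\<^sup>+z. ennreal ((\<Sum>l<k. norm (u l z) powr q) powr \<alpha>) \<partial>?M)"
      by (rule mult_left_mono) simp
    have "A powr - \<alpha> * A powr \<alpha> = 1" using A by (simp add: powr_add[symmetric])
    then have eq: "A powr - \<alpha> * W * (A * K) powr \<alpha> = K powr \<alpha> * W"
      using A K0 by (simp add: powr_mult)
    have "ennreal (\<Sum>j<J. (\<Sum>l<k. norm (u l (x j)) powr q) powr \<alpha>) \<le> ennreal (K powr \<alpha> * W)"
      using main by (rule ennreal_leI)
    also have "\<dots> = ennreal (A powr - \<alpha> * W) * ennreal ((A * K) powr \<alpha>)"
      unfolding eq[symmetric] using W by (intro ennreal_mult) auto
    also note J
    finally show "ennreal (\<Sum>j<J. (\<Sum>l<k. norm (\<Sum>i<N. t l i * x j i) powr q) powr (p / q))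
       \<le> ennreal (A powr - \<alpha> * W) * (\<integral>\<^sup>+z. ennreal ((\<Sum>l<k. norm (\<Sum>i<N. t l i * z i) powr q) powr (p / q)) \<partial>?M)"
      by (simp only: u_def \<alpha>_def)
  qed (use A in simp)
qed

text \<open>With \<open>u\<^sub>l\<close> the form with coefficients \<open>t l\<close>, now \<open>\<parallel>u x\<parallel>\<^sup>p\<close> is comparable to the mean over \<open>g\<close> of \<open>\<bar>\<Sum>l. g\<^sub>l u\<^sub>l x\<bar>\<^sup>p\<close>. For fixed \<open>g\<close> this involves a single scalar form,
  to which the hypothesis on \<open>x\<close> applies; integrating over \<open>g\<close> afterwards recovers \<open>\<parallel>u z\<parallel>\<^sup>p\<close>.\<close>

lemma lq_domination_of_gt:
  assumes p: "0 < p" "p < q" "q \<le> 2" and fin: "p < s \<or> s = 2"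
  shows "\<exists>b>0. lq_dominated p q b"
proof -
  from lp_norm_combination[OF p(1) fin] obtain A :: real where A: "0 < A" and
    lo: "\<And>(N::nat) c. ennreal (A * (\<Sum>i<N. norm (c i) powr s) powr (p / s))
        \<le> (\<integral>\<^sup>+z. ennreal (norm (\<Sum>i<N. c i * z i) powr p) \<partial>Pi\<^sub>M {..<N} (\<lambda>_. \<mu>))"
    by blast
  obtain \<nu> c0 C0 where \<nu>: "0 < c0" "0 < C0" "stable_like q c0 C0 \<nu>"
    using ex_stable_like[of q] p by auto
  from lq_norm_as_moment_euclidean[OF p \<nu>, where 'a = 'k] obtain A' B' :: real where
    AB': "0 < A'" "0 < B'" and
    lo': "\<And>k (y :: nat \<Rightarrow> 'k). ennreal (A' * (\<Sum>l<k. norm (y l) powr q) powr (p / q))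
        \<le> (\<integral>\<^sup>+g. ennreal (norm (\<Sum>l<k. g l *\<^sub>R y l) powr p) \<partial>Pi\<^sub>M {..<k} (\<lambda>_. \<nu>))" and
    up': "\<And>k (y :: nat \<Rightarrow> 'k). (\<integral>\<^sup>+g. ennreal (norm (\<Sum>l<k. g l *\<^sub>R y l) powr p) \<partial>Pi\<^sub>M {..<k} (\<lambda>_. \<nu>))
        \<le> ennreal (B' * (\<Sum>l<k. norm (y l) powr q) powr (p / q))"
    by blast
  interpret \<nu>: real_distribution \<nu> using \<nu> by (simp add: stable_like_def)
  show ?thesis
  proof (rule exI[of _ "B' / (A * A')"], intro conjI allI impI)
    fix N k J :: nat and t x :: "nat \<Rightarrow> nat \<Rightarrow> 'k" and W :: real
    assume W: "0 \<le> W"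
      and hyp: "weak_bound s p W N J x"
    let ?M = "Pi\<^sub>M {..<N} (\<lambda>_. \<mu>)" and ?V = "Pi\<^sub>M {..<k} (\<lambda>_. \<nu>)"
    interpret M: prob_space ?M by (rule prob_space_power)
    interpret V: prob_space ?V by (intro prob_space_PiM \<nu>.prob_space_axioms)
    interpret pair_sigma_finite ?M ?V ..
    define u where "u l z = (\<Sum>i<N. t l i * z i)" for l and z :: "nat \<Rightarrow> 'k"
    have mix: "(\<Sum>l<k. g l *\<^sub>R u l z) = (\<Sum>i<N. (\<Sum>l<k. g l *\<^sub>R t l i) * z i)" for g z
      by (simp add: u_def scaleR_sum_right sum_distrib_right sum.swap[of _ "{..<k}"])
    define Q where "Q z = (\<Sum>l<k. norm (u l z) powr q) powr (p / q)" for z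
    have "ennreal A' * ennreal (\<Sum>j<J. Q (x j)) = (\<Sum>j<J. ennreal (A' * Q (x j)))"
      using AB' by (subst sum_ennreal) (auto simp: Q_def sum_distrib_left[symmetric] sum_nonneg ennreal_mult)
    also have "\<dots> \<le> (\<Sum>j<J. \<integral>\<^sup>+g. ennreal (norm (\<Sum>l<k. g l *\<^sub>R u l (x j)) powr p) \<partial>?V)"
      unfolding Q_def by (intro sum_mono lo')
    also have "\<dots> = (\<integral>\<^sup>+g. ennreal (\<Sum>j<J. norm (\<Sum>l<k. g l *\<^sub>R u l (x j)) powr p) \<partial>?V)"
      by (subst nn_integral_sum[symmetric]) (auto intro!: nn_integral_cong)
    also have "\<dots> \<le> (\<integral>\<^sup>+g. ennreal (W / A) * (\<integral>\<^sup>+z. ennreal (norm (\<Sum>l<k. g l *\<^sub>R u l z) powr p) \<partial>?M) \<partial>?V)"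
    proof (rule nn_integral_mono)
      fix g :: "nat \<Rightarrow> real"
      let ?c = "\<lambda>i. \<Sum>l<k. g l *\<^sub>R t l i"
      have "(\<Sum>j<J. norm (\<Sum>l<k. g l *\<^sub>R u l (x j)) powr p) \<le> W * (\<Sum>i<N. norm (?c i) powr s) powr (p / s)"
        unfolding mix by (rule hyp[rule_format])
      then have "ennreal (\<Sum>j<J. norm (\<Sum>l<k. g l *\<^sub>R u l (x j)) powr p)
          \<le> ennreal (W / A) * ennreal (A * (\<Sum>i<N. norm (?c i) powr s) powr (p / s))"
        using A W by (subst ennreal_mult[symmetric]) (auto intro: ennreal_leI)
      also have "\<dots> \<le> ennreal (W / A) * (\<integral>\<^sup>+z. ennreal (norm (\<Sum>l<k. g l *\<^sub>R u l z) powr p) \<partial>?M)"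
        unfolding mix by (intro mult_left_mono lo) simp
      finally show "ennreal (\<Sum>j<J. norm (\<Sum>l<k. g l *\<^sub>R u l (x j)) powr p) \<le> \<dots>" .
    qed
    also have "\<dots> = ennreal (W / A) * (\<integral>\<^sup>+g. (\<integral>\<^sup>+z. ennreal (norm (\<Sum>l<k. g l *\<^sub>R u l z) powr p) \<partial>?M) \<partial>?V)"
      unfolding u_def by (rule nn_integral_cmult) measurable
    also have "(\<integral>\<^sup>+g. (\<integral>\<^sup>+z. ennreal (norm (\<Sum>l<k. g l *\<^sub>R u l z) powr p) \<partial>?M) \<partial>?V)
        = (\<integral>\<^sup>+z. (\<integral>\<^sup>+g. ennreal (norm (\<Sum>l<k. g l *\<^sub>R u l z) powr p) \<partial>?V) \<partial>?M)"
      unfolding u_def by (rule Fubini') measurable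
    also have "\<dots> \<le> (\<integral>\<^sup>+z. ennreal B' * ennreal (Q z) \<partial>?M)"
      using AB' up' by (intro nn_integral_mono) (simp add: Q_def ennreal_mult[symmetric])
    also have "\<dots> = ennreal B' * (\<integral>\<^sup>+z. ennreal (Q z) \<partial>?M)"
      unfolding Q_def u_def by (rule nn_integral_cmult) measurable
    finally have "ennreal A' * ennreal (\<Sum>j<J. Q (x j)) \<le> ennreal (W / A) * (ennreal B' * (\<integral>\<^sup>+z. ennreal (Q z) \<partial>?M))"
      by (simp add: mult_left_mono)
    then have "ennreal (1 / A') * (ennreal A' * ennreal (\<Sum>j<J. Q (x j)))
        \<le> ennreal (1 / A') * (ennreal (W / A) * (ennreal B' * (\<integral>\<^sup>+z. ennreal (Q z) \<partial>?M)))"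
      by (rule mult_left_mono) simp
    moreover have "ennreal (1 / A') * (ennreal A' * y) = y" for y
      using AB' by (simp add: mult.assoc[symmetric] ennreal_mult[symmetric])
    moreover have "ennreal (1 / A') * (ennreal (W / A) * (ennreal B' * y)) = ennreal (B' / (A * A') * W) * y" for y
    proof -
      have n: "0 \<le> 1 / A'" "0 \<le> W / A" "0 \<le> B'" "0 \<le> 1 / A' * (W / A)" using AB' A W by auto
      have eq: "B' / (A * A') * W = 1 / A' * (W / A) * B'" by (simp add: mult_ac)
      show ?thesis
        unfolding eq ennreal_mult[OF n(4) n(3)] ennreal_mult[OF n(1) n(2)]
        by (simp only: mult.assoc)
    qed
    ultimately show "ennreal (\<Sum>j<J. (\<Sum>l<k. norm (\<Sum>i<N. t l i * x j i) powr q) powr (p / q))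
       \<le> ennreal (B' / (A * A') * W) * (\<integral>\<^sup>+z. ennreal ((\<Sum>l<k. norm (\<Sum>i<N. t l i * z i) powr q) powr (p / q)) \<partial>?M)"
      by (simp only: Q_def u_def)
  qed (use A AB' in auto)
qed

end

section \<open>The spaces \<open>\<ell>\<^sub>r\<^sup>N\<close> and linear maps into \<open>\<L>\<^sub>q\<close>-spaces\<close>

lemma pts_ell [simp]: "x \<in> pts (ell r N) \<longleftrightarrow> (\<forall>i\<ge>N. x i = 0)"
  by (simp add: ell_def)

lemma smul_ell [simp]: "smul (ell r N) c x = (\<lambda>i. c * x i)"
  by (simp add: ell_def)

lemma whole_simps [simp]: "pts (whole sc) = UNIV" "smul (whole sc) = sc" "nm (whole sc) = norm"
  by (simp_all add: whole_def)

definition unit_vec :: "nat \<Rightarrow> nat \<Rightarrow> 'k::real_normed_field" where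
  "unit_vec i = (\<lambda>j. if j = i then 1 else 0)"

lemma unit_vec_pts: "i < N \<Longrightarrow> unit_vec i \<in> pts (ell r N)"
  by (simp add: unit_vec_def)

definition trunc :: "nat \<Rightarrow> (nat \<Rightarrow> 'k) \<Rightarrow> nat \<Rightarrow> 'k::real_normed_field" where
  "trunc N z = (\<lambda>i. if i < N then z i else 0)"

lemma trunc_pts: "trunc N z \<in> pts (ell r N)"
  by (simp add: trunc_def)

lemma trunc_trunc: "trunc N (trunc N z) = trunc N z"
  by (auto simp: trunc_def)

text \<open>Adding one coordinate at a time avoids sums of vectors in the function space that carries \<open>\<ell>\<^sub>r\<^sup>N\<close>.\<close>

lemma lin_map_ell_expand:
  assumes f: "lin_map (ell r N) F f" and x: "x \<in> pts (ell r N)"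
  shows "f x = (\<Sum>i<N. smul F (x i) (f (unit_vec i)))"
proof -
  have add: "f (x + y) = f x + f y" if "x \<in> pts (ell r N)" "y \<in> pts (ell r N)" for x y
    using f that by (auto simp: lin_map_def)
  have f0: "f (\<lambda>_. 0) = 0"
    using add[of "\<lambda>_. 0" "\<lambda>_. 0"] by (simp add: plus_fun_def)
  have "f (trunc n x) = (\<Sum>i<n. smul F (x i) (f (unit_vec i)))" if "n \<le> N" for n
    using that
  proof (induction n)
    case 0
    then show ?case by (simp add: trunc_def f0)
  next
    case (Suc n)
    have "trunc (Suc n) x = trunc n x + (\<lambda>i. x n * unit_vec n i)"
      by (auto simp: fun_eq_iff trunc_def unit_vec_def less_Suc_eq)
    then have "f (trunc (Suc n) x) = f (trunc n x + (\<lambda>i. x n * unit_vec n i))" by simp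
    also have "\<dots> = f (trunc n x) + f (\<lambda>i. x n * unit_vec n i)"
      using Suc.prems by (intro add) (auto simp: trunc_def unit_vec_def)
    also have "f (\<lambda>i. x n * unit_vec n i) = smul F (x n) (f (unit_vec n))"
    proof -
      have "unit_vec n \<in> pts (ell r N)" using Suc.prems by (intro unit_vec_pts) simp
      then have "f (smul (ell r N) (x n) (unit_vec n)) = smul F (x n) (f (unit_vec n))"
        using f unfolding lin_map_def by blast
      then show ?thesis by simp
    qed
    finally show ?case using Suc by simp
  qed
  moreover have "trunc N x = x" using x by (auto simp: trunc_def fun_eq_iff)
  ultimately show ?thesis by (metis order_refl)
qed

lemma lin_map_ell_scalar:
  fixes c :: "nat \<Rightarrow> 'k::real_normed_field"
  shows "lin_map (ell r N) (whole (*)) (\<lambda>x. \<Sum>i<N. c i * x i)"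
  by (auto simp: lin_map_def distrib_left sum.distrib sum_distrib_left mult_ac)

lemma measurable_trunc [measurable]:
  fixes \<mu> :: "'k::{real_normed_field, second_countable_topology} measure"
  assumes "sets \<mu> = sets borel"
  shows "trunc N \<in> borel_measurable (Pi\<^sub>M {..<N} (\<lambda>_. \<mu>))"
proof (rule measurable_coordinatewise_then_product)
  note assms[measurable_cong]
  fix i
  show "(\<lambda>z. trunc N z i) \<in> borel_measurable (Pi\<^sub>M {..<N} (\<lambda>_. \<mu>))"
    by (cases "i < N") (simp_all add: trunc_def)
qed

lemma (in normed_space_over) bounded_bilinear_scale: "bounded_bilinear sc"
proof
  fix a b x y and r :: real
  show "sc (a + b) x = sc a x + sc b x" "sc a (x + y) = sc a x + sc a y"
    by (simp_all add: scale_left_distrib scale_right_distrib)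
  have r: "r *\<^sub>R x = sc (of_real r) x" for x by (simp add: sc_of_real)
  show "sc (r *\<^sub>R a) x = r *\<^sub>R sc a x" "sc a (r *\<^sub>R x) = r *\<^sub>R sc a x"
    by (simp_all add: r scaleR_conv_of_real mult.commute)
  show "\<exists>K. \<forall>a b. norm (sc a b) \<le> norm a * norm b * K"
    by (rule exI[of _ 1]) (simp add: norm_sc)
qed

text \<open>The part of the norm axioms by which a bound on the unit ball becomes an inequality for all vectors.\<close>

definition homogeneous :: "('k::real_normed_field, 'v) nspace \<Rightarrow> bool" where
  "homogeneous E \<longleftrightarrow> (\<forall>x\<in>pts E. 0 \<le> nm E x \<and> (\<forall>c. smul E c x \<in> pts E \<and> nm E (smul E c x) = norm c * nm E x))"

lemma homogeneous_ell:
  assumes "r = \<infinity> \<or> (\<exists>\<rho>>0. r = ennreal \<rho>)"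
  shows "homogeneous (ell r N :: ('k::real_normed_field, nat \<Rightarrow> 'k) nspace)"
  unfolding homogeneous_def
proof (intro ballI conjI allI)
  fix x :: "nat \<Rightarrow> 'k" and c :: 'k assume x: "x \<in> pts (ell r N)"
  show "0 \<le> nm (ell r N) x" by (auto simp: ell_def)
  show "smul (ell r N) c x \<in> pts (ell r N)" using x by simp
  show "nm (ell r N) (smul (ell r N) c x) = norm c * nm (ell r N) x"
    using assms
  proof
    assume r: "r = \<infinity>"
    have "mono ((*) (norm c))" by (auto intro!: monoI mult_left_mono)
    then have "norm c * Max (insert 0 ((\<lambda>i. norm (x i)) ` {..<N}))
        = Max ((*) (norm c) ` insert 0 ((\<lambda>i. norm (x i)) ` {..<N}))"
      by (rule mono_Max_commute) auto
    then show ?thesis by (simp add: ell_def r norm_mult image_image)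
  next
    assume "\<exists>\<rho>>0. r = ennreal \<rho>"
    then obtain \<rho> where \<rho>: "0 < \<rho>" "r = ennreal \<rho>" by auto
    have "(\<Sum>i<N. norm (c * x i) powr \<rho>) powr (1 / \<rho>) = (norm c powr \<rho> * (\<Sum>i<N. norm (x i) powr \<rho>)) powr (1 / \<rho>)"
      by (simp add: norm_mult powr_mult sum_distrib_left)
    also have "\<dots> = norm c * (\<Sum>i<N. norm (x i) powr \<rho>) powr (1 / \<rho>)"
      using \<rho> by (simp add: powr_mult powr_powr sum_nonneg)
    finally show ?thesis using \<rho> by (simp add: ell_def)
  qed
qed

lemma homogeneous_whole:
  assumes "normed_space_over sc" "module.subspace sc M"
  shows "homogeneous ((whole sc)\<lparr>pts := M\<rparr>)"
proof -
  interpret normed_space_over sc by fact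
  show ?thesis using assms(2) by (auto simp: homogeneous_def norm_sc subspace_scale)
qed

lemma op_norm_bound:
  assumes E: "homogeneous E" and F: "\<And>y c. y \<in> pts F \<Longrightarrow> nm F (smul F c y) = norm c * nm F y"
    and f: "lin_map E F f" and C: "op_norm E F f \<le> ennreal C" "0 \<le> C" and x: "x \<in> pts E"
  shows "nm F (f x) \<le> C * nm E x"
proof -
  have unit: "nm F (f y) \<le> C" if "y \<in> pts E" "nm E y \<le> 1" for y
  proof -
    have "ennreal (nm F (f y)) \<le> op_norm E F f"
      unfolding op_norm_def using that by (intro SUP_upper) auto
    then show ?thesis using C by (meson ennreal_le_iff order_trans)
  qed
  have fs: "nm F (f (smul E c x)) = norm c * nm F (f x)" for c
    using f F x by (auto simp: lin_map_def)
  have E': "0 \<le> nm E x" "\<And>c. smul E c x \<in> pts E" "\<And>c. nm E (smul E c x) = norm c * nm E x"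
    using E x by (auto simp: homogeneous_def)
  show ?thesis
  proof (cases "nm E x = 0")
    case True
    \<comment> \<open>A vector of norm 0 stays in the unit ball under all multiples.\<close>
    have "real n * nm F (f x) \<le> C" for n
      using unit[OF E'(2)[of "of_nat n"]] fs[of "of_nat n"] E'(3)[of "of_nat n"] True by simp
    then have "nm F (f x) \<le> 0"
      by (meson not_le reals_Archimedean3)
    then show ?thesis using True by simp
  next
    case False
    let ?c = "of_real (1 / nm E x) :: 'a"
    have "nm F (f (smul E ?c x)) \<le> C"
      using False E' by (intro unit) (auto simp: norm_divide)
    moreover have "nm F (f (smul E ?c x)) = nm F (f x) / nm E x"
      unfolding fs using E'(1) by (simp add: norm_divide)
    ultimately show ?thesis
      using False E'(1) by (simp add: divide_le_eq)
  qed
qed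

text \<open>Stable laws have \<open>s \<le> 2\<close>, so the conjugate pair \<open>r = 1\<close>, \<open>s = \<infinity>\<close> is left out and \<open>s\<close> can be a real number.\<close>

definition conjugate :: "ennreal \<Rightarrow> real \<Rightarrow> bool" where
  "conjugate r s \<longleftrightarrow> r = \<infinity> \<and> s = 1 \<or> (\<exists>\<rho>>1. r = ennreal \<rho> \<and> 1 < s \<and> 1 / \<rho> + 1 / s = 1)"

lemma conjugate_cases:
  assumes "conjugate r s"
  obtains (infinite) "r = \<infinity>" "s = 1" | (finite) \<rho> where "1 < \<rho>" "r = ennreal \<rho>" "1 < s" "1 / \<rho> + 1 / s = 1"
  using assms unfolding conjugate_def by blast

lemma conjugate_homogeneous:
  assumes "conjugate r s"
  shows "homogeneous (ell r N :: ('k::real_normed_field, nat \<Rightarrow> 'k) nspace)"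
proof (rule homogeneous_ell)
  show "r = \<infinity> \<or> (\<exists>\<rho>>0. r = ennreal \<rho>)"
    using assms
  proof (cases rule: conjugate_cases)
    case (finite \<rho>)
    then show ?thesis by (intro disjI2 exI[of _ \<rho>]) simp
  qed simp
qed

text \<open>The functional is tested at the vector with entries \<open>\<bar>t\<^sub>i\<bar>\<^sup>s / t\<^sub>i\<close>, where Hoelder's inequality becomes
an equality.\<close>

lemma dual_ball_coeffs:
  fixes \<gamma> :: "(nat \<Rightarrow> 'k::real_normed_field) \<Rightarrow> 'k"
  assumes conj: "conjugate r s" and \<gamma>: "\<gamma> \<in> dual_ball (ell r N)"
  shows "(\<Sum>i<N. norm (\<gamma> (unit_vec i)) powr s) \<le> 1"
proof -
  define t where "t i = \<gamma> (unit_vec i)" for i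
  define S where "S = (\<Sum>i<N. norm (t i) powr s)"
  have S0: "0 \<le> S" by (simp add: S_def sum_nonneg)
  have lin: "lin_map (ell r N) (whole (*)) \<gamma>" and op: "op_norm (ell r N) (whole (*)) \<gamma> \<le> 1"
    using \<gamma> by (auto simp: dual_ball_def)
  define x where "x = trunc N (\<lambda>i. of_real (norm (t i) powr s) / t i)"
  have xp: "x \<in> pts (ell r N)" unfolding x_def by (rule trunc_pts)
  have "\<gamma> x = (\<Sum>i<N. x i * t i)"
    using lin_map_ell_expand[OF lin xp] by (simp add: t_def)
  also have "\<dots> = (\<Sum>i<N. of_real (norm (t i) powr s))"
    using conj by (intro sum.cong) (auto simp: x_def trunc_def)
  also have "\<dots> = of_real S" by (simp add: S_def)
  finally have "norm (\<gamma> x) = S" using S0 by simp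
  then have le: "S \<le> nm (ell r N) x"
    using op_norm_bound[OF conjugate_homogeneous[OF conj] _ lin, of 1 x] op xp by (simp add: norm_mult)
  have nx: "norm (x i) = norm (t i) powr (s - 1)" if "i < N" "t i \<noteq> 0" for i
    using that by (simp add: x_def trunc_def norm_divide powr_diff)
  have "S \<le> 1"
    using conj unfolding conjugate_def
  proof
    assume r: "r = \<infinity> \<and> s = 1"
    have "nm (ell r N) x \<le> 1"
    proof -
      have "norm (x i) \<le> 1" if "i < N" for i
        using nx[OF that] r that by (cases "t i = 0") (auto simp: x_def trunc_def)
      then show ?thesis using r by (auto simp: ell_def)
    qed
    then show ?thesis using le by simp
  next
    assume "\<exists>\<rho>>1. r = ennreal \<rho> \<and> 1 < s \<and> 1 / \<rho> + 1 / s = 1"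
    then obtain \<rho> where \<rho>: "1 < \<rho>" "r = ennreal \<rho>" "1 < s" "1 / \<rho> + 1 / s = 1" by auto
    have sr: "(s - 1) * \<rho> = s" using \<rho> by (simp add: field_simps)
    have "norm (x i) powr \<rho> = norm (t i) powr s" if "i < N" for i
      using nx[OF that] sr that \<rho> by (cases "t i = 0") (auto simp: x_def trunc_def powr_powr)
    then have "nm (ell r N) x = S powr (1 / \<rho>)"
      using \<rho> by (simp add: ell_def S_def)
    then have Sle: "S \<le> S powr (1 / \<rho>)" using le by simp
    show ?thesis
    proof (rule ccontr)
      assume "\<not> S \<le> 1"
      then have "S powr (1 / \<rho>) < S powr 1" using \<rho> by (intro powr_less_mono) auto
      then show False using Sle S0 by simp
    qed
  qed
  then show ?thesis by (simp add: S_def t_def)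
qed

text \<open>Hoelder's inequality, from Young's inequality for each summand since both norms are at most 1.\<close>

lemma coeffs_dual_ball:
  fixes c :: "nat \<Rightarrow> 'k::real_normed_field"
  assumes conj: "conjugate r s" and c: "(\<Sum>i<N. norm (c i) powr s) \<le> 1"
  shows "(\<lambda>x. \<Sum>i<N. c i * x i) \<in> dual_ball (ell r N)"
proof -
  have "norm (\<Sum>i<N. c i * x i) \<le> 1" if x: "nm (ell r N) x \<le> 1" for x
  proof -
    have n: "norm (\<Sum>i<N. c i * x i) \<le> (\<Sum>i<N. norm (x i) * norm (c i))"
      by (rule order_trans[OF norm_sum]) (simp add: norm_mult mult.commute)
    also have "\<dots> \<le> 1"
      using conj unfolding conjugate_def
    proof
      assume r: "r = \<infinity> \<and> s = 1"
      then have "norm (x i) \<le> 1" if "i < N" for i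
        using x that by (auto simp: ell_def)
      then have "(\<Sum>i<N. norm (x i) * norm (c i)) \<le> (\<Sum>i<N. norm (c i) powr s)"
        using r by (intro sum_mono) (auto intro: mult_left_le_one_le)
      then show ?thesis using c by simp
    next
      assume "\<exists>\<rho>>1. r = ennreal \<rho> \<and> 1 < s \<and> 1 / \<rho> + 1 / s = 1"
      then obtain \<rho> where \<rho>: "1 < \<rho>" "r = ennreal \<rho>" "1 < s" "1 / \<rho> + 1 / s = 1" by auto
      have "(\<Sum>i<N. norm (x i) powr \<rho>) powr (1 / \<rho>) \<le> 1"
        using x \<rho> by (simp add: ell_def)
      then have "((\<Sum>i<N. norm (x i) powr \<rho>) powr (1 / \<rho>)) powr \<rho> \<le> 1 powr \<rho>"
        using \<rho> by (intro powr_mono2) auto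
      then have X: "(\<Sum>i<N. norm (x i) powr \<rho>) \<le> 1"
        using \<rho> by (simp add: powr_powr sum_nonneg)
      have "(\<Sum>i<N. norm (x i) * norm (c i)) \<le> (\<Sum>i<N. norm (x i) powr \<rho> / \<rho> + norm (c i) powr s / s)"
        using \<rho> by (intro sum_mono Youngs_inequality) auto
      also have "\<dots> = (\<Sum>i<N. norm (x i) powr \<rho>) / \<rho> + (\<Sum>i<N. norm (c i) powr s) / s"
        by (simp add: sum.distrib sum_divide_distrib)
      also have "\<dots> \<le> 1 / \<rho> + 1 / s"
        using X c \<rho> by (intro add_mono divide_right_mono) auto
      finally show ?thesis using \<rho> by simp
    qed
    finally show ?thesis .
  qed
  then have "op_norm (ell r N) (whole (*)) (\<lambda>x. \<Sum>i<N. c i * x i) \<le> 1"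
    unfolding op_norm_def by (intro SUP_least) (auto simp: ennreal_le_1)
  then show ?thesis
    using lin_map_ell_scalar by (auto simp: dual_ball_def)
qed

text \<open>Finiteness of the weak norm matters because of the convention \<open>0 * \<infinity> = 0\<close> in products of weak norms:
  as no factor is infinite, products of weak norms are products of real numbers.\<close>

lemma weak_norm_ell:
  fixes x :: "nat \<Rightarrow> nat \<Rightarrow> 'k::real_normed_field"
  assumes conj: "conjugate r s" and p: "0 < p" and x: "\<forall>j<J. x j \<in> pts (ell r N)"
  shows "\<exists>W\<ge>0. weak_norm p (ell r N) J x = ennreal W \<and>
     weak_bound s p (W powr p) N J x"
proof -
  have s: "1 \<le> s" using conj by (auto simp: conjugate_def)
  have "weak_norm p (ell r N) J x \<le> ennreal ((\<Sum>j<J. (\<Sum>i<N. norm (x j i)) powr p) powr (1 / p))"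
    unfolding weak_norm_def
  proof (intro SUP_least ennreal_leI powr_mono2 sum_mono)
    fix \<gamma> :: "(nat \<Rightarrow> 'k) \<Rightarrow> 'k" and j assume \<gamma>: "\<gamma> \<in> dual_ball (ell r N)" and j: "j \<in> {..<J}"
    have lin: "lin_map (ell r N) (whole (*)) \<gamma>" using \<gamma> by (simp add: dual_ball_def)
    have 1: "norm (\<gamma> (unit_vec i)) \<le> 1" if "i < N" for i
    proof (rule ccontr)
      assume n: "\<not> norm (\<gamma> (unit_vec i)) \<le> 1"
      then have "1 < norm (\<gamma> (unit_vec i)) powr s" using s by (intro gr_one_powr) auto
      also have "\<dots> \<le> (\<Sum>i<N. norm (\<gamma> (unit_vec i)) powr s)"
        using that by (intro member_le_sum) auto
      also have "\<dots> \<le> 1" by (rule dual_ball_coeffs[OF conj \<gamma>])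
      finally show False by simp
    qed
    have "\<gamma> (x j) = (\<Sum>i<N. x j i * \<gamma> (unit_vec i))"
      using lin_map_ell_expand[OF lin] x j by auto
    also have "norm \<dots> \<le> (\<Sum>i<N. norm (x j i))"
      by (rule order_trans[OF norm_sum]) (auto simp: norm_mult intro!: sum_mono mult_right_le_one_le 1)
    finally show "norm (\<gamma> (x j)) \<le> (\<Sum>i<N. norm (x j i))" .
  qed (use p in \<open>auto simp: sum_nonneg\<close>)
  then have "weak_norm p (ell r N) J x < \<infinity>" by (rule order.strict_trans1) simp
  then obtain W where W: "0 \<le> W" "weak_norm p (ell r N) J x = ennreal W"
    by (cases "weak_norm p (ell r N) J x") auto
  have "(\<Sum>j<J. norm (\<Sum>i<N. c i * x j i) powr p) \<le> W powr p * (\<Sum>i<N. norm (c i) powr s) powr (p / s)" for c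
  proof -
    define S where "S = (\<Sum>i<N. norm (c i) powr s)"
    show ?thesis
    proof (cases "S = 0")
      case True
      then have "\<forall>i<N. c i = 0" unfolding S_def by (subst (asm) sum_nonneg_eq_0_iff) auto
      then show ?thesis by (simp add: sum_nonneg)
    next
      case False
      then have S: "0 < S" by (simp add: S_def less_le sum_nonneg)
      define \<sigma> where "\<sigma> = S powr (1 / s)"
      have \<sigma>: "0 < \<sigma>" "\<sigma> powr s = S" "\<sigma> powr p = S powr (p / s)"
        using S s by (auto simp: \<sigma>_def powr_powr)
      define c' where "c' i = c i / of_real \<sigma>" for i
      have "(\<Sum>i<N. norm (c' i) powr s) = 1"
        using \<sigma> S by (simp add: c'_def norm_divide powr_divide S_def[symmetric] flip: sum_divide_distrib)
      then have "(\<lambda>x. \<Sum>i<N. c' i * x i) \<in> dual_ball (ell r N)"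
        by (intro coeffs_dual_ball[OF conj]) simp
      then have "ennreal ((\<Sum>j<J. norm (\<Sum>i<N. c' i * x j i) powr p) powr (1 / p)) \<le> ennreal W"
        unfolding W(2)[symmetric] weak_norm_def by (rule SUP_upper2) simp
      then have "(\<Sum>j<J. norm (\<Sum>i<N. c' i * x j i) powr p) powr (1 / p) \<le> W"
        using W by simp
      then have "((\<Sum>j<J. norm (\<Sum>i<N. c' i * x j i) powr p) powr (1 / p)) powr p \<le> W powr p"
        using p by (intro powr_mono2) auto
      then have le: "(\<Sum>j<J. norm (\<Sum>i<N. c' i * x j i) powr p) \<le> W powr p"
        using p by (simp add: powr_powr sum_nonneg)
      have "(\<Sum>j<J. norm (\<Sum>i<N. c i * x j i) powr p) = \<sigma> powr p * (\<Sum>j<J. norm (\<Sum>i<N. c' i * x j i) powr p)"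
      proof -
        have "norm (\<Sum>i<N. c i * x j i) = \<sigma> * norm (\<Sum>i<N. c' i * x j i)" for j
        proof -
          have "(\<Sum>i<N. c i * x j i) = of_real \<sigma> * (\<Sum>i<N. c' i * x j i)"
            using \<sigma> by (simp add: c'_def sum_distrib_left)
          then show ?thesis using \<sigma> by (simp add: norm_mult)
        qed
        then show ?thesis using \<sigma> by (simp add: powr_mult sum_distrib_left)
      qed
      also have "\<dots> \<le> \<sigma> powr p * W powr p" using le by (intro mult_left_mono) auto
      finally show ?thesis by (simp add: \<sigma> S_def mult.commute)
    qed
  qed
  then show ?thesis using W by blast
qed

context stable_law
begin

text \<open>The linear case of the upper estimate. The range of \<open>u\<close> lies in a finite dimensional subspace \<open>M\<close>, and a factorization \<open>S R\<close> of its inclusion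
  through \<open>\<ell>\<^sub>q\<^sup>k\<close> transports the estimates for coefficient matrices, with loss \<open>(\<parallel>S\<parallel> \<parallel>R\<parallel>)\<^sup>p\<close>.\<close>

lemma linear_domination:
  fixes sc :: "'k \<Rightarrow> 'x::real_normed_vector \<Rightarrow> 'x"
  assumes nsp: "normed_space_over sc" and L: "Lg_space q sc" and conj: "conjugate r s"
    and p: "0 < p" and q: "1 \<le> q" and fin: "p < s \<or> s = 2" and pq: "q \<le> p \<or> q \<le> 2"
  shows "\<exists>b>0. \<forall>N u (J::nat) x W. lin_map (ell r N) (whole sc) u \<longrightarrow> (\<forall>j<J. x j \<in> pts (ell r N)) \<longrightarrow> 0 \<le> W \<longrightarrow>
     weak_bound s p W N J x \<longrightarrow>
     ennreal (\<Sum>j<J. norm (u (x j)) powr p)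
       \<le> ennreal (b * W) * (\<integral>\<^sup>+z. ennreal (norm (u (trunc N z)) powr p) \<partial>Pi\<^sub>M {..<N} (\<lambda>_. \<mu>))"
proof -
  interpret X: normed_space_over sc by fact
  obtain \<Lambda> where \<Lambda>: "1 \<le> \<Lambda>" "Lg_space_const q \<Lambda> sc" using L by (auto simp: Lg_space_def)
  have "\<exists>b>0. lq_dominated p q b"
  proof (cases "q \<le> p")
    case True
    then show ?thesis using lq_domination_of_le[of q p] q fin by simp
  next
    case False
    then show ?thesis using lq_domination_of_gt[of p q] p pq fin by simp
  qed
  then obtain b :: real where b: "0 < b" and dom: "lq_dominated p q b" by blast
  define D where "D = (\<Lambda> + 1) powr p"
  have D: "0 < D" using \<Lambda> by (simp add: D_def)
  show ?thesis
  proof (rule exI[of _ "D * b"], intro conjI allI impI)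
    fix N J :: nat and u and x :: "nat \<Rightarrow> nat \<Rightarrow> 'k" and W :: real
    assume u: "lin_map (ell r N) (whole sc) u" and x: "\<forall>j<J. x j \<in> pts (ell r N)" and W: "0 \<le> W"
      and hyp: "weak_bound s p W N J x"
    let ?M = "Pi\<^sub>M {..<N} (\<lambda>_. \<mu>)"
    define M where "M = X.span ((\<lambda>i. u (unit_vec i)) ` {..<N})"
    have sub: "X.subspace M" by (simp add: M_def)
    have uM: "u z \<in> M" if "z \<in> pts (ell r N)" for z
      unfolding M_def lin_map_ell_expand[OF u that] whole_simps
      by (intro X.span_sum X.span_scale X.span_base imageI) auto
    have finM: "\<exists>B. finite B \<and> X.span B = M" unfolding M_def by blast
    from \<Lambda>(2)[unfolded Lg_space_const_def, rule_format, OF conjI[OF sub finM] zero_less_one]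
    obtain k R S where
      R: "lin_map ((whole sc)\<lparr>pts := M\<rparr>) (ell (ennreal q) k) R" and
      S: "lin_map (ell (ennreal q) k) (whole sc) S" and
      SR: "\<forall>x\<in>M. S (R x) = x" and
      op: "op_norm (ell (ennreal q) k) (whole sc) S * op_norm ((whole sc)\<lparr>pts := M\<rparr>) (ell (ennreal q) k) R \<le> ennreal (\<Lambda> + 1)"
      by blast
    have RM: "R y \<in> pts (ell (ennreal q) k)" if "y \<in> M" for y
      using R that by (auto simp: lin_map_def simp del: pts_ell)
    have hq: "homogeneous (ell (ennreal q) k :: ('k, nat \<Rightarrow> 'k) nspace)"
      using q by (intro homogeneous_ell disjI2 exI[of _ q]) simp
    have hM: "homogeneous ((whole sc)\<lparr>pts := M\<rparr>)" by (rule homogeneous_whole[OF nsp sub])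
    \<comment> \<open>If \<open>M\<close> is not trivial, both operator norms are positive; as their product is finite, so is each of them.\<close>
    have "\<exists>a1 a2. 0 \<le> a1 \<and> 0 \<le> a2 \<and> a1 * a2 \<le> \<Lambda> + 1 \<and>
        (\<forall>y\<in>M. nm (ell (ennreal q) k) (R y) \<le> a2 * norm y \<and> norm y \<le> a1 * nm (ell (ennreal q) k) (R y))"
    proof (cases "M \<subseteq> {0}")
      case True
      have "X.subspace M" by fact
      then have "M = {0}" using True X.subspace_0 by auto
      then have "R 0 = R 0 + R 0"
        using R by (auto simp: lin_map_def)
      then have "R 0 = 0" by simp
      then have "nm (ell (ennreal q) k) (R 0) = 0"
        using q by (simp add: ell_def zero_fun_def)
      then show ?thesis using True \<Lambda> by (intro exI[of _ 0]) auto
    next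
      case False
      then obtain y where y: "y \<in> M" "y \<noteq> 0" by auto
      have pos: "op_norm (ell (ennreal q) k) (whole sc) S \<noteq> 0"
      proof
        assume "op_norm (ell (ennreal q) k) (whole sc) S = 0"
        then have "norm (S (R y)) \<le> 0 * nm (ell (ennreal q) k) (R y)"
          using op_norm_bound[OF hq _ S, of 0 "R y"] RM[OF y(1)] by (simp add: X.norm_sc)
        then show False using SR y by simp
      qed
      have pos2: "op_norm ((whole sc)\<lparr>pts := M\<rparr>) (ell (ennreal q) k) R \<noteq> 0"
      proof
        assume "op_norm ((whole sc)\<lparr>pts := M\<rparr>) (ell (ennreal q) k) R = 0"
        then have le0: "nm (ell (ennreal q) k) (R y) \<le> 0"
          using op_norm_bound[OF hM _ R, of 0 y] hq y by (simp add: homogeneous_def)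
        have "nm (ell (ennreal q) k) (R y) = (\<Sum>i<k. norm (R y i) powr q) powr (1 / q)"
          using q by (simp add: ell_def)
        then have "(\<Sum>i<k. norm (R y i) powr q) = 0"
          using le0 by (metis powr_eq_0_iff powr_ge_zero order_antisym)
        then have "\<forall>i<k. R y i = 0" by (subst (asm) sum_nonneg_eq_0_iff) auto
        moreover have "\<forall>i\<ge>k. R y i = 0" using RM[OF y(1)] by simp
        ultimately have "R y = (\<lambda>_. 0)" by (metis not_less)
        moreover have "S (\<lambda>_. 0) = (0 :: 'x)"
          using lin_map_ell_expand[OF S, of "\<lambda>_. 0"] by simp
        ultimately show False using SR y by auto
      qed
      obtain a1 where a1: "op_norm (ell (ennreal q) k) (whole sc) S = ennreal a1" "0 \<le> a1"
        using op pos2 by (cases "op_norm (ell (ennreal q) k) (whole sc) S") (auto simp: ennreal_top_mult top_unique)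
      obtain a2 where a2: "op_norm ((whole sc)\<lparr>pts := M\<rparr>) (ell (ennreal q) k) R = ennreal a2" "0 \<le> a2"
        using op pos by (cases "op_norm ((whole sc)\<lparr>pts := M\<rparr>) (ell (ennreal q) k) R") (auto simp: ennreal_mult_top top_unique)
      have "a1 * a2 \<le> \<Lambda> + 1"
        using op \<Lambda> unfolding a1(1) a2(1) ennreal_mult[OF a1(2) a2(2), symmetric]
        by (subst (asm) ennreal_le_iff) auto
      moreover have "nm (ell (ennreal q) k) (R y) \<le> a2 * norm y" if "y \<in> M" for y
        using op_norm_bound[OF hM _ R, of a2 y] hq a2 that by (simp add: homogeneous_def)
      moreover have "norm y \<le> a1 * nm (ell (ennreal q) k) (R y)" if "y \<in> M" for y
        using op_norm_bound[OF hq _ S, of a1 "R y"] a1 RM[OF that] SR that by (simp add: X.norm_sc)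
      ultimately show ?thesis using a1 a2 by blast
    qed
    then obtain a1 a2 where a: "0 \<le> a1" "0 \<le> a2" "a1 * a2 \<le> \<Lambda> + 1"
      and Rle: "\<And>y. y \<in> M \<Longrightarrow> nm (ell (ennreal q) k) (R y) \<le> a2 * norm y"
      and Sle: "\<And>y. y \<in> M \<Longrightarrow> norm y \<le> a1 * nm (ell (ennreal q) k) (R y)"
      by blast
    define t where "t l i = R (u (unit_vec i)) l" for l i
    define Q where "Q z = (\<Sum>l<k. norm (\<Sum>i<N. t l i * z i) powr q) powr (p / q)" for z
    have coord: "R (u z) l = (\<Sum>i<N. t l i * z i)" if z: "z \<in> pts (ell r N)" for z l
    proof -
      have "lin_map (ell r N) (whole (*)) (\<lambda>z. R (u z) l)"
        unfolding lin_map_def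
      proof (intro conjI ballI allI)
        fix y z :: "nat \<Rightarrow> 'k" assume yz: "y \<in> pts (ell r N)" "z \<in> pts (ell r N)"
        have "u (y + z) = u y + u z" using u yz by (simp add: lin_map_def)
        moreover have "R (u y + u z) = R (u y) + R (u z)"
          using R uM[OF yz(1)] uM[OF yz(2)] by (simp add: lin_map_def)
        ultimately show "R (u (y + z)) l = R (u y) l + R (u z) l" by simp
      next
        fix c and z :: "nat \<Rightarrow> 'k" assume z: "z \<in> pts (ell r N)"
        have "u (smul (ell r N) c z) = sc c (u z)" using u z by (simp add: lin_map_def)
        moreover have "R (sc c (u z)) = smul (ell (ennreal q) k) c (R (u z))"
          using R uM[OF z] by (simp add: lin_map_def)
        ultimately show "R (u (smul (ell r N) c z)) l = smul (whole (*)) c (R (u z) l)" by simp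
      qed simp
      from lin_map_ell_expand[OF this z] show ?thesis
        by (simp add: t_def mult.commute)
    qed
    have nmQ: "nm (ell (ennreal q) k) (R (u z)) powr p = Q z" if "z \<in> pts (ell r N)" for z
      using q that by (simp add: ell_def coord[OF that] Q_def powr_powr del: pts_ell)
    have nn: "0 \<le> nm (ell (ennreal q) k) (R (u z))" if "z \<in> pts (ell r N)" for z
      using hq RM[OF uM[OF that]] by (simp add: homogeneous_def)
    have Q1: "norm (u z) powr p \<le> a1 powr p * Q z" if z: "z \<in> pts (ell r N)" for z
    proof -
      have "norm (u z) powr p \<le> (a1 * nm (ell (ennreal q) k) (R (u z))) powr p"
        using p Sle[OF uM[OF z]] by (intro powr_mono2) auto
      then show ?thesis using a nn[OF z] by (simp add: powr_mult nmQ[OF z, symmetric])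
    qed
    have Q2: "Q z \<le> a2 powr p * norm (u z) powr p" if z: "z \<in> pts (ell r N)" for z
    proof -
      have "nm (ell (ennreal q) k) (R (u z)) powr p \<le> (a2 * norm (u z)) powr p"
        using p Rle[OF uM[OF z]] nn[OF z] by (intro powr_mono2) auto
      then show ?thesis using a by (simp add: powr_mult nmQ[OF z, symmetric])
    qed
    have Qt: "Q (trunc N z) = Q z" for z by (simp add: Q_def trunc_def)
    have "(\<Sum>j<J. norm (u (x j)) powr p) \<le> a1 powr p * (\<Sum>j<J. Q (x j))"
      using x Q1 by (auto simp: sum_distrib_left intro!: sum_mono)
    then have "ennreal (\<Sum>j<J. norm (u (x j)) powr p) \<le> ennreal (a1 powr p) * ennreal (\<Sum>j<J. Q (x j))"
      by (subst ennreal_mult[symmetric]) (auto simp: Q_def sum_nonneg intro: ennreal_leI)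
    also have "\<dots> \<le> ennreal (a1 powr p) * (ennreal (b * W) * (\<integral>\<^sup>+z. ennreal (Q z) \<partial>?M))"
      unfolding Q_def using dom W hyp by (intro mult_left_mono) (blast, simp)
    also have "\<dots> \<le> ennreal (a1 powr p) * (ennreal (b * W) * (\<integral>\<^sup>+z. ennreal (a2 powr p * norm (u (trunc N z)) powr p) \<partial>?M))"
    proof (intro mult_left_mono nn_integral_mono ennreal_leI)
      fix z
      show "Q z \<le> a2 powr p * norm (u (trunc N z)) powr p"
        using Q2[OF trunc_pts, of z] by (simp add: Qt)
    qed auto
    also have "(\<integral>\<^sup>+z. ennreal (a2 powr p * norm (u (trunc N z)) powr p) \<partial>?M)
        = ennreal (a2 powr p) * (\<integral>\<^sup>+z. ennreal (norm (u (trunc N z)) powr p) \<partial>?M)"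
    proof -
      interpret B: bounded_bilinear sc by (rule X.bounded_bilinear_scale)
      have "continuous_on UNIV (\<lambda>z :: nat \<Rightarrow> 'k. \<Sum>i<N. sc (z i) (u (unit_vec i)))"
        by (intro continuous_on_sum B.continuous_on continuous_on_const) simp
      then have "(\<lambda>z :: nat \<Rightarrow> 'k. norm (\<Sum>i<N. sc (z i) (u (unit_vec i)))) \<in> borel_measurable borel"
        by (intro borel_measurable_continuous_onI continuous_on_norm)
      from measurable_compose[OF measurable_trunc[OF sets_\<mu>] this]
      have [measurable]: "(\<lambda>z. norm (u (trunc N z))) \<in> borel_measurable ?M"
        using lin_map_ell_expand[OF u trunc_pts] by simp
      show ?thesis by (subst nn_integral_cmult[symmetric]) (auto simp: ennreal_mult)
    qed
    also have "ennreal (a1 powr p) * (ennreal (b * W) * (ennreal (a2 powr p) * I)) \<le> ennreal (D * b * W) * I" for I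
    proof -
      have "a1 powr p * (b * W) * a2 powr p = (a1 * a2) powr p * (b * W)"
        using a by (simp add: powr_mult)
      also have "\<dots> \<le> D * (b * W)"
        unfolding D_def using a p b W by (intro mult_right_mono powr_mono2) auto
      finally have "ennreal (a1 powr p * (b * W) * a2 powr p) \<le> ennreal (D * b * W)"
        by (intro ennreal_leI) (simp add: mult.assoc)
      moreover have "ennreal (a1 powr p * (b * W) * a2 powr p) = ennreal (a1 powr p) * ennreal (b * W) * ennreal (a2 powr p)"
        using b W by (simp only: ennreal_mult' ennreal_mult'' mult_nonneg_nonneg less_imp_le powr_ge_zero)
      ultimately show ?thesis
        by (metis mult.assoc mult_right_mono zero_le)
    qed
    finally show "ennreal (\<Sum>j<J. norm (u (x j)) powr p)
       \<le> ennreal (D * b * W) * (\<integral>\<^sup>+z. ennreal (norm (u (trunc N z)) powr p) \<partial>?M)" .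
  qed (use D b in auto)
qed

end

section \<open>One variable after the other\<close>

lemma restrict_if: "restrict (\<lambda>k. if k \<in> A then g k else h k) A = restrict g A"
  by (auto simp: fun_eq_iff)

lemma sum_PiE_insert:
  fixes F :: "('i \<Rightarrow> 'a) \<Rightarrow> 'b::comm_monoid_add"
  assumes "i \<notin> I"
  shows "(\<Sum>g\<in>Pi\<^sub>E (insert i I) A. F g) = (\<Sum>a\<in>A i. \<Sum>g\<in>Pi\<^sub>E I A. F (g(i := a)))"
  unfolding PiE_insert_eq
  by (subst sum.reindex[OF inj_combinator[OF assms]]) (simp add: sum.cartesian_product case_prod_beta o_def)

text \<open>An estimate for each single variable, with the others fixed at arbitrary vectors, tensorizes: in the
  induction the sum over the new variable moves inside the integral over the old ones, where the
  one-variable estimate applies pointwise.\<close>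

lemma multi_sum_le_integral:
  fixes \<Phi> :: "(nat \<Rightarrow> 'v) \<Rightarrow> ennreal" and e :: "'w \<Rightarrow> 'v"
  assumes Q: "prob_space Q" and I: "finite I"
    and meas: "\<And>I' y. \<lbrakk>I' \<subseteq> I; \<And>k. y k \<in> P\<rbrakk> \<Longrightarrow>
       (\<lambda>\<omega>. \<Phi> (\<lambda>k. if k \<in> I' then e (\<omega> k) else y k)) \<in> borel_measurable (Pi\<^sub>M I' (\<lambda>_. Q))"
    and e: "\<And>z. e z \<in> P"
    and step: "\<And>k y. \<lbrakk>k \<in> I; \<And>k. y k \<in> P\<rbrakk> \<Longrightarrow> (\<Sum>j<J k. \<Phi> (y(k := x k j))) \<le> (\<integral>\<^sup>+z. B k * \<Phi> (y(k := e z)) \<partial>Q)"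
    and x: "\<And>k j. k \<in> I \<Longrightarrow> j < J k \<Longrightarrow> x k j \<in> P" and y: "\<And>k. y k \<in> P"
  shows "(\<Sum>j\<in>(\<Pi>\<^sub>E k\<in>I. {..<J k}). \<Phi> (\<lambda>k. if k \<in> I then x k (j k) else y k))
     \<le> (\<Prod>k\<in>I. B k) * (\<integral>\<^sup>+\<omega>. \<Phi> (\<lambda>k. if k \<in> I then e (\<omega> k) else y k) \<partial>Pi\<^sub>M I (\<lambda>_. Q))"
  using I meas step x y
proof (induction I arbitrary: y rule: finite_induct)
  case empty
  interpret prob_space "Pi\<^sub>M {} (\<lambda>_::nat. Q)" by (intro prob_space_PiM Q)
  show ?case by (simp add: emeasure_space_1)
next
  case (insert i I)
  interpret Q: prob_space Q by fact
  interpret product_sigma_finite "\<lambda>_::nat. Q" ..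
  have m: "(\<lambda>\<omega>. \<Phi> (\<lambda>k. if k \<in> I' then e (\<omega> k) else y k)) \<in> borel_measurable (Pi\<^sub>M I' (\<lambda>_. Q))"
    if "I' \<subseteq> I" "\<And>k. y k \<in> P" for I' y
    using that by (intro insert.prems(1)) auto
  have st: "(\<Sum>j<J k. \<Phi> (y(k := x k j))) \<le> (\<integral>\<^sup>+z. B k * \<Phi> (y(k := e z)) \<partial>Q)"
    if "k \<in> I" "\<And>k. y k \<in> P" for k y
    using that by (intro insert.prems(2)) auto
  have xI: "x k j \<in> P" if "k \<in> I" "j < J k" for k j
    using that insert.prems(3) by auto
  have "(\<Sum>j\<in>(\<Pi>\<^sub>E k\<in>insert i I. {..<J k}). \<Phi> (\<lambda>k. if k \<in> insert i I then x k (j k) else y k))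
      = (\<Sum>a<J i. \<Sum>j\<in>(\<Pi>\<^sub>E k\<in>I. {..<J k}). \<Phi> (\<lambda>k. if k \<in> I then x k (j k) else (y(i := x i a)) k))"
    using insert.hyps
    by (subst sum_PiE_insert) (auto intro!: sum.cong arg_cong[where f = \<Phi>])
  also have "\<dots> \<le> (\<Sum>a<J i. (\<Prod>k\<in>I. B k) * (\<integral>\<^sup>+\<omega>. \<Phi> (\<lambda>k. if k \<in> I then e (\<omega> k) else (y(i := x i a)) k) \<partial>Pi\<^sub>M I (\<lambda>_. Q)))"
  proof (rule sum_mono)
    fix a assume a: "a \<in> {..<J i}"
    show "(\<Sum>j\<in>(\<Pi>\<^sub>E k\<in>I. {..<J k}). \<Phi> (\<lambda>k. if k \<in> I then x k (j k) else (y(i := x i a)) k))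
      \<le> (\<Prod>k\<in>I. B k) * (\<integral>\<^sup>+\<omega>. \<Phi> (\<lambda>k. if k \<in> I then e (\<omega> k) else (y(i := x i a)) k) \<partial>Pi\<^sub>M I (\<lambda>_. Q))"
      by (rule insert.IH[OF m st xI]) (use insert.prems a in auto)
  qed
  also have "\<dots> = (\<Prod>k\<in>I. B k) * (\<integral>\<^sup>+\<omega>. (\<Sum>a<J i. \<Phi> (\<lambda>k. if k \<in> I then e (\<omega> k) else (y(i := x i a)) k)) \<partial>Pi\<^sub>M I (\<lambda>_. Q))"
    unfolding sum_distrib_left[symmetric]
  proof (subst nn_integral_sum)
    fix a assume a: "a \<in> {..<J i}"
    show "(\<lambda>\<omega>. \<Phi> (\<lambda>k. if k \<in> I then e (\<omega> k) else (y(i := x i a)) k)) \<in> borel_measurable (Pi\<^sub>M I (\<lambda>_. Q))"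
      by (rule m) (use insert.prems a in auto)
  qed simp
  also have "\<dots> \<le> (\<Prod>k\<in>I. B k) * (\<integral>\<^sup>+\<omega>. (\<integral>\<^sup>+z. B i * \<Phi> ((\<lambda>k. if k \<in> I then e (\<omega> k) else y k)(i := e z)) \<partial>Q) \<partial>Pi\<^sub>M I (\<lambda>_. Q))"
  proof (intro mult_left_mono nn_integral_mono)
    fix \<omega> :: "nat \<Rightarrow> 'w"
    have "(\<Sum>a<J i. \<Phi> (\<lambda>k. if k \<in> I then e (\<omega> k) else (y(i := x i a)) k))
        = (\<Sum>a<J i. \<Phi> ((\<lambda>k. if k \<in> I then e (\<omega> k) else y k)(i := x i a)))"
      using insert.hyps by (intro sum.cong refl arg_cong[where f = \<Phi>]) auto
    also have "\<dots> \<le> (\<integral>\<^sup>+z. B i * \<Phi> ((\<lambda>k. if k \<in> I then e (\<omega> k) else y k)(i := e z)) \<partial>Q)"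
      by (rule insert.prems(2)) (use insert.prems e in auto)
    finally show "(\<Sum>a<J i. \<Phi> (\<lambda>k. if k \<in> I then e (\<omega> k) else (y(i := x i a)) k)) \<le> \<dots>" .
  qed simp
  also have "(\<integral>\<^sup>+\<omega>. (\<integral>\<^sup>+z. B i * \<Phi> ((\<lambda>k. if k \<in> I then e (\<omega> k) else y k)(i := e z)) \<partial>Q) \<partial>Pi\<^sub>M I (\<lambda>_. Q))
     = (\<integral>\<^sup>+\<omega>. (\<integral>\<^sup>+z. B i * \<Phi> (\<lambda>k. if k \<in> insert i I then e (fun_upd \<omega> i z k) else y k) \<partial>Q) \<partial>Pi\<^sub>M I (\<lambda>_. Q))"
    using insert.hyps by (intro nn_integral_cong arg_cong2[where f = "(*)"] refl arg_cong[where f = \<Phi>]) auto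
  also have "\<dots> = (\<integral>\<^sup>+\<omega>. B i * \<Phi> (\<lambda>k. if k \<in> insert i I then e (\<omega> k) else y k) \<partial>Pi\<^sub>M (insert i I) (\<lambda>_. Q))"
    using insert.hyps insert.prems(1)[OF order_refl insert.prems(4)]
    by (intro product_nn_integral_insert[symmetric]) auto
  also have "\<dots> = B i * (\<integral>\<^sup>+\<omega>. \<Phi> (\<lambda>k. if k \<in> insert i I then e (\<omega> k) else y k) \<partial>Pi\<^sub>M (insert i I) (\<lambda>_. Q))"
    by (rule nn_integral_cmult) (rule insert.prems(1)[OF order_refl insert.prems(4)])
  finally show ?case
    using insert.hyps by (simp add: mult_ac)
qed

text \<open>The same principle in the opposite direction. It is used for functions \<open>e\<close> with finite range, for
which the one-variable hypothesis is an equality.\<close>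

lemma multi_integral_le_sum:
  fixes \<Phi> :: "(nat \<Rightarrow> 'v) \<Rightarrow> ennreal" and e :: "'w \<Rightarrow> 'v"
  assumes Q: "prob_space Q" and I: "finite I"
    and meas: "\<And>I' y. \<lbrakk>I' \<subseteq> I; \<And>k. y k \<in> P\<rbrakk> \<Longrightarrow>
       (\<lambda>\<omega>. \<Phi> (\<lambda>k. if k \<in> I' then e (\<omega> k) else y k)) \<in> borel_measurable (Pi\<^sub>M I' (\<lambda>_. Q))"
    and e: "\<And>z. e z \<in> P"
    and step: "\<And>k y. \<lbrakk>k \<in> I; \<And>k. y k \<in> P\<rbrakk> \<Longrightarrow> (\<integral>\<^sup>+z. \<Phi> (y(k := e z)) \<partial>Q) \<le> (\<Sum>j<J. \<Phi> (y(k := x j)))"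
    and x: "\<And>j. j < J \<Longrightarrow> x j \<in> P" and y: "\<And>k. y k \<in> P"
  shows "(\<integral>\<^sup>+\<omega>. \<Phi> (\<lambda>k. if k \<in> I then e (\<omega> k) else y k) \<partial>Pi\<^sub>M I (\<lambda>_. Q))
     \<le> (\<Sum>j\<in>(\<Pi>\<^sub>E k\<in>I. {..<J}). \<Phi> (\<lambda>k. if k \<in> I then x (j k) else y k))"
  using I meas step y
proof (induction I arbitrary: y rule: finite_induct)
  case empty
  interpret prob_space "Pi\<^sub>M {} (\<lambda>_::nat. Q)" by (intro prob_space_PiM Q)
  show ?case by (simp add: emeasure_space_1)
next
  case (insert i I)
  interpret Q: prob_space Q by fact
  interpret product_sigma_finite "\<lambda>_::nat. Q" ..
  have m: "(\<lambda>\<omega>. \<Phi> (\<lambda>k. if k \<in> I' then e (\<omega> k) else y k)) \<in> borel_measurable (Pi\<^sub>M I' (\<lambda>_. Q))"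
    if "I' \<subseteq> I" "\<And>k. y k \<in> P" for I' y
    using that by (intro insert.prems(1)) auto
  have st: "(\<integral>\<^sup>+z. \<Phi> (y(k := e z)) \<partial>Q) \<le> (\<Sum>j<J. \<Phi> (y(k := x j)))"
    if "k \<in> I" "\<And>k. y k \<in> P" for k y
    using that by (intro insert.prems(2)) auto
  have "(\<integral>\<^sup>+\<omega>. \<Phi> (\<lambda>k. if k \<in> insert i I then e (\<omega> k) else y k) \<partial>Pi\<^sub>M (insert i I) (\<lambda>_. Q))
     = (\<integral>\<^sup>+\<omega>. (\<integral>\<^sup>+z. \<Phi> (\<lambda>k. if k \<in> insert i I then e (fun_upd \<omega> i z k) else y k) \<partial>Q) \<partial>Pi\<^sub>M I (\<lambda>_. Q))"
    using insert.hyps insert.prems(1)[OF order_refl insert.prems(3)]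
    by (intro product_nn_integral_insert) auto
  also have "\<dots> \<le> (\<integral>\<^sup>+\<omega>. (\<Sum>a<J. \<Phi> (\<lambda>k. if k \<in> I then e (\<omega> k) else (y(i := x a)) k)) \<partial>Pi\<^sub>M I (\<lambda>_. Q))"
  proof (rule nn_integral_mono)
    fix \<omega> :: "nat \<Rightarrow> 'w"
    have "(\<integral>\<^sup>+z. \<Phi> (\<lambda>k. if k \<in> insert i I then e (fun_upd \<omega> i z k) else y k) \<partial>Q)
        = (\<integral>\<^sup>+z. \<Phi> ((\<lambda>k. if k \<in> I then e (\<omega> k) else y k)(i := e z)) \<partial>Q)"
      using insert.hyps by (intro nn_integral_cong arg_cong[where f = \<Phi>]) auto
    also have "\<dots> \<le> (\<Sum>a<J. \<Phi> ((\<lambda>k. if k \<in> I then e (\<omega> k) else y k)(i := x a)))"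
      by (rule insert.prems(2)) (use insert.prems e in auto)
    also have "\<dots> = (\<Sum>a<J. \<Phi> (\<lambda>k. if k \<in> I then e (\<omega> k) else (y(i := x a)) k))"
      using insert.hyps by (intro sum.cong refl arg_cong[where f = \<Phi>]) auto
    finally show "(\<integral>\<^sup>+z. \<Phi> (\<lambda>k. if k \<in> insert i I then e (fun_upd \<omega> i z k) else y k) \<partial>Q) \<le> \<dots>" .
  qed
  also have "\<dots> = (\<Sum>a<J. (\<integral>\<^sup>+\<omega>. \<Phi> (\<lambda>k. if k \<in> I then e (\<omega> k) else (y(i := x a)) k) \<partial>Pi\<^sub>M I (\<lambda>_. Q)))"
  proof (rule nn_integral_sum)
    fix a assume a: "a \<in> {..<J}"
    show "(\<lambda>\<omega>. \<Phi> (\<lambda>k. if k \<in> I then e (\<omega> k) else (y(i := x a)) k)) \<in> borel_measurable (Pi\<^sub>M I (\<lambda>_. Q))"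
      by (rule m) (use insert.prems a x in auto)
  qed
  also have "\<dots> \<le> (\<Sum>a<J. (\<Sum>j\<in>(\<Pi>\<^sub>E k\<in>I. {..<J}). \<Phi> (\<lambda>k. if k \<in> I then x (j k) else (y(i := x a)) k)))"
  proof (rule sum_mono)
    fix a assume a: "a \<in> {..<J}"
    show "(\<integral>\<^sup>+\<omega>. \<Phi> (\<lambda>k. if k \<in> I then e (\<omega> k) else (y(i := x a)) k) \<partial>Pi\<^sub>M I (\<lambda>_. Q))
      \<le> (\<Sum>j\<in>(\<Pi>\<^sub>E k\<in>I. {..<J}). \<Phi> (\<lambda>k. if k \<in> I then x (j k) else (y(i := x a)) k))"
      by (rule insert.IH[OF m st]) (use insert.prems a x in auto)
  qed
  also have "\<dots> = (\<Sum>j\<in>(\<Pi>\<^sub>E k\<in>insert i I. {..<J}). \<Phi> (\<lambda>k. if k \<in> insert i I then x (j k) else y k))"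
    using insert.hyps
    by (subst sum_PiE_insert) (auto intro!: sum.cong arg_cong[where f = \<Phi>])
  finally show ?case .
qed

lemma nn_integral_finite_range:
  assumes V: "finite V" "\<And>z. z \<in> space M \<Longrightarrow> f z \<in> V"
    and meas: "\<And>v. v \<in> V \<Longrightarrow> f -` {v} \<inter> space M \<in> sets M"
  shows "(\<integral>\<^sup>+z. G (f z) \<partial>M) = (\<Sum>v\<in>V. G v * emeasure M (f -` {v} \<inter> space M))"
proof -
  have "(\<integral>\<^sup>+z. G (f z) \<partial>M) = (\<integral>\<^sup>+z. (\<Sum>v\<in>V. G v * indicator (f -` {v} \<inter> space M) z) \<partial>M)"
  proof (rule nn_integral_cong)
    fix z assume z: "z \<in> space M"
    have "(\<Sum>v\<in>V. G v * indicator (f -` {v} \<inter> space M) z) = (\<Sum>v\<in>{f z}. G v * indicator (f -` {v} \<inter> space M) z)"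
      using V z by (intro sum.mono_neutral_right) (auto simp: indicator_def)
    then show "G (f z) = (\<Sum>v\<in>V. G v * indicator (f -` {v} \<inter> space M) z)" using z by simp
  qed
  also have "\<dots> = (\<Sum>v\<in>V. G v * emeasure M (f -` {v} \<inter> space M))"
    using meas by (subst nn_integral_sum) (auto simp: nn_integral_cmult_indicator)
  finally show ?thesis .
qed

lemma tendsto_funI:
  fixes f :: "'a \<Rightarrow> 'i \<Rightarrow> 'b::topological_space"
  assumes "\<And>i. ((\<lambda>n. f n i) \<longlongrightarrow> l i) F"
  shows "(f \<longlongrightarrow> l) F"
  using assms limitin_componentwise[of "\<lambda>_::'i. euclidean :: 'b topology" UNIV f l F]
  by (simp add: euclidean_product_topology limitin_canonical_iff)

lemma cont_multilinear_lin_map: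
  assumes "T \<in> cont_multilinear m (\<lambda>_. E) F" "k < m" "\<And>k. k < m \<Longrightarrow> y k \<in> pts E"
  shows "lin_map E F (\<lambda>v. T (restrict (y(k := v)) {..<m}))"
proof -
  have "restrict y {..<m} \<in> (\<Pi>\<^sub>E k\<in>{..<m}. pts E)" using assms by auto
  then have "lin_map E F (\<lambda>v. T ((restrict y {..<m})(k := v)))"
    using assms unfolding cont_multilinear_def by blast
  moreover have "(restrict y {..<m})(k := v) = restrict (y(k := v)) {..<m}" for v
    using assms(2) by (auto simp: fun_eq_iff restrict_def)
  ultimately show ?thesis by simp
qed

lemma cont_multilinear_homogeneous:
  fixes T :: "(nat \<Rightarrow> nat \<Rightarrow> 'k::real_normed_field) \<Rightarrow> 'x::real_normed_vector"
  assumes nsp: "normed_space_over sc" and T: "T \<in> cont_multilinear m (\<lambda>_. ell r N) (whole sc)"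
    and k: "k < m" and y: "\<And>k. y k \<in> pts (ell r N)" and v: "v \<in> pts (ell r N)"
  shows "norm (T (restrict (y(k := (\<lambda>i. c * v i))) {..<m})) = norm c * norm (T (restrict (y(k := v)) {..<m}))"
proof -
  have "lin_map (ell r N) (whole sc) (\<lambda>v. T (restrict (y(k := v)) {..<m}))"
    by (rule cont_multilinear_lin_map[OF T k]) (rule y)
  then have "T (restrict (y(k := smul (ell r N) c v)) {..<m}) = smul (whole sc) c (T (restrict (y(k := v)) {..<m}))"
    using v unfolding lin_map_def by blast
  then show ?thesis using nsp by (simp add: normed_space_over.norm_sc)
qed

text \<open>In a multilinear map on \<open>\<ell>\<^sub>r\<^sup>N\<close> each variable can be expanded in coordinates, so that its values are polynomials in
  finitely many scalars; continuity in the product topology of \<open>\<nat> \<Rightarrow> \<nat> \<Rightarrow> \<K>\<close> follows by induction on the set of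
  expanded variables.\<close>

lemma multilinear_continuous:
  fixes T :: "(nat \<Rightarrow> nat \<Rightarrow> 'k::{real_normed_field}) \<Rightarrow> 'x::real_normed_vector"
  assumes sc: "normed_space_over sc" and T: "T \<in> cont_multilinear m (\<lambda>_. ell r N) (whole sc)"
    and "finite I" "I \<subseteq> {..<m}" and "\<And>k. k < m \<Longrightarrow> y k \<in> pts (ell r N)"
  shows "continuous_on UNIV (\<lambda>\<omega> :: nat \<Rightarrow> nat \<Rightarrow> 'k. T (restrict (\<lambda>k. if k \<in> I then trunc N (\<omega> k) else y k) {..<m}))"
  using assms(3-5)
proof (induction I arbitrary: y rule: finite_induct)
  case empty
  then show ?case by simp
next
  case (insert k I)
  interpret B: bounded_bilinear sc by (rule normed_space_over.bounded_bilinear_scale[OF sc])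
  have k: "k < m" using insert.prems by simp
  have "T (restrict (\<lambda>k'. if k' \<in> insert k I then trunc N (\<omega> k') else y k') {..<m})
      = (\<Sum>i<N. sc (\<omega> k i) (T (restrict (\<lambda>k'. if k' \<in> I then trunc N (\<omega> k') else (y(k := unit_vec i)) k') {..<m})))"
    for \<omega> :: "nat \<Rightarrow> nat \<Rightarrow> 'k"
  proof -
    let ?y = "\<lambda>k'. if k' \<in> I then trunc N (\<omega> k') else y k'"
    have "?y k' \<in> pts (ell r N)" if "k' < m" for k'
      using insert.prems(2)[OF that] by (simp add: trunc_pts del: pts_ell)
    from lin_map_ell_expand[OF cont_multilinear_lin_map[OF T k this] trunc_pts[of N "\<omega> k" r]]
    have "T (restrict (?y(k := trunc N (\<omega> k))) {..<m})
        = (\<Sum>i<N. sc (trunc N (\<omega> k) i) (T (restrict (?y(k := unit_vec i)) {..<m})))"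
      by simp
    also have "\<dots> = (\<Sum>i<N. sc (\<omega> k i) (T (restrict (?y(k := unit_vec i)) {..<m})))"
      by (intro sum.cong refl) (simp add: trunc_def)
    finally have "T (restrict (?y(k := trunc N (\<omega> k))) {..<m})
        = (\<Sum>i<N. sc (\<omega> k i) (T (restrict (?y(k := unit_vec i)) {..<m})))" .
    moreover have "?y(k := trunc N (\<omega> k)) = (\<lambda>k'. if k' \<in> insert k I then trunc N (\<omega> k') else y k')"
      by auto
    moreover have "?y(k := unit_vec i) = (\<lambda>k'. if k' \<in> I then trunc N (\<omega> k') else (y(k := unit_vec i)) k')" for i
      using insert.hyps by auto
    ultimately show ?thesis by (simp only:)
  qed
  moreover have "continuous_on UNIV (\<lambda>\<omega> :: nat \<Rightarrow> nat \<Rightarrow> 'k. \<Sum>i<N. sc (\<omega> k i)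
      (T (restrict (\<lambda>k'. if k' \<in> I then trunc N (\<omega> k') else (y(k := unit_vec i)) k') {..<m})))"
  proof (rule continuous_on_sum, rule B.continuous_on)
    fix i assume i: "i \<in> {..<N}"
    show "continuous_on UNIV (\<lambda>\<omega> :: nat \<Rightarrow> nat \<Rightarrow> 'k. \<omega> k i)"
      by (rule continuous_on_product_then_coordinatewise[OF continuous_on_product_then_coordinatewise[OF continuous_on_id]])
    show "continuous_on UNIV (\<lambda>\<omega> :: nat \<Rightarrow> nat \<Rightarrow> 'k.
        T (restrict (\<lambda>k'. if k' \<in> I then trunc N (\<omega> k') else (y(k := unit_vec i)) k') {..<m}))"
    proof (rule insert.IH)
      show "(y(k := unit_vec i)) k' \<in> pts (ell r N)" if "k' < m" for k'
        using insert.prems(2)[OF that] unit_vec_pts[of i N r] i by (cases "k' = k") (simp_all del: pts_ell)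
    qed (use insert.prems in auto)
  qed
  ultimately show ?case by (simp only:)
qed

text \<open>The composition with the norm is measurable for a target space that need not be separable, because it is
continuous on a second countable space.\<close>

lemma multilinear_measurable:
  fixes T :: "(nat \<Rightarrow> nat \<Rightarrow> 'k::{real_normed_field, second_countable_topology}) \<Rightarrow> 'x::real_normed_vector"
  assumes sc: "normed_space_over sc" and T: "T \<in> cont_multilinear m (\<lambda>_. ell r N) (whole sc)"
    and I: "I \<subseteq> {..<m}" and y: "\<And>k. y k \<in> pts (ell r N)" and g: "g \<in> borel_measurable Q"
  shows "(\<lambda>\<omega>. ennreal (norm (T (restrict (\<lambda>k. if k \<in> I then trunc N (g (\<omega> k)) else y k) {..<m})) powr p))
     \<in> borel_measurable (Pi\<^sub>M I (\<lambda>_. Q))"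
proof -
  have "finite I" using I finite_subset by blast
  from multilinear_continuous[OF sc T this I, of y] y
  have "(\<lambda>\<omega> :: nat \<Rightarrow> nat \<Rightarrow> 'k. norm (T (restrict (\<lambda>k. if k \<in> I then trunc N (\<omega> k) else y k) {..<m}))) \<in> borel_measurable borel"
    by (intro borel_measurable_continuous_onI continuous_on_norm) simp
  moreover have "(\<lambda>\<omega> k. if k \<in> I then g (\<omega> k) else (\<lambda>_. 0)) \<in> borel_measurable (Pi\<^sub>M I (\<lambda>_. Q))"
  proof (rule measurable_coordinatewise_then_product)
    fix k
    show "(\<lambda>\<omega>. if k \<in> I then g (\<omega> k) else (\<lambda>_. 0)) \<in> borel_measurable (Pi\<^sub>M I (\<lambda>_. Q))"
      using g by (cases "k \<in> I") (auto intro: measurable_compose[OF measurable_component_singleton])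
  qed
  ultimately have "(\<lambda>\<omega>. norm (T (restrict (\<lambda>k. if k \<in> I then trunc N (if k \<in> I then g (\<omega> k) else (\<lambda>_. 0)) else y k) {..<m})))
      \<in> borel_measurable (Pi\<^sub>M I (\<lambda>_. Q))"
    by (rule measurable_compose[rotated])
  then have "(\<lambda>\<omega>. norm (T (restrict (\<lambda>k. if k \<in> I then trunc N (g (\<omega> k)) else y k) {..<m})))
      \<in> borel_measurable (Pi\<^sub>M I (\<lambda>_. Q))"
    by (simp cong: if_cong)
  then show ?thesis by measurable
qed

lemma Lp_integral_norm_le:
  assumes "0 < p" "0 \<le> c"
    and "(\<integral>\<^sup>+z. ennreal (norm (T (restrict (\<lambda>k. trunc N (z k)) {..<m})) powr p) \<partial>Pi\<^sub>M {..<m} (\<lambda>_. Pi\<^sub>M {..<N} (\<lambda>_. \<mu>)))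
       \<le> ennreal (c powr p)"
  shows "Lp_integral_norm p m N \<mu> T \<le> ennreal c"
proof -
  let ?I = "\<integral>\<^sup>+z. ennreal (norm (T (restrict (\<lambda>k. trunc N (z k)) {..<m})) powr p) \<partial>Pi\<^sub>M {..<m} (\<lambda>_. Pi\<^sub>M {..<N} (\<lambda>_. \<mu>))"
  obtain v where v: "0 \<le> v" "?I = ennreal v"
    using assms(3) by (cases ?I) (auto simp: top_unique)
  have "v \<le> c powr p" using assms(3) v by simp
  then have "v powr (1 / p) \<le> (c powr p) powr (1 / p)" using v assms by (intro powr_mono2) auto
  also have "\<dots> = c" using assms by (simp add: powr_powr)
  finally show ?thesis
    using v unfolding Lp_integral_norm_def ennpowr_def trunc_def by (simp add: ennreal_leI)
qed

section \<open>The upper estimate and discretization\<close>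

context stable_law
begin

text \<open>The constant \<open>D = b\<^bsup>1/p\<^esup>\<close> of the linear estimate is picked up once for each variable.\<close>

lemma multiple_summing_norm_le:
  fixes sc :: "'k \<Rightarrow> 'x::real_normed_vector \<Rightarrow> 'x"
  assumes nsp: "normed_space_over sc" and L: "Lg_space q sc" and conj: "conjugate r s"
    and p: "0 < p" and q: "1 \<le> q" and fin: "p < s \<or> s = 2" and pq: "q \<le> p \<or> q \<le> 2"
  shows "\<exists>b>0. \<forall>N. \<forall>T \<in> cont_multilinear m (\<lambda>_. ell r N) (whole sc).
     multiple_summing_norm p m (\<lambda>_. ell r N) (whole sc) T \<le> ennreal b * Lp_integral_norm p m N \<mu> T"
proof -
  interpret X: normed_space_over sc by fact
  obtain b :: real where b: "0 < b" and dom: "\<And>N u (J::nat) x W. lin_map (ell r N) (whole sc) u \<Longrightarrow>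
     (\<forall>j<J. x j \<in> pts (ell r N)) \<Longrightarrow> 0 \<le> W \<Longrightarrow>
     weak_bound s p W N J x \<Longrightarrow>
     ennreal (\<Sum>j<J. norm (u (x j)) powr p)
       \<le> ennreal (b * W) * (\<integral>\<^sup>+z. ennreal (norm (u (trunc N z)) powr p) \<partial>Pi\<^sub>M {..<N} (\<lambda>_. \<mu>))"
    using linear_domination[OF assms] by blast
  define D where "D = b powr (1 / p)"
  have D: "0 < D" "D powr p = b" using b p by (auto simp: D_def powr_powr)
  show ?thesis
  proof (rule exI[of _ "D ^ m"], intro conjI allI ballI)
    fix N and T :: "(nat \<Rightarrow> nat \<Rightarrow> 'k) \<Rightarrow> 'x"
    assume T: "T \<in> cont_multilinear m (\<lambda>_. ell r N) (whole sc)"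
    let ?S = "multiple_summing_norm p m (\<lambda>_. ell r N) (whole sc) T"
    let ?Q = "Pi\<^sub>M {..<N} (\<lambda>_. \<mu>)" and ?P = "pts (ell r N) :: (nat \<Rightarrow> 'k) set"
    define \<Phi> where "\<Phi> y = ennreal (norm (T (restrict y {..<m})) powr p)" for y
    define I where "I = (\<integral>\<^sup>+\<omega>. \<Phi> (\<lambda>k. trunc N (\<omega> k)) \<partial>Pi\<^sub>M {..<m} (\<lambda>_. ?Q))"
    have Lp: "Lp_integral_norm p m N \<mu> T = ennpowr I (1 / p)"
      unfolding Lp_integral_norm_def I_def \<Phi>_def trunc_def ..
    show "?S \<le> ennreal (D ^ m) * Lp_integral_norm p m N \<mu> T"
    proof (cases "I = \<infinity>")
      case True
      then show ?thesis using D by (simp add: Lp ennpowr_def ennreal_mult_top)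
    next
      case False
      then obtain v where v: "0 \<le> v" "I = ennreal v" by (cases I) auto
      have meas: "(\<lambda>\<omega>. \<Phi> (\<lambda>k. if k \<in> I' then trunc N (\<omega> k) else y k)) \<in> borel_measurable (Pi\<^sub>M I' (\<lambda>_. ?Q))"
        if "I' \<subseteq> {..<m}" "\<And>k. y k \<in> ?P" for I' y
      proof -
        have "(\<lambda>\<omega>. ennreal (norm (T (restrict (\<lambda>k. if k \<in> I' then trunc N (trunc N (\<omega> k)) else y k) {..<m})) powr p))
            \<in> borel_measurable (Pi\<^sub>M I' (\<lambda>_. ?Q))"
          by (rule multilinear_measurable[OF nsp T that(1) that(2) measurable_trunc[OF sets_\<mu>]])
        then show ?thesis by (simp only: \<Phi>_def trunc_trunc)
      qed
      \<comment> \<open>The summand \<open>e\<close> makes the constant positive even if the integral vanishes.\<close>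
      have adm: "ennreal ((\<Sum>j \<in> (\<Pi>\<^sub>E k\<in>{..<m}. {..<J k}). norm (T (\<lambda>k\<in>{..<m}. x k (j k))) powr p) powr (1 / p))
          \<le> ennreal (D ^ m * v powr (1 / p) + e) * (\<Prod>k<m. weak_norm p (ell r N) (J k) (x k))"
        if x: "\<forall>k<m. \<forall>j<J k. x k j \<in> ?P" and e: "0 < e" for J :: "nat \<Rightarrow> nat" and x and e :: real
      proof -
        have "\<forall>k\<in>{..<m}. \<exists>W\<ge>0. weak_norm p (ell r N) (J k) (x k) = ennreal W \<and>
          weak_bound s p (W powr p) N (J k) (x k)"
          using weak_norm_ell[OF conj p] x by blast
        from bchoice[OF this] obtain W where W: "\<And>k. k < m \<Longrightarrow> 0 \<le> W k"
          "\<And>k. k < m \<Longrightarrow> weak_norm p (ell r N) (J k) (x k) = ennreal (W k)"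
          "\<And>k. k < m \<Longrightarrow> weak_bound s p (W k powr p) N (J k) (x k)"
          by auto
        let ?\<Sigma> = "\<Sum>j \<in> (\<Pi>\<^sub>E k\<in>{..<m}. {..<J k}). norm (T (\<lambda>k\<in>{..<m}. x k (j k))) powr p"
        have "(\<Sum>j\<in>(\<Pi>\<^sub>E k\<in>{..<m}. {..<J k}). \<Phi> (\<lambda>k. if k \<in> {..<m} then x k (j k) else (\<lambda>_. 0)))
          \<le> (\<Prod>k<m. ennreal (b * W k powr p)) * (\<integral>\<^sup>+\<omega>. \<Phi> (\<lambda>k. if k \<in> {..<m} then trunc N (\<omega> k) else (\<lambda>_. 0)) \<partial>Pi\<^sub>M {..<m} (\<lambda>_. ?Q))"
        proof (rule multi_sum_le_integral[where P = ?P, OF prob_space_power finite_lessThan meas trunc_pts])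
          fix k :: nat and y :: "nat \<Rightarrow> nat \<Rightarrow> 'k" assume k: "k \<in> {..<m}" and y: "\<And>k. y k \<in> ?P"
          have "lin_map (ell r N) (whole sc) (\<lambda>v. T (restrict (y(k := v)) {..<m}))"
            using k by (intro cont_multilinear_lin_map[OF T _ y]) auto
          from dom[OF this _ _ W(3)] x W(1) k
          have "ennreal (\<Sum>j<J k. norm (T (restrict (y(k := x k j)) {..<m})) powr p)
            \<le> ennreal (b * W k powr p) * (\<integral>\<^sup>+z. ennreal (norm (T (restrict (y(k := trunc N z)) {..<m})) powr p) \<partial>?Q)"
            by simp
          moreover have "(\<lambda>z. ennreal (norm (T (restrict (y(k := trunc N z)) {..<m})) powr p)) \<in> borel_measurable ?Q"
          proof -
            have "continuous_on UNIV (\<lambda>\<omega>. T (restrict (\<lambda>k'. if k' \<in> {k} then trunc N (\<omega> k') else y k') {..<m}))"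
              using k by (intro multilinear_continuous[OF nsp T _ _ y]) auto
            then have c: "(\<lambda>\<omega>. norm (T (restrict (\<lambda>k'. if k' \<in> {k} then trunc N (\<omega> k') else y k') {..<m}))) \<in> borel_measurable borel"
              by (intro borel_measurable_continuous_onI continuous_on_norm)
            have "(\<lambda>z. (\<lambda>_. trunc N z) :: nat \<Rightarrow> nat \<Rightarrow> 'k) \<in> borel_measurable ?Q"
              by (rule measurable_coordinatewise_then_product) (rule measurable_trunc[OF sets_\<mu>])
            from measurable_compose[OF this c]
            have "(\<lambda>z. norm (T (restrict (\<lambda>k'. if k' \<in> {k} then trunc N (trunc N z) else y k') {..<m}))) \<in> borel_measurable ?Q" .
            moreover have "(\<lambda>k'. if k' \<in> {k} then trunc N (trunc N z) else y k') = y(k := trunc N z)" for z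
              by (simp add: trunc_trunc fun_eq_iff)
            ultimately show ?thesis by simp
          qed
          ultimately show "(\<Sum>j<J k. \<Phi> (y(k := x k j))) \<le> (\<integral>\<^sup>+z. ennreal (b * W k powr p) * \<Phi> (y(k := trunc N z)) \<partial>?Q)"
            by (simp add: \<Phi>_def nn_integral_cmult)
        next
          show "x k j \<in> ?P" if "k \<in> {..<m}" "j < J k" for k j using x that by blast
        qed simp_all
        also have "(\<Prod>k<m. ennreal (b * W k powr p)) = ennreal (\<Prod>k<m. b * W k powr p)"
          using b by (intro prod_ennreal) auto
        also have "(\<integral>\<^sup>+\<omega>. \<Phi> (\<lambda>k. if k \<in> {..<m} then trunc N (\<omega> k) else (\<lambda>_. 0)) \<partial>Pi\<^sub>M {..<m} (\<lambda>_. ?Q)) = ennreal v"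
          unfolding v(2)[symmetric] I_def \<Phi>_def restrict_if ..
        also have "(\<Sum>j\<in>(\<Pi>\<^sub>E k\<in>{..<m}. {..<J k}). \<Phi> (\<lambda>k. if k \<in> {..<m} then x k (j k) else (\<lambda>_. 0)))
          = ennreal (\<Sum>j \<in> (\<Pi>\<^sub>E k\<in>{..<m}. {..<J k}). norm (T (\<lambda>k\<in>{..<m}. x k (j k))) powr p)"
          unfolding \<Phi>_def restrict_if by (rule sum_ennreal) simp
        finally have le: "ennreal ?\<Sigma> \<le> ennreal (\<Prod>k<m. b * W k powr p) * ennreal v" .
        have "?\<Sigma> \<le> (\<Prod>k<m. b * W k powr p) * v"
        proof -
          have nonneg: "0 \<le> (\<Prod>k<m. b * W k powr p)" using b by (intro prod_nonneg) auto
          from le have "ennreal ?\<Sigma> \<le> ennreal ((\<Prod>k<m. b * W k powr p) * v)"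
            using nonneg v(1) by (simp only: ennreal_mult)
          then show ?thesis using nonneg v(1) by (simp only: ennreal_le_iff mult_nonneg_nonneg)
        qed
        then have "(\<Sum>j \<in> (\<Pi>\<^sub>E k\<in>{..<m}. {..<J k}). norm (T (\<lambda>k\<in>{..<m}. x k (j k))) powr p) powr (1 / p)
            \<le> ((\<Prod>k<m. b * W k powr p) * v) powr (1 / p)"
          using p by (intro powr_mono2) (auto simp: sum_nonneg)
        also have "(\<Prod>k<m. b * W k powr p) = (\<Prod>k<m. D * W k) powr p"
        proof -
          have "(\<Prod>k<n. b * W k powr p) = (\<Prod>k<n. D * W k) powr p" if "n \<le> m" for n
            using that by (induction n) (use D W(1) in \<open>simp_all add: powr_mult prod_nonneg\<close>)
          then show ?thesis by blast
        qed
        also have "((\<Prod>k<m. D * W k) powr p * v) powr (1 / p) = (\<Prod>k<m. D * W k) * v powr (1 / p)"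
        proof -
          have "0 \<le> (\<Prod>k<m. D * W k)" using D W(1) by (intro prod_nonneg) auto
          then show ?thesis using p v by (simp add: powr_mult powr_powr)
        qed
        also have "\<dots> = D ^ m * v powr (1 / p) * (\<Prod>k<m. W k)"
          by (simp add: prod.distrib)
        also have "\<dots> \<le> (D ^ m * v powr (1 / p) + e) * (\<Prod>k<m. W k)"
          using e W(1) by (intro mult_right_mono prod_nonneg) auto
        finally have "ennreal ((\<Sum>j \<in> (\<Pi>\<^sub>E k\<in>{..<m}. {..<J k}). norm (T (\<lambda>k\<in>{..<m}. x k (j k))) powr p) powr (1 / p))
            \<le> ennreal ((D ^ m * v powr (1 / p) + e) * (\<Prod>k<m. W k))"
          by (rule ennreal_leI)
        also have "\<dots> = ennreal (D ^ m * v powr (1 / p) + e) * (\<Prod>k<m. ennreal (W k))"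
        proof -
          have "0 \<le> D ^ m * v powr (1 / p) + e" "0 \<le> (\<Prod>k<m. W k)"
            using D e W(1) by (auto intro!: prod_nonneg)
          moreover have "(\<Prod>k<m. ennreal (W k)) = ennreal (\<Prod>k<m. W k)"
            using W(1) by (intro prod_ennreal) auto
          ultimately show ?thesis by (simp only: ennreal_mult)
        qed
        also have "(\<Prod>k<m. ennreal (W k)) = (\<Prod>k<m. weak_norm p (ell r N) (J k) (x k))"
          using W(2) by simp
        finally show ?thesis .
      qed
      have eps: "?S \<le> ennreal (D ^ m * v powr (1 / p)) + ennreal e" if e: "0 < e" for e
      proof -
        have pos: "0 < D ^ m * v powr (1 / p) + e" using D e by (intro add_nonneg_pos) auto
        have "?S \<le> ennreal (D ^ m * v powr (1 / p) + e)"
          unfolding multiple_summing_norm_def whole_simps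
          using pos adm[OF _ e] by (intro Inf_lower) blast
        then show ?thesis using D e by simp
      qed
      have "?S \<le> ennreal (D ^ m * v powr (1 / p))"
        by (rule ennreal_le_epsilon) (rule eps)
      also have "\<dots> = ennreal (D ^ m) * Lp_integral_norm p m N \<mu> T"
        using v D by (simp add: Lp ennpowr_def ennreal_mult)
      finally show ?thesis .
    qed
  qed (use D in simp)
qed

lemma nn_integral_component:
  fixes i N :: nat
  assumes [measurable]: "f \<in> borel_measurable \<mu>" and i: "i < N"
  shows "(\<integral>\<^sup>+z. f (z i) \<partial>Pi\<^sub>M {..<N} (\<lambda>_. \<mu>)) = (\<integral>\<^sup>+z. f z \<partial>\<mu>)"
proof -
  have "(\<integral>\<^sup>+z. f z \<partial>\<mu>) = (\<integral>\<^sup>+z. f z \<partial>distr (Pi\<^sub>M {..<N} (\<lambda>_. \<mu>)) \<mu> (\<lambda>\<omega>. \<omega> i))"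
    using i by (subst distr_PiM_component[of "{..<N}" "\<lambda>_. \<mu>" i]) (auto intro: prob_space_axioms)
  also have "\<dots> = (\<integral>\<^sup>+z. f (z i) \<partial>Pi\<^sub>M {..<N} (\<lambda>_. \<mu>))"
    using i by (subst nn_integral_distr) auto
  finally show ?thesis ..
qed

lemma absolute_moment_finite:
  assumes p: "0 < p" and fin: "p < s \<or> s = 2"
  shows "(\<integral>\<^sup>+z. ennreal (norm z powr p) \<partial>\<mu>) < \<infinity>"
proof -
  obtain B :: real where B: "\<And>(N::nat) c. (\<integral>\<^sup>+z. ennreal (norm (\<Sum>i<N. c i * z i) powr p) \<partial>Pi\<^sub>M {..<N} (\<lambda>_. \<mu>))
        \<le> ennreal (B * (\<Sum>i<N. norm (c i) powr s) powr (p / s))"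
    using lp_norm_combination[OF assms] by blast
  have "(\<integral>\<^sup>+z. ennreal (norm z powr p) \<partial>\<mu>) = (\<integral>\<^sup>+z. ennreal (norm (z 0) powr p) \<partial>Pi\<^sub>M {..<1::nat} (\<lambda>_. \<mu>))"
    by (rule nn_integral_component[symmetric]) auto
  also have "\<dots> \<le> ennreal B"
    using B[of "1::nat" "\<lambda>_. 1"] by simp
  finally show ?thesis by (rule order.strict_trans1) simp
qed

lemma simple_approximation:
  assumes p: "0 < p" and fin: "p < s \<or> s = 2"
  shows "\<exists>S :: nat \<Rightarrow> 'k \<Rightarrow> 'k. (\<forall>n. S n \<in> borel_measurable borel \<and> finite (range (S n))) \<and>
     (\<forall>z. (\<lambda>n. S n z) \<longlonglongrightarrow> z) \<and> (\<lambda>n. \<integral>\<^sup>+z. ennreal (norm (S n z - z) powr p) \<partial>\<mu>) \<longlonglongrightarrow> 0"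
proof -
  obtain S :: "nat \<Rightarrow> 'k \<Rightarrow> 'k" where S: "\<And>n. simple_function borel (S n)" "\<And>z. (\<lambda>n. S n z) \<longlonglongrightarrow> z"
    "\<And>n z. dist (S n z) 0 \<le> 2 * dist z 0"
    using borel_measurable_implies_sequence_metric[of "\<lambda>z::'k. z" borel 0] by auto
  have Sm [measurable]: "S n \<in> borel_measurable borel" for n
    using S(1) by (rule borel_measurable_simple_function)
  have "(\<lambda>n. \<integral>\<^sup>+z. ennreal (norm (S n z - z) powr p) \<partial>\<mu>) \<longlonglongrightarrow> (\<integral>\<^sup>+z. 0 \<partial>\<mu>)"
  proof (rule nn_integral_dominated_convergence[where w = "\<lambda>z. ennreal (3 powr p) * ennreal (norm z powr p)"])
    show "AE z in \<mu>. ennreal (norm (S n z - z) powr p) \<le> ennreal (3 powr p) * ennreal (norm z powr p)" for n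
    proof (rule AE_I2)
      fix z
      have "norm (S n z - z) \<le> 3 * norm z"
        using S(3)[of n z] norm_triangle_ineq4[of "S n z" z] by simp
      then have "norm (S n z - z) powr p \<le> (3 * norm z) powr p"
        using p by (intro powr_mono2) auto
      then show "ennreal (norm (S n z - z) powr p) \<le> ennreal (3 powr p) * ennreal (norm z powr p)"
        by (simp add: powr_mult ennreal_mult[symmetric] ennreal_leI)
    qed
    show "(\<integral>\<^sup>+z. ennreal (3 powr p) * ennreal (norm z powr p) \<partial>\<mu>) < \<infinity>"
      using absolute_moment_finite[OF assms] by (subst nn_integral_cmult) (auto simp: ennreal_mult_less_top)
    show "AE z in \<mu>. (\<lambda>n. ennreal (norm (S n z - z) powr p)) \<longlonglongrightarrow> 0"
    proof (rule AE_I2)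
      fix z
      have "(\<lambda>n. norm (S n z - z)) \<longlonglongrightarrow> 0"
        using S(2)[of z] by (simp add: LIM_zero tendsto_norm_zero)
      then have "(\<lambda>n. norm (S n z - z) powr p) \<longlonglongrightarrow> 0 powr p"
        using p by (intro tendsto_powr') (auto intro: tendsto_const)
      then have "(\<lambda>n. ennreal (norm (S n z - z) powr p)) \<longlonglongrightarrow> ennreal 0"
        using p by (intro tendsto_ennrealI) simp
      then show "(\<lambda>n. ennreal (norm (S n z - z) powr p)) \<longlonglongrightarrow> 0" by simp
    qed
  qed measurable
  moreover have "finite (range (S n))" for n
    using simple_functionD(1)[OF S(1)[of n]] by simp
  ultimately show ?thesis using S(2) Sm by (intro exI[of _ S]) auto
qed

text \<open>The weak \<open>p\<close>-norm of the discretized variables. A combination of the \<open>S\<^sub>n z\<^sub>i\<close> differs from that of the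
  \<open>z\<^sub>i\<close> by at most \<open>\<Sum>i. norm (S\<^sub>n z\<^sub>i - z\<^sub>i)\<close>, as the coefficients have norm at most 1. So for \<open>n\<close> large, depending on \<open>N\<close>, the
  bound from stability persists with a constant \<open>H\<close> independent of \<open>N\<close>.\<close>

lemma simple_combination_bound:
  assumes p: "0 < p" and fin: "p < s \<or> s = 2"
    and S: "\<And>n. S n \<in> borel_measurable borel" "(\<lambda>n. \<integral>\<^sup>+z. ennreal (norm (S n z - z) powr p) \<partial>\<mu>) \<longlonglongrightarrow> 0"
  shows "\<exists>H>0. \<forall>N::nat. \<exists>n0. \<forall>n\<ge>n0. \<forall>c. (\<Sum>i<N. norm (c i) powr s) \<le> 1 \<longrightarrow>
     (\<integral>\<^sup>+z. ennreal (norm (\<Sum>i<N. c i * S n (z i)) powr p) \<partial>Pi\<^sub>M {..<N} (\<lambda>_. \<mu>)) \<le> ennreal H"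
proof -
  obtain B :: real where B: "0 < B" "\<And>(N::nat) c. (\<integral>\<^sup>+z. ennreal (norm (\<Sum>i<N. c i * z i) powr p) \<partial>Pi\<^sub>M {..<N} (\<lambda>_. \<mu>))
        \<le> ennreal (B * (\<Sum>i<N. norm (c i) powr s) powr (p / s))"
    using lp_norm_combination[OF p fin] by blast
  define H where "H = 2 powr p * (B + 1)"
  show ?thesis
  proof (rule exI[of _ H], intro conjI allI)
    show "0 < H" using B by (simp add: H_def)
    fix N :: nat
    let ?Q = "Pi\<^sub>M {..<N} (\<lambda>_. \<mu>)"
    note S(1)[measurable]
    \<comment> \<open>The discretization error is a sum over the coordinates and is made at most 1 in total.\<close>
    define d where "d = 1 / (real N powr p * real N + 1)"
    have d: "0 < d" "real N powr p * real N * d \<le> 1"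
      by (auto simp: d_def add_nonneg_pos divide_le_eq)
    have "eventually (\<lambda>n. (\<integral>\<^sup>+z. ennreal (norm (S n z - z) powr p) \<partial>\<mu>) < ennreal d) sequentially"
      using S(2) by (rule order_tendstoD(2)) (use d in simp)
    then obtain n0 where n0: "\<And>n. n \<ge> n0 \<Longrightarrow> (\<integral>\<^sup>+z. ennreal (norm (S n z - z) powr p) \<partial>\<mu>) < ennreal d"
      by (auto simp: eventually_sequentially)
    show "\<exists>n0. \<forall>n\<ge>n0. \<forall>c. (\<Sum>i<N. norm (c i) powr s) \<le> 1 \<longrightarrow>
       (\<integral>\<^sup>+z. ennreal (norm (\<Sum>i<N. c i * S n (z i)) powr p) \<partial>?Q) \<le> ennreal H"
    proof (rule exI[of _ n0], intro allI impI)
      fix n and c :: "nat \<Rightarrow> 'k" assume n: "n0 \<le> n" and c: "(\<Sum>i<N. norm (c i) powr s) \<le> 1"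
      have c1: "norm (c i) \<le> 1" if "i < N" for i
      proof (rule ccontr)
        assume "\<not> norm (c i) \<le> 1"
        then have "1 < norm (c i) powr s" using s by (intro gr_one_powr) auto
        also have "\<dots> \<le> (\<Sum>i<N. norm (c i) powr s)" using that by (intro member_le_sum) auto
        finally show False using c by simp
      qed
      let ?A = "\<lambda>z. norm (\<Sum>i<N. c i * z i) powr p" and ?D = "\<lambda>z. \<Sum>i<N. norm (S n (z i) - z i) powr p"
      have "(\<integral>\<^sup>+z. ennreal (norm (\<Sum>i<N. c i * S n (z i)) powr p) \<partial>?Q)
        \<le> (\<integral>\<^sup>+z. ennreal (2 powr p) * (ennreal (?A z) + ennreal (real N powr p) * (\<Sum>i<N. ennreal (norm (S n (z i) - z i) powr p))) \<partial>?Q)"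
      proof (rule nn_integral_mono)
        fix z :: "nat \<Rightarrow> 'k"
        let ?a = "\<lambda>b. if b then norm (\<Sum>i<N. c i * z i) else (\<Sum>i<N. norm (S n (z i) - z i))"
        have "(\<Sum>i<N. c i * S n (z i)) = (\<Sum>i<N. c i * z i) + (\<Sum>i<N. c i * (S n (z i) - z i))"
          by (simp add: algebra_simps flip: sum.distrib)
        then have "norm (\<Sum>i<N. c i * S n (z i)) \<le> norm (\<Sum>i<N. c i * z i) + norm (\<Sum>i<N. c i * (S n (z i) - z i))"
          by (simp add: norm_triangle_ineq)
        also have "norm (\<Sum>i<N. c i * (S n (z i) - z i)) \<le> (\<Sum>i<N. norm (S n (z i) - z i))"
          by (rule order_trans[OF norm_sum]) (auto simp: norm_mult intro!: sum_mono mult_left_le_one_le c1)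
        finally have "norm (\<Sum>i<N. c i * S n (z i)) powr p \<le> (\<Sum>b\<in>UNIV. ?a b) powr p"
          using p by (intro powr_mono2) (auto simp: UNIV_bool)
        also have "\<dots> \<le> real (card (UNIV :: bool set)) powr p * (\<Sum>b\<in>UNIV. ?a b powr p)"
          using p by (intro powr_sum_le) (auto simp: sum_nonneg)
        also have "\<dots> = 2 powr p * (?A z + (\<Sum>i<N. norm (S n (z i) - z i)) powr p)"
          by (simp add: UNIV_bool)
        also have "\<dots> \<le> 2 powr p * (?A z + real N powr p * ?D z)"
          using powr_sum_le[of "{..<N}" "\<lambda>i. norm (S n (z i) - z i)" p] p by (intro mult_left_mono add_left_mono) auto
        finally show "ennreal (norm (\<Sum>i<N. c i * S n (z i)) powr p)
          \<le> ennreal (2 powr p) * (ennreal (?A z) + ennreal (real N powr p) * (\<Sum>i<N. ennreal (norm (S n (z i) - z i) powr p)))"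
          by (subst sum_ennreal)
             (auto simp: ennreal_mult[symmetric] sum_nonneg intro: ennreal_leI simp flip: ennreal_plus)
      qed
      also have "\<dots> = ennreal (2 powr p) * ((\<integral>\<^sup>+z. ennreal (?A z) \<partial>?Q)
          + ennreal (real N powr p) * (\<Sum>i<N. (\<integral>\<^sup>+z. ennreal (norm (S n (z i) - z i) powr p) \<partial>?Q)))"
        by (subst nn_integral_cmult, measurable, subst nn_integral_add, measurable,
            subst nn_integral_cmult, measurable, subst nn_integral_sum, measurable)
      also have "\<dots> \<le> ennreal (2 powr p) * (ennreal B + ennreal (real N powr p) * (\<Sum>i<N. ennreal d))"
      proof (intro mult_left_mono add_mono sum_mono)
        have "B * (\<Sum>i<N. norm (c i) powr s) powr (p / s) \<le> B * 1"
          using c B(1) p s by (intro mult_left_mono powr_le1) (auto simp: sum_nonneg)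
        then show "(\<integral>\<^sup>+z. ennreal (?A z) \<partial>?Q) \<le> ennreal B"
          using B(2)[of N c] by (intro order_trans[OF B(2) ennreal_leI]) simp
        fix i assume i: "i \<in> {..<N}"
        have "(\<integral>\<^sup>+z. ennreal (norm (S n (z i) - z i) powr p) \<partial>?Q) = (\<integral>\<^sup>+z. ennreal (norm (S n z - z) powr p) \<partial>\<mu>)"
          using i by (intro nn_integral_component) auto
        then show "(\<integral>\<^sup>+z. ennreal (norm (S n (z i) - z i) powr p) \<partial>?Q) \<le> ennreal d"
          using n0[OF n] by simp
      qed auto
      also have "\<dots> = ennreal (2 powr p * (B + real N powr p * real N * d))"
        using B d by (simp add: ennreal_mult[symmetric] ennreal_of_nat_eq_real_of_nat mult_ac flip: ennreal_plus)
      also have "\<dots> \<le> ennreal H"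
        unfolding H_def using d by (intro ennreal_leI mult_left_mono) auto
      finally show "(\<integral>\<^sup>+z. ennreal (norm (\<Sum>i<N. c i * S n (z i)) powr p) \<partial>?Q) \<le> ennreal H" .
    qed
  qed
qed

end

text \<open>Integrating functions of \<open>f\<close> amounts to a finite sum with nodes \<open>h\<^sub>j\<close> and weights \<open>w\<^sub>j\<close>, which is the shape of
the sums that define summing norms.\<close>

lemma finite_range_quadrature:
  assumes "prob_space Q" and fin: "finite (f ` space Q)"
    and meas: "\<And>v. f -` {v} \<inter> space Q \<in> sets Q"
  shows "\<exists>(J::nat) h w. (\<forall>j<J. (0::real) \<le> w j \<and> h j \<in> f ` space Q) \<and>
     (\<forall>G. (\<integral>\<^sup>+z. G (f z) \<partial>Q) = (\<Sum>j<J. G (h j) * ennreal (w j)))"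
proof -
  interpret prob_space Q by fact
  obtain h where h: "bij_betw h {..<card (f ` space Q)} (f ` space Q)"
    using ex_bij_betw_nat_finite[OF fin] by (auto simp: atLeast0LessThan)
  let ?w = "\<lambda>j. prob (f -` {h j} \<inter> space Q)"
  have "(\<integral>\<^sup>+z. G (f z) \<partial>Q) = (\<Sum>j<card (f ` space Q). G (h j) * ennreal (?w j))" for G
  proof -
    have "(\<integral>\<^sup>+z. G (f z) \<partial>Q) = (\<Sum>v\<in>f ` space Q. G v * emeasure Q (f -` {v} \<inter> space Q))"
      by (rule nn_integral_finite_range) (use fin meas in auto)
    also have "\<dots> = (\<Sum>j<card (f ` space Q). G (h j) * emeasure Q (f -` {h j} \<inter> space Q))"
      by (rule sum.reindex_bij_betw[OF h, symmetric])
    finally show ?thesis by (simp add: emeasure_eq_measure)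
  qed
  moreover have "h j \<in> f ` space Q" if "j < card (f ` space Q)" for j
    using h that by (auto simp: bij_betw_def)
  ultimately show ?thesis
    by (intro exI[of _ "card (f ` space Q)"] exI[of _ h] exI[of _ ?w]) auto
qed

section \<open>The lower estimate and the equivalence\<close>

context stable_law
begin

text \<open>For a discretization \<open>f n\<close> of \<open>z\<close> with nodes \<open>h\<^sub>j\<close> and weights \<open>w\<^sub>j\<close>, the vectors \<open>x\<^sub>j = w\<^sub>j\<^bsup>1/p\<^esup> h\<^sub>j\<close> turn the \<open>p\<close>-th powers in
  the definition of the multiple summing norm into integrals: one side becomes the integral of
  \<open>\<parallel>T\<parallel>\<^sup>p\<close> over the discretized variables, and the weak norm of \<open>x\<close> becomes a supremum of \<open>L\<^sub>p\<close>-norms of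
  combinations, bounded by \<open>H\<^bsup>1/p\<^esup>\<close>. Fatou's lemma removes the discretization.\<close>

lemma integral_le_multiple_summing_norm:
  fixes sc :: "'k \<Rightarrow> 'x::real_normed_vector \<Rightarrow> 'x"
  assumes nsp: "normed_space_over sc" and conj: "conjugate r s"
    and p: "0 < p" and fin: "p < s \<or> s = 2"
  shows "\<exists>a>0. \<forall>N. \<forall>T \<in> cont_multilinear m (\<lambda>_. ell r N) (whole sc).
     ennreal a * Lp_integral_norm p m N \<mu> T \<le> multiple_summing_norm p m (\<lambda>_. ell r N) (whole sc) T"
proof -
  obtain S :: "nat \<Rightarrow> 'k \<Rightarrow> 'k" where S: "\<And>n. S n \<in> borel_measurable borel" "\<And>n. finite (range (S n))"
    "\<And>z. (\<lambda>n. S n z) \<longlonglongrightarrow> z" "(\<lambda>n. \<integral>\<^sup>+z. ennreal (norm (S n z - z) powr p) \<partial>\<mu>) \<longlonglongrightarrow> 0"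
    using simple_approximation[OF p fin] by blast
  obtain H :: real where H: "0 < H" "\<And>N::nat. \<exists>n0. \<forall>n\<ge>n0. \<forall>c. (\<Sum>i<N. norm (c i) powr s) \<le> 1 \<longrightarrow>
     (\<integral>\<^sup>+z. ennreal (norm (\<Sum>i<N. c i * S n (z i)) powr p) \<partial>Pi\<^sub>M {..<N} (\<lambda>_. \<mu>)) \<le> ennreal H"
    using simple_combination_bound[OF p fin S(1) S(4)] by blast
  define K where "K = (H powr (1 / p)) ^ m"
  have K: "0 < K" using H by (simp add: K_def)
  show ?thesis
  proof (rule exI[of _ "1 / K"], intro conjI allI ballI)
    fix N and T :: "(nat \<Rightarrow> nat \<Rightarrow> 'k) \<Rightarrow> 'x"
    assume T: "T \<in> cont_multilinear m (\<lambda>_. ell r N) (whole sc)"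
    let ?Q = "Pi\<^sub>M {..<N} (\<lambda>_. \<mu>)" and ?P = "pts (ell r N) :: (nat \<Rightarrow> 'k) set"
    define \<Phi> where "\<Phi> y = ennreal (norm (T (restrict y {..<m})) powr p)" for y
    define f where "f n z = trunc N (\<lambda>i. S n (z i))" for n and z :: "nat \<Rightarrow> 'k"
    have fP: "f n z \<in> ?P" for n z unfolding f_def by (rule trunc_pts)
    have f_meas: "f n \<in> borel_measurable ?Q" for n
    proof (rule measurable_coordinatewise_then_product)
      note S(1)[measurable]
      fix i show "(\<lambda>z. f n z i) \<in> borel_measurable ?Q"
        by (cases "i < N") (simp_all add: f_def trunc_def)
    qed
    have f_fin: "finite (f n ` space ?Q)" for n
    proof -
      have "f n ` space ?Q \<subseteq> trunc N ` (\<Pi>\<^sub>E i\<in>{..<N}. range (S n))"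
      proof
        fix v assume "v \<in> f n ` space ?Q"
        then obtain z where "v = f n z" by auto
        then have v: "v = trunc N (restrict (\<lambda>i. S n (z i)) {..<N})"
          by (auto simp: f_def trunc_def)
        show "v \<in> trunc N ` (\<Pi>\<^sub>E i\<in>{..<N}. range (S n))"
          unfolding v by (intro imageI, unfold restrict_PiE_iff) simp
      qed
      then show ?thesis
        using S(2) by (meson finite_PiE finite_imageI finite_lessThan finite_subset)
    qed
    have trunc_f: "trunc N (f n z) = f n z" for n z by (auto simp: f_def trunc_def)
    have meas: "(\<lambda>\<omega>. \<Phi> (\<lambda>k. if k \<in> I' then f n (\<omega> k) else y k)) \<in> borel_measurable (Pi\<^sub>M I' (\<lambda>_. ?Q))"
      if "I' \<subseteq> {..<m}" "\<And>k. y k \<in> ?P" for I' y n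
    proof -
      have "(\<lambda>\<omega>. ennreal (norm (T (restrict (\<lambda>k. if k \<in> I' then trunc N (f n (\<omega> k)) else y k) {..<m})) powr p))
          \<in> borel_measurable (Pi\<^sub>M I' (\<lambda>_. ?Q))"
        by (rule multilinear_measurable[OF nsp T that(1) that(2) f_meas])
      then show ?thesis by (simp only: \<Phi>_def trunc_f)
    qed
    from H(2)[of N] obtain n0 where n0': "\<forall>n\<ge>n0. \<forall>c. (\<Sum>i<N. norm (c i) powr s) \<le> 1 \<longrightarrow>
       (\<integral>\<^sup>+z. ennreal (norm (\<Sum>i<N. c i * S n (z i)) powr p) \<partial>?Q) \<le> ennreal H"
      by (rule exE)
    note n0 = n0'[rule_format]
    have main: "ennreal (1 / K) * Lp_integral_norm p m N \<mu> T \<le> ennreal C"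
      if C: "0 < C" and adm: "\<forall>J x. (\<forall>k<m. \<forall>j<J k. x k j \<in> ?P) \<longrightarrow>
          ennreal ((\<Sum>j \<in> (\<Pi>\<^sub>E k\<in>{..<m}. {..<J k}). norm (T (\<lambda>k\<in>{..<m}. x k (j k))) powr p) powr (1 / p))
            \<le> ennreal C * (\<Prod>k<m. weak_norm p (ell r N) (J k) (x k))" for C
    proof -
      have bound: "(\<integral>\<^sup>+\<omega>. \<Phi> (\<lambda>k. if k \<in> {..<m} then f n (\<omega> k) else (\<lambda>_. 0)) \<partial>Pi\<^sub>M {..<m} (\<lambda>_. ?Q)) \<le> ennreal ((C * K) powr p)"
        if n: "n0 \<le> n" for n
      proof -
        have pre: "f n -` {v} \<inter> space ?Q \<in> sets ?Q" for v
          using f_meas by (rule measurable_sets) simp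
        obtain J :: nat and h w where w: "\<And>j. j < J \<Longrightarrow> (0::real) \<le> w j" and h: "\<And>j. j < J \<Longrightarrow> h j \<in> f n ` space ?Q"
          and quad: "\<And>G. (\<integral>\<^sup>+z. G (f n z) \<partial>?Q) = (\<Sum>j<J. G (h j) * ennreal (w j))"
          using finite_range_quadrature[OF prob_space_power f_fin pre] by blast
        have hP: "h j \<in> ?P" if "j < J" for j using h[OF that] by (elim imageE) (simp only: fP)
        define x where "x j = (\<lambda>i. of_real (w j powr (1 / p)) * h j i)" for j
        have xP: "x j \<in> ?P" if "j < J" for j using hP[OF that] by (simp add: x_def)
        have wp: "(w j powr (1 / p)) powr p = w j" if "j < J" for j using w[OF that] p by (simp add: powr_powr)
        have weak: "weak_norm p (ell r N) J x \<le> ennreal (H powr (1 / p))"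
          unfolding weak_norm_def
        proof (rule SUP_least)
          fix \<gamma> :: "(nat \<Rightarrow> 'k) \<Rightarrow> 'k" assume \<gamma>: "\<gamma> \<in> dual_ball (ell r N)"
          let ?c = "\<lambda>i. \<gamma> (unit_vec i)"
          have lin: "lin_map (ell r N) (whole (*)) \<gamma>" using \<gamma> by (simp add: dual_ball_def)
          have "norm (\<gamma> (x j)) powr p = norm (\<Sum>i<N. ?c i * h j i) powr p * w j" if "j < J" for j
          proof -
            have "\<gamma> (x j) = of_real (w j powr (1 / p)) * (\<Sum>i<N. ?c i * h j i)"
              unfolding lin_map_ell_expand[OF lin xP[OF that]] by (simp add: x_def sum_distrib_left mult_ac)
            then show ?thesis by (simp add: norm_mult powr_mult wp[OF that])
          qed
          then have "ennreal (\<Sum>j<J. norm (\<gamma> (x j)) powr p) = (\<Sum>j<J. ennreal (norm (\<Sum>i<N. ?c i * h j i) powr p) * ennreal (w j))"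
            using w by (subst sum_ennreal[symmetric]) (auto simp: ennreal_mult)
          also have "\<dots> = (\<integral>\<^sup>+z. ennreal (norm (\<Sum>i<N. ?c i * f n z i) powr p) \<partial>?Q)"
            by (rule quad[symmetric])
          also have "\<dots> = (\<integral>\<^sup>+z. ennreal (norm (\<Sum>i<N. ?c i * S n (z i)) powr p) \<partial>?Q)"
            by (simp add: f_def trunc_def)
          also have "\<dots> \<le> ennreal H"
            by (rule n0[OF n dual_ball_coeffs[OF conj \<gamma>]])
          finally have "(\<Sum>j<J. norm (\<gamma> (x j)) powr p) \<le> H" using H by simp
          then show "ennreal ((\<Sum>j<J. norm (\<gamma> (x j)) powr p) powr (1 / p)) \<le> ennreal (H powr (1 / p))"
            using p by (intro ennreal_leI powr_mono2) (auto simp: sum_nonneg)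
        qed
        have "(\<integral>\<^sup>+\<omega>. \<Phi> (\<lambda>k. if k \<in> {..<m} then f n (\<omega> k) else (\<lambda>_. 0)) \<partial>Pi\<^sub>M {..<m} (\<lambda>_. ?Q))
          \<le> (\<Sum>j\<in>(\<Pi>\<^sub>E k\<in>{..<m}. {..<J}). \<Phi> (\<lambda>k. if k \<in> {..<m} then x (j k) else (\<lambda>_. 0)))"
        proof (rule multi_integral_le_sum[where P = ?P, OF prob_space_power finite_lessThan meas fP])
          fix k :: nat and y :: "nat \<Rightarrow> nat \<Rightarrow> 'k" assume k: "k \<in> {..<m}" and y: "\<And>k. y k \<in> ?P"
          have "\<Phi> (y(k := x j)) = \<Phi> (y(k := h j)) * ennreal (w j)" if j: "j < J" for j
          proof -
            have "norm (T (restrict (y(k := x j)) {..<m}))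
                = norm (of_real (w j powr (1 / p)) :: 'k) * norm (T (restrict (y(k := h j)) {..<m}))"
              unfolding x_def using k y hP[OF j] by (intro cont_multilinear_homogeneous[OF nsp T]) auto
            then show ?thesis
              using w[OF j] wp[OF j] by (simp add: \<Phi>_def powr_mult ennreal_mult mult.commute)
          qed
          then show "(\<integral>\<^sup>+z. \<Phi> (y(k := f n z)) \<partial>?Q) \<le> (\<Sum>j<J. \<Phi> (y(k := x j)))"
            unfolding quad[of "\<lambda>v. \<Phi> (y(k := v))"] by simp
        qed (use xP in auto)
        also have "\<dots> = ennreal (\<Sum>j \<in> (\<Pi>\<^sub>E k\<in>{..<m}. {..<J}). norm (T (\<lambda>k\<in>{..<m}. x (j k))) powr p)"
          unfolding \<Phi>_def restrict_if by (rule sum_ennreal) simp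
        also have "\<dots> \<le> ennreal ((C * K) powr p)"
        proof -
          let ?\<Sigma> = "\<Sum>j \<in> (\<Pi>\<^sub>E k\<in>{..<m}. {..<J}). norm (T (\<lambda>k\<in>{..<m}. x (j k))) powr p"
          have "ennreal (?\<Sigma> powr (1 / p)) \<le> ennreal C * (\<Prod>k<m. weak_norm p (ell r N) J x)"
            using adm[rule_format, of "\<lambda>_. J" "\<lambda>_. x"] xP by blast
          also have "\<dots> \<le> ennreal C * (\<Prod>k<m. ennreal (H powr (1 / p)))"
            using weak by (intro mult_left_mono prod_mono_ennreal) auto
          also have "\<dots> = ennreal (C * K)"
            using C by (simp add: K_def ennreal_power ennreal_mult)
          finally have "?\<Sigma> powr (1 / p) \<le> C * K" using C K by simp
          then have "(?\<Sigma> powr (1 / p)) powr p \<le> (C * K) powr p" using p by (intro powr_mono2) auto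
          then show ?thesis using p by (intro ennreal_leI) (simp add: powr_powr sum_nonneg)
        qed
        finally show ?thesis .
      qed
      have "(\<integral>\<^sup>+\<omega>. \<Phi> (\<lambda>k. trunc N (\<omega> k)) \<partial>Pi\<^sub>M {..<m} (\<lambda>_. ?Q))
          = (\<integral>\<^sup>+\<omega>. liminf (\<lambda>n. \<Phi> (\<lambda>k. if k \<in> {..<m} then f n (\<omega> k) else (\<lambda>_. 0))) \<partial>Pi\<^sub>M {..<m} (\<lambda>_. ?Q))"
      proof (rule nn_integral_cong)
        fix \<omega> :: "nat \<Rightarrow> nat \<Rightarrow> 'k"
        let ?F = "\<lambda>\<omega>. T (restrict (\<lambda>k. if k \<in> {..<m} then trunc N (\<omega> k) else (\<lambda>_. 0)) {..<m})"
        have "continuous_on UNIV ?F"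
          by (rule multilinear_continuous[OF nsp T]) auto
        moreover have "(\<lambda>n k i. S n (\<omega> k i)) \<longlonglongrightarrow> \<omega>"
          by (intro tendsto_funI S(3))
        ultimately have "(\<lambda>n. ?F (\<lambda>k i. S n (\<omega> k i))) \<longlonglongrightarrow> ?F \<omega>"
          by (rule continuous_on_tendsto_compose) auto
        then have "(\<lambda>n. norm (?F (\<lambda>k i. S n (\<omega> k i))) powr p) \<longlonglongrightarrow> norm (?F \<omega>) powr p"
          using p by (intro tendsto_powr' tendsto_norm tendsto_const) auto
        then have "(\<lambda>n. ennreal (norm (?F (\<lambda>k i. S n (\<omega> k i))) powr p)) \<longlonglongrightarrow> ennreal (norm (?F \<omega>) powr p)"
          by (rule tendsto_ennrealI)
        moreover have "ennreal (norm (?F (\<lambda>k i. S n (\<omega> k i))) powr p) = \<Phi> (\<lambda>k. if k \<in> {..<m} then f n (\<omega> k) else (\<lambda>_. 0))" for n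
          by (simp only: \<Phi>_def f_def)
        moreover have "ennreal (norm (?F \<omega>) powr p) = \<Phi> (\<lambda>k. trunc N (\<omega> k))"
          by (simp only: \<Phi>_def restrict_if)
        ultimately have "(\<lambda>n. \<Phi> (\<lambda>k. if k \<in> {..<m} then f n (\<omega> k) else (\<lambda>_. 0))) \<longlonglongrightarrow> \<Phi> (\<lambda>k. trunc N (\<omega> k))"
          by (simp only:)
        then show "\<Phi> (\<lambda>k. trunc N (\<omega> k)) = liminf (\<lambda>n. \<Phi> (\<lambda>k. if k \<in> {..<m} then f n (\<omega> k) else (\<lambda>_. 0)))"
          by (rule lim_imp_Liminf[symmetric, rotated]) simp
      qed
      also have "\<dots> \<le> liminf (\<lambda>n. \<integral>\<^sup>+\<omega>. \<Phi> (\<lambda>k. if k \<in> {..<m} then f n (\<omega> k) else (\<lambda>_. 0)) \<partial>Pi\<^sub>M {..<m} (\<lambda>_. ?Q))"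
        by (rule nn_integral_liminf) (rule meas, auto)
      also have "\<dots> \<le> limsup (\<lambda>n. \<integral>\<^sup>+\<omega>. \<Phi> (\<lambda>k. if k \<in> {..<m} then f n (\<omega> k) else (\<lambda>_. 0)) \<partial>Pi\<^sub>M {..<m} (\<lambda>_. ?Q))"
        by (rule Liminf_le_Limsup) simp
      also have "\<dots> \<le> ennreal ((C * K) powr p)"
        using bound by (intro Limsup_bounded) (auto simp: eventually_sequentially)
      finally have "Lp_integral_norm p m N \<mu> T \<le> ennreal (C * K)"
        using p C K by (intro Lp_integral_norm_le) (auto simp: \<Phi>_def)
      then have "ennreal (1 / K) * Lp_integral_norm p m N \<mu> T \<le> ennreal (1 / K) * ennreal (C * K)"
        by (rule mult_left_mono) simp
      also have "\<dots> = ennreal C"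
        using C K by (simp add: ennreal_mult[symmetric])
      finally show ?thesis .
    qed
    show "ennreal (1 / K) * Lp_integral_norm p m N \<mu> T \<le> multiple_summing_norm p m (\<lambda>_. ell r N) (whole sc) T"
      unfolding multiple_summing_norm_def whole_simps by (rule Inf_greatest) (use main in auto)
  qed (use K in simp)
qed

end

text \<open>Since \<open>enn2real\<close> sends \<open>\<infinity>\<close> to 0, its positivity excludes the pair \<open>r = 1\<close>, \<open>r' = \<infinity>\<close>.\<close>

lemma conjugate_exponents:
  assumes "1 \<le> r" "1 / r + 1 / r' = 1" "0 < enn2real r'"
  shows "r' = ennreal (enn2real r')" "conjugate r (enn2real r')" "r = 2 \<Longrightarrow> enn2real r' = 2"
proof -
  define s where "s = enn2real r'"
  have s: "0 < s" "r' = ennreal s"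
    using assms(3) by (cases r'; simp add: s_def)+
  have inv: "1 / ennreal x = ennreal (1 / x)" if "0 < x" for x
    using divide_ennreal[of 1 x] that by simp
  show "r' = ennreal (enn2real r')" using s(2) unfolding s_def .
  have "conjugate r s \<and> (r = 2 \<longrightarrow> s = 2)"
  proof (cases r)
    case top
    then have "ennreal (1 / s) = ennreal 1"
      using assms(2) s inv[of s] by simp
    then have "1 / s = 1" using s(1) by (subst (asm) ennreal_inj) auto
    then have "s = 1" using s(1) by simp
    then show ?thesis using top by (simp add: conjugate_def)
  next
    case (real \<rho>)
    then have \<rho>: "1 \<le> \<rho>" using assms(1) by simp
    have "ennreal (1 / \<rho> + 1 / s) = ennreal (1 / \<rho>) + ennreal (1 / s)"
      using \<rho> s by (intro ennreal_plus) auto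
    also have "\<dots> = ennreal 1"
      using assms(2) s real inv[of s] inv[of \<rho>] \<rho> by simp
    finally have "ennreal (1 / \<rho> + 1 / s) = ennreal 1" .
    then have eq: "1 / \<rho> + 1 / s = 1" using s \<rho> by (subst (asm) ennreal_inj) auto
    have "0 < 1 / s" using s by simp
    then have "1 / \<rho> < 1" using eq by linarith
    then have "1 < \<rho>" using \<rho> by (simp add: divide_less_eq)
    have "0 < 1 / \<rho>" using \<rho> by simp
    then have "1 / s < 1" using eq by linarith
    then have "1 < s" using s by (simp add: divide_less_eq)
    have "s = 2" if "r = 2"
    proof -
      have "ennreal \<rho> = ennreal 2" using that real by simp
      then have "\<rho> = 2" using \<rho> by (subst (asm) ennreal_inj) auto
      then show ?thesis using eq s by (simp add: field_simps)
    qed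
    then show ?thesis
      using \<open>1 < \<rho>\<close> \<open>1 < s\<close> eq real unfolding conjugate_def by blast
  qed
  then show "conjugate r (enn2real r')" "r = 2 \<Longrightarrow> enn2real r' = 2" unfolding s_def by blast+
qed

theorem proposition1p3:
  fixes m :: nat and r r' :: ennreal and p :: real
    and \<mu> :: "'k::{real_normed_field, euclidean_space} measure"
    and scX :: "'k \<Rightarrow> 'x::real_normed_vector \<Rightarrow> 'x"
    and scY :: "'k \<Rightarrow> 'y::banach \<Rightarrow> 'y"
  assumes "m \<ge> 1"
    and "1 \<le> r" and "1 / r + 1 / r' = 1"
    and "0 < p"
    and "stable_measure (enn2real r') \<mu>"
    and "normed_space_over scX"
    and "normed_space_over scY"
  shows "(\<forall>q::real. 1 \<le> q
      \<and> (r = 2 \<and> p < 2 \<and> q < 2 \<or> r = 2 \<and> q \<le> p \<or> ennreal p < r' \<and> r' < 2 \<and> q \<le> 2)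
      \<and> Lg_space q scX \<longrightarrow>
      (\<exists>a b::real. 0 < a \<and> a \<le> b \<and>
        (\<forall>N\<ge>1. \<forall>T \<in> cont_multilinear m (\<lambda>_. ell r N) (whole scX).
           ennreal a * Lp_integral_norm p m N \<mu> T
             \<le> multiple_summing_norm p m (\<lambda>_. ell r N) (whole scX) T
         \<and> multiple_summing_norm p m (\<lambda>_. ell r N) (whole scX) T
             \<le> ennreal b * Lp_integral_norm p m N \<mu> T)))
    \<and>
    (r = 2 \<or> ennreal p < r' \<and> r' < 2 \<longrightarrow>
      (\<exists>a::real. 0 < a \<and>
        (\<forall>N\<ge>1. \<forall>T \<in> cont_multilinear m (\<lambda>_. ell r N) (whole scY).
           ennreal a * Lp_integral_norm p m N \<mu> T
             \<le> multiple_summing_norm p m (\<lambda>_. ell r N) (whole scY) T)))"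
proof -
  define s where "s = enn2real r'"
  obtain \<kappa> where \<kappa>: "stable_law \<mu> s \<kappa>"
    using stable_measure_imp_stable_law[OF assms(5)] by (auto simp: s_def)
  interpret stable_law \<mu> s \<kappa> by fact
  have r': "r' = ennreal s" and conj: "conjugate r s" and two: "r = 2 \<Longrightarrow> s = 2"
    using conjugate_exponents[OF assms(2,3)] s(1) by (simp_all add: s_def)
  have fin: "p < s \<or> s = 2" if "r = 2 \<or> ennreal p < r' \<and> r' < 2"
    using that two \<open>0 < p\<close> s(1) by (auto simp: r' ennreal_less_iff)
  show ?thesis
  proof (intro conjI allI impI)
    fix q :: real
    assume q: "1 \<le> q
      \<and> (r = 2 \<and> p < 2 \<and> q < 2 \<or> r = 2 \<and> q \<le> p \<or> ennreal p < r' \<and> r' < 2 \<and> q \<le> 2)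
      \<and> Lg_space q scX"
    then have fin': "p < s \<or> s = 2" and pq: "q \<le> p \<or> q \<le> 2" using fin by auto
    obtain a where a: "0 < a" "\<forall>N. \<forall>T \<in> cont_multilinear m (\<lambda>_. ell r N) (whole scX).
       ennreal a * Lp_integral_norm p m N \<mu> T \<le> multiple_summing_norm p m (\<lambda>_. ell r N) (whole scX) T"
      using integral_le_multiple_summing_norm[OF assms(6) conj assms(4) fin', of m] by blast
    obtain b where b: "0 < b" "\<forall>N. \<forall>T \<in> cont_multilinear m (\<lambda>_. ell r N) (whole scX).
       multiple_summing_norm p m (\<lambda>_. ell r N) (whole scX) T \<le> ennreal b * Lp_integral_norm p m N \<mu> T"
      using multiple_summing_norm_le[OF assms(6) _ conj assms(4) _ fin' pq, of m] q by blast
    show "\<exists>a b::real. 0 < a \<and> a \<le> b \<and>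
        (\<forall>N\<ge>1. \<forall>T \<in> cont_multilinear m (\<lambda>_. ell r N) (whole scX).
           ennreal a * Lp_integral_norm p m N \<mu> T
             \<le> multiple_summing_norm p m (\<lambda>_. ell r N) (whole scX) T
         \<and> multiple_summing_norm p m (\<lambda>_. ell r N) (whole scX) T
             \<le> ennreal b * Lp_integral_norm p m N \<mu> T)"
    proof (rule exI[of _ a], rule exI[of _ "max a b"], intro conjI allI impI ballI)
      fix N :: nat and T :: "(nat \<Rightarrow> nat \<Rightarrow> 'k) \<Rightarrow> 'x"
      assume T: "T \<in> cont_multilinear m (\<lambda>_. ell r N) (whole scX)"
      show "ennreal a * Lp_integral_norm p m N \<mu> T \<le> multiple_summing_norm p m (\<lambda>_. ell r N) (whole scX) T"
        using a(2) T by blast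
      have "multiple_summing_norm p m (\<lambda>_. ell r N) (whole scX) T \<le> ennreal b * Lp_integral_norm p m N \<mu> T"
        using b(2) T by blast
      also have "\<dots> \<le> ennreal (max a b) * Lp_integral_norm p m N \<mu> T"
        by (intro mult_right_mono ennreal_leI) auto
      finally show "multiple_summing_norm p m (\<lambda>_. ell r N) (whole scX) T \<le> \<dots>" .
    qed (use a in auto)
  next
    assume "r = 2 \<or> ennreal p < r' \<and> r' < 2"
    from integral_le_multiple_summing_norm[OF assms(7) conj assms(4) fin[OF this], of m]
    show "\<exists>a::real. 0 < a \<and>
        (\<forall>N\<ge>1. \<forall>T \<in> cont_multilinear m (\<lambda>_. ell r N) (whole scY).
           ennreal a * Lp_integral_norm p m N \<mu> T
             \<le> multiple_summing_norm p m (\<lambda>_. ell r N) (whole scY) T)"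
      by blast
  qed
qed

end
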